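(* Let $\mathfrak{g}$ be a non-compact real simple Lie algebra without complex structure, with Cartan decomposition $\mathfrak{g}=\mathfrak{k}+\mathfrak{p}$. Then the number of minimal nilpotent $K_{\mathbb{C}}$-orbits in $\mathfrak{p}_{\mathbb{C}}$ is $1$ if $(\mathfrak{g},\mathfrak{k})$ is of non-Hermitian type, and $2$ if $(\mathfrak{g},\mathfrak{k})$ is of Hermitian type.
   Context: "Without complex structure" means that the complexification $\mathfrak{g}_{\mathbb{C}}$ is simple. $\mathfrak{g}_{\mathbb{C}}=\mathfrak{k}_{\mathbb{C}}+\mathfrak{p}_{\mathbb{C}}$ is the complexified Cartan decomposition and $K_{\mathbb{C}}$ is the connected complex subgroup of $\mathrm{Int}(\mathfrak{g}_{\mathbb{C}})$ with Lie algebra $\mathfrak{k}_{\mathbb{C}}$. A nilpotent $K_{\mathbb{C}}$-orbit is a $K_{\mathbb{C}}$-orbit of elements of $\mathfrak{p}_{\mathbb{C}}$ that are nilpotent in $\mathfrak{g}_{\mathbb{C}}$; the closure ordering is $\mathcal{O}_1\le\mathcal{O}_2$ iff $\mathcal{O}_1\subset\overline{\mathcal{O}_2}$. A nilpotent $K_{\mathbb{C}}$-orbit is called minimal if it is minimal, for the closure ordering, among the non-zero nilpotent $K_{\mathbb{C}}$-orbits in $\mathfrak{p}_{\mathbb{C}}$ (equivalently, if it is a non-zero one of smallest dimension). $(\mathfrak{g},\mathfrak{k})$ is of Hermitian type if $\mathfrak{k}$ has non-zero center, and of non-Hermitian type otherwise. *)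

theory Defs
  imports "HOL-Analysis.Analysis"
begin

section \<open>Lie algebras over a field\<close>

locale lie_algebra = vector_space scale
  for scale :: "'f::field \<Rightarrow> 'v::ab_group_add \<Rightarrow> 'v" +
  fixes br :: "'v \<Rightarrow> 'v \<Rightarrow> 'v"
  assumes br_add_left: "br (x + y) z = br x z + br y z"
    and br_add_right: "br x (y + z) = br x y + br x z"
    and br_scale_left: "br (scale c x) y = scale c (br x y)"
    and br_scale_right: "br x (scale c y) = scale c (br x y)"
    and br_self: "br x x = 0"
    and jacobi: "br x (br y z) + br y (br z x) + br z (br x y) = 0"
begin

definition lie_ideal :: "'v set \<Rightarrow> bool" where
  "lie_ideal I \<longleftrightarrow> subspace I \<and> (\<forall>x. \<forall>y\<in>I. br x y \<in> I)"

end

locale simple_lie_algebra = lie_algebra +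
  assumes nonabelian: "\<exists>x y. br x y \<noteq> 0"
    and ideal_trivial: "lie_ideal I \<Longrightarrow> I = {0} \<or> I = UNIV"

definition ad_nilpotent :: "('v \<Rightarrow> 'v \<Rightarrow> 'v::zero) \<Rightarrow> 'v \<Rightarrow> bool" where
  "ad_nilpotent br x \<longleftrightarrow> (\<exists>n. \<forall>y. (br x ^^ n) y = 0)"

text \<open>The centre of a subalgebra \<open>k\<close>, taken inside \<open>k\<close>.\<close>

definition lie_center :: "('v \<Rightarrow> 'v \<Rightarrow> 'v::zero) \<Rightarrow> 'v set \<Rightarrow> 'v set" where
  "lie_center br k = {z \<in> k. \<forall>x\<in>k. br z x = 0}"


section \<open>Groups of inner automorphisms\<close>

definition exp_map :: "('v \<Rightarrow> 'v) \<Rightarrow> 'v \<Rightarrow> 'v::real_normed_vector" where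
  "exp_map f v = (\<Sum>n. (f ^^ n) v /\<^sub>R fact n)"

text \<open>
  For a subalgebra \<open>h\<close>, the connected Lie subgroup of the general linear group with Lie algebra
  \<open>ad h\<close> is the set of all finite products of exponentials \<open>exp (ad x)\<close>, \<open>x \<in> h\<close>. It is closed
  under inverses, since \<open>exp (ad x)\<close> has inverse \<open>exp (ad (- x))\<close>.
\<close>

inductive_set adjoint_group ::
    "('v \<Rightarrow> 'v \<Rightarrow> 'v::real_normed_vector) \<Rightarrow> 'v set \<Rightarrow> ('v \<Rightarrow> 'v) set"
  for br h where
  one: "id \<in> adjoint_group br h"
| mult: "x \<in> h \<Longrightarrow> g \<in> adjoint_group br h \<Longrightarrow> exp_map (br x) \<circ> g \<in> adjoint_group br h"

text \<open>\<open>Int g\<close> is compact; the topology is that of the operator norm.\<close>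

definition compact_lie_algebra :: "('a \<Rightarrow> 'a \<Rightarrow> 'a::euclidean_space) \<Rightarrow> bool" where
  "compact_lie_algebra br \<longleftrightarrow> compact (Blinfun ` adjoint_group br UNIV)"


section \<open>Cartan decompositions of real Lie algebras\<close>

text \<open>
  A finite-dimensional real Lie algebra is a bracket on a type of class
  \<^class>\<open>euclidean_space\<close>. The inner product of that class is unrelated to the bracket: it only
  provides the vector space topology and an expression for the trace, neither of which depends
  on its choice.
\<close>

definition endo_trace :: "('a \<Rightarrow> 'a::euclidean_space) \<Rightarrow> real" where
  "endo_trace f = (\<Sum>b\<in>Basis. f b \<bullet> b)"

definition killing_form :: "('a \<Rightarrow> 'a \<Rightarrow> 'a::euclidean_space) \<Rightarrow> 'a \<Rightarrow> 'a \<Rightarrow> real" where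
  "killing_form br x y = endo_trace (br x \<circ> br y)"

definition cartan_involution ::
    "('a \<Rightarrow> 'a \<Rightarrow> 'a::euclidean_space) \<Rightarrow> ('a \<Rightarrow> 'a) \<Rightarrow> bool" where
  "cartan_involution br \<theta> \<longleftrightarrow>
     linear \<theta> \<and> (\<forall>x y. \<theta> (br x y) = br (\<theta> x) (\<theta> y)) \<and> (\<forall>x. \<theta> (\<theta> x) = x) \<and>
     (\<forall>x. x \<noteq> 0 \<longrightarrow> - killing_form br x (\<theta> x) > 0)"

definition cartan_decomposition ::
    "('a \<Rightarrow> 'a \<Rightarrow> 'a::euclidean_space) \<Rightarrow> 'a set \<Rightarrow> 'a set \<Rightarrow> bool" where
  "cartan_decomposition br k p \<longleftrightarrow>
     (\<exists>\<theta>. cartan_involution br \<theta> \<and> k = {x. \<theta> x = x} \<and> p = {x. \<theta> x = - x})"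

definition hermitian_type :: "('a \<Rightarrow> 'a \<Rightarrow> 'a::euclidean_space) \<Rightarrow> 'a set \<Rightarrow> bool" where
  "hermitian_type br k \<longleftrightarrow> lie_center br k \<noteq> {0}"


section \<open>Complexification\<close>

text \<open>The pair \<open>(x, y)\<close> stands for \<open>x + i y\<close>.\<close>

definition cscale :: "complex \<Rightarrow> 'a \<times> 'a \<Rightarrow> 'a \<times> 'a::real_vector" where
  "cscale c v = (Re c *\<^sub>R fst v - Im c *\<^sub>R snd v, Re c *\<^sub>R snd v + Im c *\<^sub>R fst v)"

definition cbracket ::
    "('a \<Rightarrow> 'a \<Rightarrow> 'a) \<Rightarrow> 'a \<times> 'a \<Rightarrow> 'a \<times> 'a \<Rightarrow> 'a \<times> 'a::real_vector" where
  "cbracket br v w =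
     (br (fst v) (fst w) - br (snd v) (snd w), br (fst v) (snd w) + br (snd v) (fst w))"

definition complexify :: "'a set \<Rightarrow> ('a \<times> 'a) set" where
  "complexify s = s \<times> s"

lemma lie_algebra_complexification:
  fixes br :: "'a::real_vector \<Rightarrow> 'a \<Rightarrow> 'a"
  assumes "lie_algebra scaleR br"
  shows "lie_algebra cscale (cbracket br)"
proof -
  interpret L: lie_algebra scaleR br by fact
  have zero: "br 0 y = 0" "br y 0 = 0" for y
    using L.br_scale_left[of 0 0 y] L.br_scale_right[of y 0 0] by simp_all
  have minus: "br (- x) y = - br x y" "br x (- y) = - br x y" for x y
    using L.br_scale_left[of "-1" x y] L.br_scale_right[of x "-1" y] by simp_all
  have diff: "br (x - y) z = br x z - br y z" "br z (x - y) = br z x - br z y" for x y z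
    using L.br_add_left[of x "- y" z] L.br_add_right[of z x "- y"] by (simp_all add: minus)
  have swap: "br x y + br y x = 0" for x y
    using L.br_self[of "x + y"] L.br_self[of x] L.br_self[of y]
    by (simp add: L.br_add_left L.br_add_right add.commute)
  have jac: "br x (br y z) = - br y (br z x) - br z (br x y)" for x y z
    using L.jacobi[of x y z] by (simp add: algebra_simps eq_neg_iff_add_eq_0)
  note bil = L.br_add_left L.br_add_right L.br_scale_left L.br_scale_right diff
  show ?thesis
  proof unfold_locales
    fix x y z :: "'a \<times> 'a" and c d :: complex
    show "cscale c (x + y) = cscale c x + cscale c y"
      "cscale (c + d) x = cscale c x + cscale d x"
      "cscale c (cscale d x) = cscale (c * d) x"
      "cscale 1 x = x"
      by (simp_all add: cscale_def prod_eq_iff algebra_simps)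
    show "cbracket br (x + y) z = cbracket br x z + cbracket br y z"
      "cbracket br x (y + z) = cbracket br x y + cbracket br x z"
      "cbracket br (cscale c x) y = cscale c (cbracket br x y)"
      "cbracket br x (cscale c y) = cscale c (cbracket br x y)"
      by (simp_all add: cbracket_def cscale_def prod_eq_iff bil algebra_simps)
    show "cbracket br x x = 0"
      by (simp add: cbracket_def prod_eq_iff L.br_self swap)
    show "cbracket br x (cbracket br y z) + cbracket br y (cbracket br z x)
        + cbracket br z (cbracket br x y) = 0"
      by (simp add: cbracket_def prod_eq_iff bil
          jac[of "fst x" "fst y" "fst z"] jac[of "fst x" "fst y" "snd z"]
          jac[of "fst x" "snd y" "fst z"] jac[of "snd x" "fst y" "fst z"]
          jac[of "fst x" "snd y" "snd z"] jac[of "snd x" "fst y" "snd z"]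
          jac[of "snd x" "snd y" "fst z"] jac[of "snd x" "snd y" "snd z"])
  qed
qed


section \<open>Nilpotent orbits\<close>

definition K_orbit ::
    "('a \<Rightarrow> 'a \<Rightarrow> 'a::euclidean_space) \<Rightarrow> 'a set \<Rightarrow> 'a \<times> 'a \<Rightarrow> ('a \<times> 'a) set" where
  "K_orbit br k v = {g v | g. g \<in> adjoint_group (cbracket br) (complexify k)}"

definition nilpotent_K_orbits ::
    "('a \<Rightarrow> 'a \<Rightarrow> 'a::euclidean_space) \<Rightarrow> 'a set \<Rightarrow> 'a set \<Rightarrow> ('a \<times> 'a) set set" where
  "nilpotent_K_orbits br k p =
     {K_orbit br k v | v. v \<in> complexify p \<and> ad_nilpotent (cbracket br) v}"

definition minimal_nilpotent_K_orbits ::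
    "('a \<Rightarrow> 'a \<Rightarrow> 'a::euclidean_space) \<Rightarrow> 'a set \<Rightarrow> 'a set \<Rightarrow> ('a \<times> 'a) set set" where
  "minimal_nilpotent_K_orbits br k p =
     {U \<in> nilpotent_K_orbits br k p - {{0}}.
        \<forall>V \<in> nilpotent_K_orbits br k p - {{0}}. V \<subseteq> closure U \<longrightarrow> V = U}"

end

theory Submission
  imports Defs
begin

text \<open>
  Write \<open>kC\<close>, \<open>pC\<close> for the complexifications and give the complexified algebra the inner product
  \<open>Q\<close> coming from the Killing form and the Cartan involution; elements of \<open>i k\<close> act symmetrically.
  Simplicity shows that \<open>pC\<close> is an irreducible \<open>kC\<close>-module if \<open>k\<close> has no centre (a proper submodule
  would produce a derivation, hence a central element of \<open>k\<close>), and the sum of two irreducible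
  modules, the eigenspaces of a central element, otherwise.

  In an irreducible \<open>W\<close> maximise \<open>Q [H, w] w\<close> over unit vectors \<open>H \<in> i k\<close>, \<open>w \<in> W\<close>. Then \<open>w\<close> plays
  the role of a highest weight vector: it spans the top eigenspace of \<open>H\<close> over the complex numbers.
  The closure of a nilpotent orbit is a cone, because a nilpotent \<open>x \<in> pC\<close> satisfies \<open>[h, x] = x\<close>
  for some \<open>h \<in> kC\<close>; contracting along \<open>H\<close> shows that any such cone meeting \<open>W - {0}\<close> contains \<open>w\<close>.
  Conversely a nilpotent \<open>x \<noteq> 0\<close> in \<open>W\<close> and in the closure of the orbit of \<open>w\<close> can be moved by unipotent
  elements to \<open>w + n\<close> with \<open>n\<close> orthogonal to \<open>[kC, w]\<close>, and since the dimension of \<open>[kC, x]\<close> is lower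
  semicontinuous in \<open>x\<close>, \<open>n\<close> vanishes. Hence each irreducible summand contributes exactly one
  minimal orbit.

  Non-compactness is needed only for \<open>p \<noteq> {0}\<close>: if the Killing form is negative definite, then the
  automorphisms near the identity are inner, so \<open>Int g\<close> is closed in a compact orthogonal group.
\<close>

section \<open>Exponentials of linear maps\<close>

text \<open>Mutual containment in closures does not by itself identify two orbits. The classical
  remedy, that the boundary of an orbit consists of orbits of smaller dimension, rests on orbits
  being locally closed varieties. Here the group is only a set of finite products of exponentials,
  without manifold or variety structure. Hence the dimension of \<open>[kC, x]\<close> stands in for
  that of an orbit, and points of the orbit of \<open>w\<close> are recognised by an explicit chain
  of unipotent moves.

  The joint maximum replaces Cartan subalgebras and weights. Maximality in \<open>w\<close> makes
  \<open>w\<close> an eigenvector of \<open>H\<close>. Maximality in \<open>H\<close>, used for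
  every unit vector of the top eigenspace, makes each element of \<open>i k\<close> that commutes
  with \<open>H\<close> and is orthogonal to it act there by zero. So the centralizer of
  \<open>H\<close> acts on \<open>w\<close> by complex scalars, and lowering from \<open>w\<close>
  alone fills \<open>W\<close>.\<close>

lemma linear_funpow:
  fixes f :: "'a::real_vector \<Rightarrow> 'a"
  assumes "linear f"
  shows "linear (f ^^ n)"
proof (induction n)
  case 0
  then show ?case by (simp add: linear_id[unfolded id_def] id_def)
next
  case (Suc n)
  then show ?case using linear_compose[OF Suc assms] by (simp add: o_def)
qed

lemma funpow_norm_bound:
  fixes f :: "'a::real_normed_vector \<Rightarrow> 'a"
  assumes "\<And>x. norm (f x) \<le> C * norm x" "C \<ge> 0"
  shows "norm ((f ^^ n) x) \<le> C ^ n * norm x"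
proof (induction n)
  case (Suc n)
  have "norm ((f ^^ Suc n) x) \<le> C * norm ((f ^^ n) x)" using assms(1) by simp
  also have "\<dots> \<le> C * (C ^ n * norm x)" using Suc assms(2) by (intro mult_left_mono)
  finally show ?case by (simp add: mult.assoc)
qed simp

lemma exp_map_norm_summable:
  fixes f :: "'a::euclidean_space \<Rightarrow> 'a"
  assumes "linear f"
  shows "summable (\<lambda>n. norm ((f ^^ n) v /\<^sub>R fact n))"
proof -
  obtain C where C: "C \<ge> 0" "\<And>x. norm (f x) \<le> C * norm x"
    using linear_bounded_pos[OF assms] by (metis less_imp_le)
  have "summable (\<lambda>n. (C ^ n /\<^sub>R fact n) * norm v)"
    by (intro summable_mult2 summable_exp_generic)
  then show ?thesis
  proof (rule summable_comparison_test')
    fix n :: nat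
    have "norm ((f ^^ n) v) / fact n \<le> (C ^ n * norm v) / fact n"
      by (intro divide_right_mono funpow_norm_bound C) simp
    then show "norm (norm ((f ^^ n) v /\<^sub>R fact n)) \<le> (C ^ n /\<^sub>R fact n) * norm v"
      by (simp add: divide_inverse mult_ac)
  qed
qed

lemma exp_map_sums:
  fixes f :: "'a::euclidean_space \<Rightarrow> 'a"
  assumes "linear f"
  shows "(\<lambda>n. (f ^^ n) v /\<^sub>R fact n) sums exp_map f v"
  unfolding exp_map_def
  by (rule summable_sums[OF summable_norm_cancel[OF exp_map_norm_summable[OF assms]]])

text \<open>\<open>g\<close> passes through the limit of the series. The cases used are
  \<open>f\<close> itself, a scaling and the complex structure \<open>J\<close>.\<close>

lemma exp_map_intertwine:
  fixes f :: "'a::euclidean_space \<Rightarrow> 'a" and f' :: "'b::euclidean_space \<Rightarrow> 'b"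
  assumes "linear f" "linear f'" "linear g" and comm: "\<And>x. g (f x) = f' (g x)"
  shows "g (exp_map f v) = exp_map f' (g v)"
proof -
  have pow: "g ((f ^^ n) v) = (f' ^^ n) (g v)" for n
    by (induction n) (simp_all add: comm)
  have "(\<lambda>n. g ((f ^^ n) v /\<^sub>R fact n)) sums g (exp_map f v)"
    using bounded_linear.sums[OF linear_conv_bounded_linear[THEN iffD1, OF assms(3)] exp_map_sums[OF assms(1)]] .
  then have "(\<lambda>n. (f' ^^ n) (g v) /\<^sub>R fact n) sums g (exp_map f v)"
    by (simp add: linear_scale[OF assms(3)] pow)
  then show ?thesis
    using exp_map_sums[OF assms(2)] by (rule sums_unique2)
qed

lemma exp_map_linear:
  fixes f :: "'a::euclidean_space \<Rightarrow> 'a"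
  assumes "linear f"
  shows "linear (exp_map f)"
proof (rule linearI)
  fix x y :: 'a and c :: real
  have "(\<lambda>n. (f ^^ n) x /\<^sub>R fact n + (f ^^ n) y /\<^sub>R fact n) sums (exp_map f x + exp_map f y)"
    by (intro sums_add exp_map_sums assms)
  then have "(\<lambda>n. (f ^^ n) (x + y) /\<^sub>R fact n) sums (exp_map f x + exp_map f y)"
    by (simp add: linear_add[OF linear_funpow[OF assms]] scaleR_add_right)
  then show "exp_map f (x + y) = exp_map f x + exp_map f y"
    using exp_map_sums[OF assms] by (rule sums_unique2[symmetric])
  show "exp_map f (c *\<^sub>R x) = c *\<^sub>R exp_map f x"
    using exp_map_intertwine[OF assms assms, of "\<lambda>x. c *\<^sub>R x"]
    by (simp add: linear_scale[OF assms] linear_scale_self)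
qed

lemma funpow_scaleR:
  fixes f :: "'a::real_vector \<Rightarrow> 'a"
  assumes "linear f"
  shows "((\<lambda>x. t *\<^sub>R f x) ^^ n) v = t ^ n *\<^sub>R (f ^^ n) v"
  by (induction n) (simp_all add: linear_scale[OF assms])

text \<open>Each coordinate is an everywhere convergent real power series in \<open>t\<close>, so
  real termwise differentiation applies; the differentiated series is the one at \<open>f v\<close>,
  and \<open>f\<close> commutes with its own exponential.\<close>

lemma exp_map_has_vector_derivative:
  fixes f :: "'a::euclidean_space \<Rightarrow> 'a"
  assumes "linear f"
  shows "((\<lambda>t. exp_map (\<lambda>x. t *\<^sub>R f x) v) has_vector_derivative
           f (exp_map (\<lambda>x. t *\<^sub>R f x) v)) (at t)"
proof -
  have lin: "linear (\<lambda>x. s *\<^sub>R f x)" for s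
    using assms by (rule linear_compose_scale_right)
  have comm: "f (exp_map (\<lambda>x. t *\<^sub>R f x) v) = exp_map (\<lambda>x. t *\<^sub>R f x) (f v)"
    by (intro exp_map_intertwine lin assms) (simp add: linear_scale[OF assms])
  have "((\<lambda>t. exp_map (\<lambda>x. t *\<^sub>R f x) v \<bullet> b) has_derivative
      (\<lambda>s. (s *\<^sub>R f (exp_map (\<lambda>x. t *\<^sub>R f x) v)) \<bullet> b)) (at t)" for b
  proof -
    define c where "c = (\<lambda>n. ((f ^^ n) v \<bullet> b) / fact n)"
    have sums: "(\<lambda>n. ((f ^^ n) w \<bullet> b) / fact n * s ^ n) sums (exp_map (\<lambda>x. s *\<^sub>R f x) w \<bullet> b)" for s w
      using bounded_linear.sums[OF bounded_linear_inner_left exp_map_sums[OF lin[of s], of w], of b]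
      by (simp add: funpow_scaleR[OF assms] divide_inverse mult_ac)
    have c_sums: "(\<lambda>n. c n * s ^ n) sums (exp_map (\<lambda>x. s *\<^sub>R f x) v \<bullet> b)" for s
      using sums[of v s] by (simp add: c_def)
    have diffs: "diffs c = (\<lambda>n. ((f ^^ n) (f v) \<bullet> b) / fact n)"
      by (rule ext) (simp add: diffs_def c_def funpow_swap1 del: of_nat_Suc)
    have "((\<lambda>s. \<Sum>n. c n * s ^ n) has_field_derivative (\<Sum>n. diffs c n * t ^ n)) (at t)"
      by (rule termdiffs_strong_converges_everywhere) (use c_sums sums_summable in blast)
    moreover have "(\<Sum>n. diffs c n * t ^ n) = exp_map (\<lambda>x. t *\<^sub>R f x) (f v) \<bullet> b"
      using sums[of "f v" t] by (simp add: diffs sums_iff)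
    moreover have "(\<lambda>s. \<Sum>n. c n * s ^ n) = (\<lambda>s. exp_map (\<lambda>x. s *\<^sub>R f x) v \<bullet> b)"
      using c_sums by (simp add: sums_iff)
    ultimately show ?thesis
      by (simp add: has_field_derivative_def comm mult_commute_abs)
  qed
  then show ?thesis
    unfolding has_vector_derivative_def
    by (subst has_derivative_componentwise_within) blast
qed

lemma exp_map_zero: "exp_map (\<lambda>x. 0) v = (v::'a::real_normed_vector)"
proof -
  have "((\<lambda>x::'a. 0::'a) ^^ n) v = 0" if "n > 0" for n
    using that by (cases n) auto
  then have "exp_map (\<lambda>x. 0) v = (\<Sum>n\<in>{0}. ((\<lambda>x::'a. 0::'a) ^^ n) v /\<^sub>R fact n)"
    unfolding exp_map_def by (intro suminf_finite) auto
  then show ?thesis by simp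
qed

text \<open>Gronwall's argument: with \<open>norm (f x) \<le> C * norm x\<close>, the weight
  \<open>exp (- 2 * C * t)\<close> turns \<open>u t \<bullet> u t\<close> into a nonincreasing
  function, which starts at 0.\<close>

lemma linear_ode_zero_forward:
  fixes f :: "'a::euclidean_space \<Rightarrow> 'a"
  assumes "linear f" and deriv: "\<And>t. (u has_vector_derivative f (u t)) (at t)"
    and "u 0 = 0" and "t \<ge> 0"
  shows "u t = 0"
proof -
  obtain C where C: "\<And>x. norm (f x) \<le> C * norm x"
    using linear_bounded_pos[OF assms(1)] by metis
  define \<phi> where "\<phi> = (\<lambda>t. exp (- 2 * C * t) * (u t \<bullet> u t))"
  have der: "(\<phi> has_real_derivative
      exp (- 2 * C * s) * (2 * (u s \<bullet> f (u s)) - 2 * C * (u s \<bullet> u s))) (at s)" for s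
  proof -
    have "((\<lambda>t. u t \<bullet> u t) has_real_derivative 2 * (u s \<bullet> f (u s))) (at s)"
      using has_derivative_inner[OF deriv[of s, unfolded has_vector_derivative_def]
          deriv[of s, unfolded has_vector_derivative_def]]
      unfolding has_field_derivative_def
      by (rule has_derivative_eq_rhs) (auto simp: inner_commute algebra_simps)
    then show ?thesis
      unfolding \<phi>_def by (auto intro!: derivative_eq_intros simp: algebra_simps)
  qed
  have "\<phi> t \<le> \<phi> 0"
  proof (rule DERIV_nonpos_imp_nonincreasing[OF \<open>t \<ge> 0\<close>])
    fix s :: real
    have "u s \<bullet> f (u s) \<le> norm (u s) * norm (f (u s))" by (rule norm_cauchy_schwarz)
    also have "\<dots> \<le> norm (u s) * (C * norm (u s))" by (intro mult_left_mono C) simp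
    finally have "u s \<bullet> f (u s) \<le> C * (u s \<bullet> u s)"
      by (simp add: dot_square_norm power2_eq_square mult_ac)
    then show "\<exists>y. (\<phi> has_real_derivative y) (at s) \<and> y \<le> 0"
      using der[of s] by (intro exI conjI) (auto simp: mult_nonneg_nonpos)
  qed
  then have "u t \<bullet> u t \<le> 0"
    using \<open>u 0 = 0\<close> by (simp add: \<phi>_def mult_le_0_iff)
  then show ?thesis by (metis inner_gt_zero_iff not_less)
qed

text \<open>The source of the exponential identities below: both sides solve the same linear
  equation, so no series are multiplied out. Negative times are reduced to positive ones by
  reversing \<open>t\<close>.\<close>

lemma linear_ode_unique:
  fixes f :: "'a::euclidean_space \<Rightarrow> 'a"
  assumes "linear f" and deriv: "\<And>t. (w has_vector_derivative f (w t)) (at t)"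
  shows "w t = exp_map (\<lambda>x. t *\<^sub>R f x) (w 0)"
proof -
  define u where "u = (\<lambda>t. w t - exp_map (\<lambda>x. t *\<^sub>R f x) (w 0))"
  have u: "(u has_vector_derivative f (u t)) (at t)" for t
    unfolding u_def linear_diff[OF assms(1)]
    by (intro has_vector_derivative_diff deriv exp_map_has_vector_derivative assms)
  have u0: "u 0 = 0" by (simp add: u_def exp_map_zero)
  have "u t = 0"
  proof (cases "t \<ge> 0")
    case True
    show ?thesis by (rule linear_ode_zero_forward[OF assms(1) u u0 True])
  next
    case False
    have "((\<lambda>t. u (- t)) has_vector_derivative - f (u (- s))) (at s)" for s
      using vector_diff_chain_at[of uminus "-1" s u "f (u (- s))"] u[of "- s"]
      by (simp add: o_def has_vector_derivative_minus[OF has_vector_derivative_id])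
    from linear_ode_zero_forward[OF linear_compose_neg[OF assms(1)] this, of "- t"] u0 False
    show ?thesis by simp
  qed
  then show ?thesis by (simp add: u_def)
qed




lemma exp_map_minus:
  fixes f :: "'a::euclidean_space \<Rightarrow> 'a"
  assumes "linear f"
  shows "exp_map (\<lambda>x. - f x) (exp_map f v) = v"
proof -
  have lin: "linear (\<lambda>x. s *\<^sub>R f x)" for s
    using assms by (rule linear_compose_scale_right)
  \<comment> \<open>Time runs backwards from 1, so \<open>w 0\<close> is the inner exponential and
    \<open>w 1\<close> is \<open>v\<close>.\<close>
  define w where "w = (\<lambda>t. exp_map (\<lambda>x. (1 - t) *\<^sub>R f x) v)"
  have "(w has_vector_derivative - f (w t)) (at t)" for t
  proof -
    have "((\<lambda>t. 1 - t) has_vector_derivative - 1) (at t)"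
      unfolding has_real_derivative_iff_has_vector_derivative[symmetric]
      by (auto intro!: derivative_eq_intros)
    from vector_diff_chain_at[OF this, of "\<lambda>t. exp_map (\<lambda>x. t *\<^sub>R f x) v"]
      exp_map_has_vector_derivative[OF assms, of v "1 - t"]
    show ?thesis by (simp add: w_def o_def)
  qed
  from linear_ode_unique[OF linear_compose_neg[OF assms] this, of 1]
  show ?thesis by (simp add: w_def exp_map_zero)
qed

text \<open>By the Leibniz rule the product of the two flows solves the equation of
  \<open>f\<close>. With the bracket as product this makes \<open>exp (ad x)\<close> an
  automorphism, with an invariant form an isometry.\<close>

lemma exp_map_bilinear:
  fixes f :: "'a::euclidean_space \<Rightarrow> 'a" and h :: "'b::euclidean_space \<Rightarrow> 'b"
    and g :: "'c::euclidean_space \<Rightarrow> 'c"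
  assumes "bounded_bilinear pr" "linear f" "linear h" "linear g"
    and "\<And>x y. f (pr x y) = pr (h x) y + pr x (g y)"
  shows "exp_map f (pr x y) = pr (exp_map h x) (exp_map g y)"
proof -
  define w where "w = (\<lambda>t. pr (exp_map (\<lambda>x. t *\<^sub>R h x) x) (exp_map (\<lambda>x. t *\<^sub>R g x) y))"
  have "(w has_vector_derivative f (w t)) (at t)" for t
    unfolding w_def
    using bounded_bilinear.has_vector_derivative[OF assms(1)
      exp_map_has_vector_derivative[OF assms(3), of x t]
      exp_map_has_vector_derivative[OF assms(4), of y t]]
    by (simp add: assms(5) add.commute)
  from linear_ode_unique[OF assms(2) this, of 1]
  show ?thesis by (simp add: w_def exp_map_zero)
qed

lemma exp_map_skew:
  fixes f :: "'a::euclidean_space \<Rightarrow> 'a"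
  assumes "bounded_bilinear Q" "linear f" and "\<And>x y. Q (f x) y + Q x (f y) = 0"
  shows "Q (exp_map f x) (exp_map f y) = (Q x y :: real)"
  using exp_map_bilinear[OF assms(1) linear_zero assms(2,2), of x y] assms(3)
  by (simp add: exp_map_zero)

section \<open>Remainder of the exponential series beyond the first order\<close>

lemma exp_map_tail_sums:
  fixes f :: "'a::euclidean_space \<Rightarrow> 'a"
  assumes "linear f"
  shows "(\<lambda>n. (f ^^ (n + 2)) v /\<^sub>R fact (n + 2)) sums (exp_map f v - v - f v)"
  using sums_split_initial_segment[OF exp_map_sums[OF assms, of v], of 2]
  by (simp add: numeral_2_eq_2 diff_diff_eq)

text \<open>Neither \<open>v\<close> nor \<open>f v\<close> need lie in \<open>S\<close>, but all
  terms from the second order on do. In the normal form of extremal orbits this places the error of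
  a first-order correction at lower eigenvalues.\<close>

lemma exp_map_second_order_mem:
  fixes f :: "'a::euclidean_space \<Rightarrow> 'a"
  assumes "linear f" "subspace S" "\<And>x. x \<in> S \<Longrightarrow> f x \<in> S" "f (f v) \<in> S"
  shows "exp_map f v - v - f v \<in> S"
proof -
  have pow: "(f ^^ (n + 2)) v \<in> S" for n
    by (induction n) (simp_all add: assms)
  have "(\<Sum>i<n. (f ^^ (i + 2)) v /\<^sub>R fact (i + 2)) \<in> S" for n
    by (intro subspace_sum[OF assms(2)] subspace_scale[OF assms(2)] pow)
  then show ?thesis
    using exp_map_tail_sums[OF assms(1), of v] unfolding sums_def
    by (intro Lim_in_closed_set[OF closed_subspace[OF assms(2)], of _ sequentially]) auto
qed

lemma exp_map_mem:
  fixes f :: "'a::euclidean_space \<Rightarrow> 'a"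
  assumes "linear f" "subspace S" "\<And>x. x \<in> S \<Longrightarrow> f x \<in> S" "v \<in> S"
  shows "exp_map f v \<in> S"
proof -
  have "exp_map f v - v - f v \<in> S"
    by (intro exp_map_second_order_mem assms)
  moreover have "v + f v \<in> S" by (intro subspace_add assms)
  ultimately have "(exp_map f v - v - f v) + (v + f v) \<in> S" by (rule subspace_add[OF assms(2)])
  then show ?thesis by simp
qed

lemma exp_map_eigenvector:
  fixes f :: "'a::euclidean_space \<Rightarrow> 'a"
  assumes "linear f" "f v = c *\<^sub>R v"
  shows "exp_map f v = exp c *\<^sub>R v"
proof -
  have "((\<lambda>t. exp (t * c) *\<^sub>R v) has_vector_derivative f (exp (t * c) *\<^sub>R v)) (at t)" for t
  proof -
    have "((\<lambda>t. exp (t * c)) has_vector_derivative (exp (t * c) * c)) (at t)"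
      unfolding has_real_derivative_iff_has_vector_derivative[symmetric]
      by (auto intro!: derivative_eq_intros)
    then have "((\<lambda>t. exp (t * c) *\<^sub>R v) has_vector_derivative ((exp (t * c) * c) *\<^sub>R v)) (at t)"
      by (rule bounded_linear.has_vector_derivative[OF bounded_linear_scaleR_left])
    then show ?thesis by (simp add: assms linear_scale[OF assms(1)])
  qed
  from linear_ode_unique[OF assms(1) this, of 1] show ?thesis by simp
qed

section \<open>Symmetric operators for an arbitrary inner product\<close>

lemma linear_span_mem:
  assumes "linear f" "subspace S" "x \<in> span B" "\<And>b. b \<in> B \<Longrightarrow> f b \<in> S"
  shows "f x \<in> S"
  using assms(3)
proof (rule span_induct)
  show "subspace {x. f x \<in> S}"
    using assms(1,2) by (auto simp: subspace_def linear_0 linear_add linear_scale)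
qed (use assms(4) in blast)

lemma span_pair: "x \<in> span {a, b} \<longleftrightarrow> (\<exists>s t. x = s *\<^sub>R a + t *\<^sub>R b)"
proof
  assume "x \<in> span {a, b}"
  then obtain s where "x - s *\<^sub>R a \<in> span {b}" using span_breakdown_eq by blast
  then obtain t where "x - s *\<^sub>R a = t *\<^sub>R b" by (auto simp: span_singleton)
  then have "x = s *\<^sub>R a + t *\<^sub>R b" by (simp add: algebra_simps)
  then show "\<exists>s t. x = s *\<^sub>R a + t *\<^sub>R b" by blast
next
  assume "\<exists>s t. x = s *\<^sub>R a + t *\<^sub>R b"
  then show "x \<in> span {a, b}" by (auto intro!: span_add span_scale intro: span_base)
qed

lemma subspace_eigenspace:
  assumes "linear f" "subspace S"
  shows "subspace {v \<in> S. f v = c *\<^sub>R v}"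
  using assms by (auto simp: subspace_def linear_0 linear_add linear_scale scaleR_add_right)

text \<open>The inner product of the type is arbitrary, whereas the spectral arguments need forms
  adapted to the bracket. The locale is applied to \<open>q\<close> on the real algebra, to
  \<open>Q\<close> on its complexification and to the negative of a negative definite Killing
  form.\<close>

locale inner_form =
  fixes Q :: "'a::euclidean_space \<Rightarrow> 'a \<Rightarrow> real"
  assumes bilinear: "bilinear Q"
    and sym: "Q x y = Q y x"
    and pos: "x \<noteq> 0 \<Longrightarrow> Q x x > 0"
begin

lemma lin_right: "linear (Q x)"
  using bilinear by (auto simp: bilinear_def)

lemma add_left: "Q (x + y) z = Q x z + Q y z" and add_right: "Q z (x + y) = Q z x + Q z y"
  and diff_left: "Q (x - y) z = Q x z - Q y z" and diff_right: "Q z (x - y) = Q z x - Q z y"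
  and minus_left: "Q (- x) z = - Q x z" and minus_right: "Q z (- x) = - Q z x"
  and scale_left: "Q (c *\<^sub>R x) z = c * Q x z" and scale_right: "Q z (c *\<^sub>R x) = c * Q z x"
  and zero_left: "Q 0 z = 0" and zero_right: "Q z 0 = 0"
  using bilinear
  by (simp_all add: bilinear_ladd bilinear_radd bilinear_lsub bilinear_rsub bilinear_lneg
      bilinear_rneg bilinear_lmul bilinear_rmul bilinear_lzero bilinear_rzero)

lemmas bilinear_simps = add_left add_right diff_left diff_right minus_left minus_right
  scale_left scale_right zero_left zero_right

lemma eq_zero: "Q x x = 0 \<Longrightarrow> x = 0"
  using pos[of x] by auto

lemma nonneg: "Q x x \<ge> 0"
  using pos[of x] by (cases "x = 0") (auto simp: zero_left)

lemma bounded_bilinear: "bounded_bilinear Q"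
  using bilinear bilinear_conv_bounded_bilinear by blast

lemma continuous_quadratic: "continuous_on S (\<lambda>x. Q (f x) (g x))"
  if "continuous_on S f" "continuous_on S g"
  using bounded_bilinear.continuous_on[OF bounded_bilinear that] .

lemma projection_span_finite:
  assumes "finite B"
  shows "\<exists>s\<in>span B. \<forall>t\<in>span B. Q (x - s) t = 0"
  using assms
proof (induction B arbitrary: x)
  case empty
  then show ?case by (simp add: zero_right)
next
  case (insert a B)
  obtain s where s: "s \<in> span B" "\<And>t. t \<in> span B \<Longrightarrow> Q (x - s) t = 0"
    using insert.IH by blast
  obtain r where r: "r \<in> span B" "\<And>t. t \<in> span B \<Longrightarrow> Q (a - r) t = 0"
    using insert.IH by blast
  define a' where "a' = a - r"
  \<comment> \<open>If \<open>a\<close> already lies in \<open>span B\<close> then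
    \<open>a' = 0\<close> and \<open>c\<close> is 0 by division by zero, which is harmless.\<close>
  define c where "c = Q x a' / Q a' a'"
  have sub: "t \<in> span B \<Longrightarrow> t \<in> span (insert a B)" for t
    using span_mono[of B "insert a B"] by auto
  have "a' \<in> span (insert a B)"
    unfolding a'_def by (intro span_diff sub[OF r(1)] span_base) simp
  then have mem: "s + c *\<^sub>R a' \<in> span (insert a B)"
    by (intro span_add span_scale sub[OF s(1)])
  have orth: "Q (x - (s + c *\<^sub>R a')) t = 0" if "t \<in> span B" for t
    using s(2)[OF that] r(2)[OF that] by (simp add: a'_def bilinear_simps)
  have "Q (x - (s + c *\<^sub>R a')) a' = 0"
  proof (cases "a' = 0")
    case False
    then show ?thesis using r(2)[OF s(1)] pos[OF False] sym
      by (simp add: bilinear_simps c_def a'_def[symmetric])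
  qed (simp add: zero_right)
  then have "Q (x - (s + c *\<^sub>R a')) a = 0"
    using orth[OF r(1)] by (simp add: a'_def bilinear_simps)
  moreover have "\<exists>k. t - k *\<^sub>R a \<in> span B" if "t \<in> span (insert a B)" for t
    using that span_breakdown_eq by blast
  ultimately have "Q (x - (s + c *\<^sub>R a')) t = 0" if "t \<in> span (insert a B)" for t
  proof -
    assume a: "Q (x - (s + c *\<^sub>R a')) a = 0"
    obtain k where "t - k *\<^sub>R a \<in> span B" using \<open>t \<in> span (insert a B)\<close> span_breakdown_eq by blast
    from orth[OF this] a show ?thesis by (simp add: diff_right scale_right)
  qed
  then show ?case using mem by blast
qed

lemma projection_ex:
  assumes "subspace S"
  shows "\<exists>s\<in>S. \<forall>t\<in>S. Q (x - s) t = 0"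
proof -
  obtain B where "finite B" "span B = S"
    using basis_exists[of S] assms by (metis finiteI_independent span_subspace)
  then show ?thesis using projection_span_finite by blast
qed

lemma projection_unique:
  assumes "subspace S" "s \<in> S" "s' \<in> S" "\<And>t. t \<in> S \<Longrightarrow> Q (x - s) t = 0" "\<And>t. t \<in> S \<Longrightarrow> Q (x - s') t = 0"
  shows "s = s'"
proof -
  have "s - s' \<in> S" using assms subspace_diff by blast
  then have "Q (s - s') (s - s') = 0"
    using assms(4,5)[of "s - s'"] by (simp add: bilinear_simps)
  then show ?thesis using eq_zero by fastforce
qed

lemma lower_bound: "\<exists>c>0. \<forall>x. c * (norm x)\<^sup>2 \<le> Q x x"
proof -
  have cont: "continuous_on A (\<lambda>x. Q x x)" for A
    by (intro continuous_quadratic continuous_intros)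
  obtain c where c: "c > 0" "\<And>x. norm x = 1 \<Longrightarrow> c \<le> Q x x"
  proof (cases "sphere (0::'a) 1 = {}")
    case True
    then show ?thesis using that[of 1] by force
  next
    case False
    then obtain x where "x \<in> sphere 0 1" "\<And>y. y \<in> sphere 0 1 \<Longrightarrow> Q x x \<le> Q y y"
      using continuous_attains_inf[of "sphere 0 1", OF _ _ cont] by auto
    moreover then have "x \<noteq> 0" by auto
    ultimately show ?thesis using that[of "Q x x"] pos[of x] by auto
  qed
  have "c * (norm x)\<^sup>2 \<le> Q x x" for x
  proof (cases "x = 0")
    case False
    then have "c \<le> Q (x /\<^sub>R norm x) (x /\<^sub>R norm x)" by (intro c) simp
    also have "\<dots> = Q x x / (norm x)\<^sup>2"
      by (simp add: scale_left scale_right power2_eq_square divide_inverse)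
    finally show ?thesis using False by (simp add: field_simps)
  qed (simp add: zero_left)
  then show ?thesis using c(1) by blast
qed

lemma unit_compact:
  assumes "closed S"
  shows "compact {x \<in> S. Q x x = 1}"
proof -
  have cont: "continuous_on A (\<lambda>x. Q x x)" for A
    by (intro continuous_quadratic continuous_intros)
  have clo: "closed {x \<in> S. Q x x = 1}"
    using continuous_closed_preimage_constant[OF cont assms] by blast
  obtain c where c: "c > 0" "\<And>x. c * (norm x)\<^sup>2 \<le> Q x x" using lower_bound by blast
  have "norm x \<le> sqrt (1 / c)" if "Q x x = 1" for x
  proof -
    have "(norm x)\<^sup>2 \<le> 1 / c" using c(1) c(2)[of x] that by (simp add: field_simps)
    then show ?thesis by (rule real_le_rsqrt)
  qed
  then have "bounded {x \<in> S. Q x x = 1}" unfolding bounded_iff by blast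
  with clo show ?thesis using compact_eq_bounded_closed by blast
qed

lemma unit_nonempty:
  assumes "subspace S" "x \<in> S" "x \<noteq> 0"
  shows "\<exists>c>0. c *\<^sub>R x \<in> S \<and> Q (c *\<^sub>R x) (c *\<^sub>R x) = 1"
proof -
  have "Q x x > 0" using pos assms by blast
  then have "inverse (sqrt (Q x x)) > 0" and
    "Q (inverse (sqrt (Q x x)) *\<^sub>R x) (inverse (sqrt (Q x x)) *\<^sub>R x) = 1"
    by (simp_all add: scale_left scale_right flip: mult.assoc inverse_mult_distrib)
  then show ?thesis using subspace_scale[OF assms(1,2)] by blast
qed

text \<open>First variation in the direction of the residual \<open>r\<close>: along
  \<open>w + t *\<^sub>R r\<close> the maximum bounds the linear term \<open>2 * t * Q r r\<close>
  by a term quadratic in \<open>t\<close>, so \<open>r = 0\<close>.\<close>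

lemma rayleigh_maximizer:
  assumes "subspace S" "linear A" "\<And>x. x \<in> S \<Longrightarrow> A x \<in> S"
    and symA: "\<And>x y. x \<in> S \<Longrightarrow> y \<in> S \<Longrightarrow> Q (A x) y = Q x (A y)"
    and w: "w \<in> S" "Q w w = 1"
    and max: "\<And>x. x \<in> S \<Longrightarrow> Q x x = 1 \<Longrightarrow> Q (A x) x \<le> Q (A w) w"
  shows "A w = Q (A w) w *\<^sub>R w"
proof -
  define m where "m = Q (A w) w"
  define r where "r = A w - m *\<^sub>R w"
  have rS: "r \<in> S" unfolding r_def using assms w by (intro subspace_diff subspace_scale) auto
  have le: "Q (A x) x \<le> m * Q x x" if xS: "x \<in> S" for x
  proof (cases "x = 0")
    case True
    then show ?thesis by (simp add: linear_0[OF assms(2)] zero_left)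
  next
    case False
    obtain c where c: "c > 0" "c *\<^sub>R x \<in> S" "Q (c *\<^sub>R x) (c *\<^sub>R x) = 1"
      using unit_nonempty[OF assms(1) xS False] by blast
    have "c * c * Q (A x) x \<le> m"
      using max[OF c(2,3)] by (simp add: linear_scale[OF assms(2)] scale_left scale_right m_def mult.assoc)
    also have "m = c * c * (m * Q x x)" using c(3) by (simp add: scale_left scale_right mult_ac)
    finally show ?thesis using c(1) by (simp add: mult_le_cancel_left)
  qed
  have ineq: "2 * t * Q r r \<le> t * t * (m * Q r r - Q (A r) r)" for t
  proof -
    have wr: "Q w (A r) = Q (A w) r" using symA[OF w(1) rS] by simp
    have "Q r z = Q (A w) z - m * Q w z" for z by (simp add: r_def bilinear_simps)
    then have rr: "Q r r = Q (A w) r - m * Q w r" .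
    have "Q (A (w + t *\<^sub>R r)) (w + t *\<^sub>R r) \<le> m * Q (w + t *\<^sub>R r) (w + t *\<^sub>R r)"
      using rS w by (intro le subspace_add subspace_scale assms(1))
    moreover have "Q (A r) w = Q (A w) r" using wr sym by simp
    ultimately have "m + 2 * t * Q (A w) r + t * t * Q (A r) r \<le> m * (1 + 2 * t * Q w r + t * t * Q r r)"
      using w(2) sym[of r w]
      by (simp add: linear_add[OF assms(2)] linear_scale[OF assms(2)] bilinear_simps m_def algebra_simps)
    moreover have e: "Q (A w) r = Q r r + m * Q w r" using rr by simp
    ultimately show ?thesis unfolding e by (simp add: algebra_simps)
  qed
  have "Q r r \<le> 0"
  proof (rule ccontr)
    assume "\<not> Q r r \<le> 0"
    then have p: "Q r r > 0" by simp
    define k where "k = \<bar>m * Q r r - Q (A r) r\<bar> + 1"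
    define t where "t = Q r r / k"
    have k: "k > 0" "m * Q r r - Q (A r) r \<le> k" by (auto simp: k_def)
    have t: "t > 0" using p k by (simp add: t_def)
    have "2 * t * Q r r \<le> t * t * k"
      using ineq[of t] k(2) t by (meson mult_left_mono order_trans zero_le_square)
    also have "\<dots> = t * Q r r" using k by (simp add: t_def)
    finally show False using t p by (simp add: mult_le_cancel_right)
  qed
  then have "r = 0" using eq_zero nonneg[of r] by force
  then show ?thesis by (simp add: r_def m_def)
qed

lemma eigenvector_ex:
  assumes "subspace S" "linear A" "\<And>x. x \<in> S \<Longrightarrow> A x \<in> S"
    and symA: "\<And>x y. x \<in> S \<Longrightarrow> y \<in> S \<Longrightarrow> Q (A x) y = Q x (A y)"
    and "S \<noteq> {0}"
  shows "\<exists>w\<in>S. w \<noteq> 0 \<and> (\<exists>c. A w = c *\<^sub>R w)"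
proof -
  obtain x where "x \<in> S" "x \<noteq> 0" using assms(5) subspace_0[OF assms(1)] by auto
  then have ne: "{x \<in> S. Q x x = 1} \<noteq> {}"
    using unit_nonempty[OF assms(1)] by blast
  have "continuous_on {x \<in> S. Q x x = 1} (\<lambda>x. Q (A x) x)"
    by (intro continuous_quadratic continuous_intros linear_continuous_on
        linear_conv_bounded_linear[THEN iffD1] assms(2))
  then obtain w where w: "w \<in> S" "Q w w = 1"
    and max: "\<And>x. x \<in> S \<Longrightarrow> Q x x = 1 \<Longrightarrow> Q (A x) x \<le> Q (A w) w"
    using continuous_attains_sup[OF unit_compact[OF closed_subspace[OF assms(1)]] ne] by blast
  have "w \<noteq> 0" using w(2) zero_left by auto
  then show ?thesis using rayleigh_maximizer[OF assms(1,2,3,4) w max] w(1) by blast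
qed

text \<open>The vectors of \<open>S\<close> orthogonal to all eigenvectors form an invariant
  subspace; if nonzero, it would contain an eigenvector, orthogonal to itself.\<close>

lemma span_eigenvectors:
  assumes "subspace S" "linear A" and inv: "\<And>x. x \<in> S \<Longrightarrow> A x \<in> S"
    and symA: "\<And>x y. x \<in> S \<Longrightarrow> y \<in> S \<Longrightarrow> Q (A x) y = Q x (A y)"
  shows "span {x \<in> S. \<exists>c. A x = c *\<^sub>R x} = S" (is "span ?E = S")
proof (rule ccontr)
  assume neq: "span ?E \<noteq> S"
  have sub: "span ?E \<subseteq> S" by (rule span_minimal[OF _ assms(1)]) auto
  define T where "T = {x \<in> S. \<forall>e\<in>?E. Q x e = 0}"
  have T: "subspace T"
    using assms(1) unfolding T_def subspace_def by (auto simp: bilinear_simps)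
  obtain x where x: "x \<in> S" "x \<notin> span ?E" using neq sub by blast
  obtain s where s: "s \<in> span ?E" "\<And>t. t \<in> span ?E \<Longrightarrow> Q (x - s) t = 0"
    using projection_ex[OF subspace_span] by blast
  have "x - s \<in> S" using x s sub subspace_diff[OF assms(1)] by blast
  moreover have "Q (x - s) e = 0" if "e \<in> ?E" for e using s(2) span_base[OF that] .
  ultimately have "x - s \<in> T" unfolding T_def by blast
  moreover have "x - s \<noteq> 0" using x s by auto
  ultimately have "T \<noteq> {0}" by blast
  moreover have "A x \<in> T" if "x \<in> T" for x
  proof -
    have "Q (A x) e = 0" if e: "e \<in> ?E" for e
    proof -
      obtain c where c: "A e = c *\<^sub>R e" "e \<in> S" using e by blast
      have "Q (A x) e = c * Q x e" using symA[of x e] c \<open>x \<in> T\<close> by (simp add: T_def scale_right)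
      also have "\<dots> = 0" using \<open>x \<in> T\<close> e by (simp add: T_def)
      finally show ?thesis .
    qed
    then show ?thesis using that inv by (simp add: T_def)
  qed
  ultimately obtain w where w: "w \<in> T" "w \<noteq> 0" "\<exists>c. A w = c *\<^sub>R w"
    using eigenvector_ex[OF T assms(2)] symA by (metis (no_types, lifting) T_def mem_Collect_eq)
  then have "w \<in> ?E" "\<forall>e\<in>?E. Q w e = 0" unfolding T_def by blast+
  then have "Q w w = 0" by blast
  then show False using eq_zero w(2) by blast
qed

lemma eigenvectors_orthogonal:
  assumes "Q (A x) y = Q x (A y)" "A x = c *\<^sub>R x" "A y = d *\<^sub>R y" "c \<noteq> d"
  shows "Q x y = 0"
  using assms by (simp add: scale_left scale_right)

text \<open>Eigenvectors chosen for distinct eigenvalues are orthogonal, hence independent.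
  Finiteness lets the later normal form descend from one eigenvalue to the next.\<close>

lemma finite_eigenvalues:
  assumes symA: "\<And>x y. Q (A x) y = Q x (A y)"
  shows "finite {c. \<exists>x. x \<noteq> 0 \<and> A x = c *\<^sub>R x}" (is "finite ?L")
proof -
  define v where "v c = (SOME x. x \<noteq> 0 \<and> A x = c *\<^sub>R x)" for c
  have v: "v c \<noteq> 0" "A (v c) = c *\<^sub>R v c" if "c \<in> ?L" for c
    using someI_ex[of "\<lambda>x. x \<noteq> 0 \<and> A x = c *\<^sub>R x"] that by (auto simp: v_def)
  have orth: "Q (v c) (v d) = 0" if "c \<in> ?L" "d \<in> ?L" "c \<noteq> d" for c d
    using eigenvectors_orthogonal[OF symA v(2)[OF that(1)] v(2)[OF that(2)] that(3)] .
  have inj: "inj_on v ?L"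
  proof (rule inj_onI)
    fix c d assume cd: "c \<in> ?L" "d \<in> ?L" "v c = v d"
    then show "c = d" using orth[OF cd(1,2)] eq_zero v(1)[OF cd(2)] by metis
  qed
  have "independent (v ` ?L)"
    unfolding dependent_def
  proof safe
    fix c x assume c: "x \<noteq> 0" "A x = c *\<^sub>R x" "v c \<in> span (v ` ?L - {v c})"
    then have cL: "c \<in> ?L" by blast
    have "Q (v c) y = 0" if "y \<in> span (v ` ?L - {v c})" for y
      using that
    proof (rule span_induct)
      show "subspace {y. Q (v c) y = 0}" by (auto simp: subspace_def bilinear_simps)
      fix y assume "y \<in> v ` ?L - {v c}"
      then show "Q (v c) y = 0" using orth[OF cL] by auto
    qed
    then show False using c(3) eq_zero v(1)[OF cL] by blast
  qed
  then have "finite (v ` ?L)" by (rule independent_imp_finite)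
  then show ?thesis using inj finite_imageD by blast
qed

text \<open>The test vector \<open>x + A x\<close> polarises the quadratic form: the cross terms add
  up to \<open>2 * Q (A x) (A x)\<close>.\<close>

lemma symmetric_zero_form:
  assumes "subspace S" "linear A" "\<And>x. x \<in> S \<Longrightarrow> A x \<in> S"
    and "\<And>x y. x \<in> S \<Longrightarrow> y \<in> S \<Longrightarrow> Q (A x) y = Q x (A y)"
    and zero: "\<And>x. x \<in> S \<Longrightarrow> Q (A x) x = 0" and "x \<in> S"
  shows "A x = 0"
proof -
  have "Q (A (x + A x)) (x + A x) = 0"
    by (intro zero subspace_add[OF assms(1)] assms(3,6))
  moreover have "Q (A (A x)) x = Q (A x) (A x)" using assms(3,4,6) by simp
  ultimately have "2 * Q (A x) (A x) = 0"
    using zero[of x] zero[of "A x"] assms(3,6) by (simp add: linear_add[OF assms(2)] bilinear_simps)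
  then show ?thesis using eq_zero by simp
qed

text \<open>In the plane of \<open>y\<close> and the normalised \<open>x\<close>, the vector
  \<open>v\<close> is the gradient of \<open>L\<close>. After normalisation \<open>L\<close> takes
  the value \<open>N\<close> on it, which exceeds \<open>L y\<close> unless the coefficient
  \<open>a\<close> vanishes.\<close>

lemma functional_maximizer:
  assumes "subspace S" "linear L" "y \<in> S" "Q y y = 1" "L y > 0"
    and max: "\<And>x. x \<in> S \<Longrightarrow> Q x x = 1 \<Longrightarrow> L x \<le> L y" and x: "x \<in> S" "Q x y = 0"
  shows "L x = (0::real)"
proof (cases "x = 0")
  case True
  then show ?thesis by (simp add: linear_0[OF assms(2)])
next
  case False
  obtain c where c: "c > 0" "c *\<^sub>R x \<in> S" "Q (c *\<^sub>R x) (c *\<^sub>R x) = 1"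
    using unit_nonempty[OF assms(1) x(1) False] by blast
  define x' a v N where "x' = c *\<^sub>R x" and "a = L x'" and "v = L y *\<^sub>R y + a *\<^sub>R x'" and "N = sqrt ((L y)\<^sup>2 + a\<^sup>2)"
  have N: "N > 0" "N\<^sup>2 = (L y)\<^sup>2 + a\<^sup>2" using assms(5) by (auto simp: N_def add_pos_nonneg)
  have "Q x' y = 0" using x(2) by (simp add: x'_def scale_left)
  then have "Q v v = (L y)\<^sup>2 + a\<^sup>2"
    using assms(4) c(3) sym[of y x'] by (simp add: v_def bilinear_simps power2_eq_square x'_def[symmetric])
  then have "Q v v = N\<^sup>2" using N(2) by simp
  then have "Q (v /\<^sub>R N) (v /\<^sub>R N) = 1" using N(1) by (simp add: scale_left scale_right power2_eq_square field_simps)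
  moreover have "v /\<^sub>R N \<in> S"
    unfolding v_def using c(2) assms(1,3) by (intro subspace_scale subspace_add) (auto simp: x'_def)
  ultimately have "L (v /\<^sub>R N) \<le> L y" by (intro max)
  moreover have "L v = (L y)\<^sup>2 + a\<^sup>2"
    by (simp add: v_def linear_add[OF assms(2)] linear_scale[OF assms(2)] a_def power2_eq_square)
  then have "L v = N\<^sup>2" using N(2) by simp
  then have "L (v /\<^sub>R N) = N" using N(1) by (simp add: linear_scale[OF assms(2)] power2_eq_square)
  ultimately have "N \<le> L y" by simp
  then have "N\<^sup>2 \<le> (L y)\<^sup>2" using N(1) by (intro power_mono) auto
  then have "a = 0" using N(2) by simp
  then show ?thesis using c(1) by (simp add: a_def x'_def linear_scale[OF assms(2)])
qed



end


section \<open>Ranks of linear maps\<close>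

lemma linear_expand:
  fixes f :: "'a::euclidean_space \<Rightarrow> 'b::real_vector"
  assumes "linear f"
  shows "f u = (\<Sum>b\<in>Basis. (u \<bullet> b) *\<^sub>R f b)"
  using linear_sum[OF assms, of "\<lambda>b. (u \<bullet> b) *\<^sub>R b" Basis]
  by (simp add: euclidean_representation linear_scale[OF assms])

text \<open>On a subspace \<open>S\<close> that \<open>A\<close> maps injectively onto its range, a
  map \<open>F j\<close> of smaller rank kills a unit vector. A limit of these vectors is killed by
  \<open>A\<close>; pointwise convergence suffices because \<open>F j\<close> is expanded in a
  finite basis.\<close>

lemma rank_lower_semicontinuous:
  fixes A :: "'a::euclidean_space \<Rightarrow> 'b::euclidean_space"
  assumes lin: "\<And>j::nat. linear (F j)" "linear A"
    and lim: "\<And>u. (\<lambda>j. F j u) \<longlonglongrightarrow> A u" and rank: "\<And>j. dim (range (F j)) \<le> d"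
  shows "dim (range A) \<le> d"
proof (rule ccontr)
  assume neg: "\<not> dim (range A) \<le> d"
  obtain g where g: "linear g" "\<And>v. v \<in> range A \<Longrightarrow> A (g v) = v"
    using linear_exists_right_inverse_on[OF lin(2) subspace_UNIV] by blast
  define S where "S = g ` range A"
  have rA: "subspace (range A)" using linear_subspace_image[OF lin(2) subspace_UNIV] .
  have S: "subspace S" unfolding S_def using linear_subspace_image[OF g(1) rA] .
  have injA: "A u = 0 \<Longrightarrow> u \<in> S \<Longrightarrow> u = 0" for u
    unfolding S_def using g linear_0[OF g(1)] by auto
  have "inj_on g (span (range A))" using g(2) rA by (metis inj_on_inverseI span_eq_iff)
  then have dS: "dim S = dim (range A)" unfolding S_def by (rule dim_image_eq[OF g(1)])
  have "\<exists>q\<in>S. norm q = 1 \<and> F j q = 0" for j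
  proof -
    have "\<not> inj_on (F j) S"
    proof
      assume "inj_on (F j) S"
      then have "dim (F j ` S) = dim S"
        using dim_image_eq[OF lin(1)[of j], of S] S by (metis span_eq_iff)
      moreover have "dim (F j ` S) \<le> dim (range (F j))" by (intro dim_subset) auto
      ultimately show False using neg dS rank[of j] by linarith
    qed
    then obtain q where q: "q \<in> S" "q \<noteq> 0" "F j q = 0"
      using linear_inj_on_iff_eq_0[OF lin(1) S] by blast
    then show ?thesis
      by (intro bexI[of _ "q /\<^sub>R norm q"]) (auto simp: linear_scale[OF lin(1)] subspace_scale[OF S])
  qed
  then obtain q where q: "\<And>j. q j \<in> S" "\<And>j. norm (q j) = 1" "\<And>j. F j (q j) = 0" by metis
  have "compact (S \<inter> sphere 0 1)" using closed_subspace[OF S] by (intro closed_Int_compact) auto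
  then obtain l r where l: "l \<in> S \<inter> sphere 0 1" "strict_mono (r::nat \<Rightarrow> nat)" "(q \<circ> r) \<longlonglongrightarrow> l"
    using q unfolding compact_def by (metis IntI dist_0_norm mem_sphere)
  have "(\<lambda>j. \<Sum>b\<in>Basis. ((q \<circ> r) j \<bullet> b) *\<^sub>R F (r j) b) \<longlonglongrightarrow> (\<Sum>b\<in>Basis. (l \<bullet> b) *\<^sub>R A b)"
    using LIMSEQ_subseq_LIMSEQ[OF lim l(2)] unfolding o_def
    by (intro tendsto_intros l(3)[unfolded o_def])
  then have "(\<lambda>j. F (r j) (q (r j))) \<longlonglongrightarrow> A l"
    by (simp add: linear_expand[OF lin(2), of l] linear_expand[OF lin(1), of _ "q _"])
  then have "A l = 0" using q(3) LIMSEQ_unique tendsto_const by (metis (no_types, lifting) ext)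
  then have "l = 0" using injA l(1) by blast
  then show False using l(1) by auto
qed

section \<open>Traces\<close>

lemma endo_trace_commute:
  fixes f g :: "'a::euclidean_space \<Rightarrow> 'a"
  assumes "linear f" "linear g"
  shows "endo_trace (f \<circ> g) = endo_trace (g \<circ> f)"
proof -
  have exp: "endo_trace (f \<circ> g) = (\<Sum>b\<in>Basis. \<Sum>c\<in>Basis. (g b \<bullet> c) * (f c \<bullet> b))"
    if "linear f" for f g :: "'a \<Rightarrow> 'a"
    unfolding endo_trace_def o_def
    by (subst linear_expand[OF that]) (simp add: inner_sum_left)
  have "endo_trace (f \<circ> g) = (\<Sum>c\<in>Basis. \<Sum>b\<in>Basis. (g b \<bullet> c) * (f c \<bullet> b))"
    unfolding exp[OF assms(1)] by (rule sum.swap)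
  also have "\<dots> = endo_trace (g \<circ> f)"
    unfolding exp[OF assms(2)] by (simp add: mult.commute)
  finally show ?thesis .
qed

lemma endo_trace_add: "endo_trace (\<lambda>x. f x + g x) = endo_trace f + endo_trace g"
  and endo_trace_diff: "endo_trace (\<lambda>x. f x - g x) = endo_trace f - endo_trace g"
  and endo_trace_scale: "endo_trace (\<lambda>x. c *\<^sub>R f x) = c * endo_trace f"
  by (simp_all add: endo_trace_def inner_add_left inner_diff_left sum.distrib sum_subtractf sum_distrib_left)

text \<open>With \<open>P k\<close> a projection onto the range of \<open>f ^^ k\<close>, the trace of \<open>f \<circ> P k\<close> does not depend
  on \<open>k\<close>.\<close>

lemma endo_trace_nilpotent:
  fixes f :: "'a::euclidean_space \<Rightarrow> 'a"
  assumes lin: "linear f" and nil: "\<And>x. (f ^^ n) x = 0"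
  shows "endo_trace f = 0"
proof -
  have "\<exists>P. linear P \<and> range P \<subseteq> range (f ^^ k) \<and> (\<forall>v\<in>range (f ^^ k). P v = v)" for k
    using linear_exists_left_inverse_on[OF linear_id linear_subspace_image[OF linear_funpow[OF lin, of k] subspace_UNIV]
        inj_on_id] by auto
  then obtain P where P: "\<And>k. linear (P k)" "\<And>k x. P k x \<in> range (f ^^ k)"
    "\<And>k v. v \<in> range (f ^^ k) \<Longrightarrow> P k v = v"
    by (metis rangeI subsetD)
  have "endo_trace (f \<circ> P k) = endo_trace f" for k
  proof (induction k)
    case 0
    have "P 0 = id" using P(3)[of _ 0] by auto
    then show ?case by simp
  next
    case (Suc k)
    have "P (Suc k) (f (P k x)) = f (P k x)" for x
    proof -
      obtain y where "P k x = (f ^^ k) y" using P(2) by blast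
      then have "f (P k x) = (f ^^ Suc k) y" by simp
      then show ?thesis using P(3) by blast
    qed
    then have "endo_trace (f \<circ> P k) = endo_trace (P (Suc k) \<circ> (f \<circ> P k))" by (simp add: o_def)
    also have "\<dots> = endo_trace ((f \<circ> P k) \<circ> P (Suc k))"
      by (intro endo_trace_commute linear_compose P lin)
    also have "P k (P (Suc k) x) = P (Suc k) x" for x
    proof -
      obtain y where "P (Suc k) x = (f ^^ Suc k) y" using P(2) by blast
      then have "P (Suc k) x = (f ^^ k) (f y)" by (simp only: funpow_Suc_right o_apply)
      then show ?thesis using P(3) by blast
    qed
    then have "(f \<circ> P k) \<circ> P (Suc k) = f \<circ> P (Suc k)" by (simp add: fun_eq_iff)
    finally show ?case using Suc by simp
  qed
  from this[of n] have "endo_trace f = endo_trace (f \<circ> P n)" by simp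
  moreover have "P n x = 0" for x using P(2)[of n x] nil by auto
  ultimately show ?thesis by (simp add: endo_trace_def linear_0[OF lin])
qed


section \<open>Real Lie algebras\<close>

locale real_lie_algebra =
  fixes br :: "'a::euclidean_space \<Rightarrow> 'a \<Rightarrow> 'a"
  assumes lie: "lie_algebra scaleR br"
begin

lemma bilinear: "bilinear br"
proof -
  interpret L: lie_algebra scaleR br by (rule lie)
  show ?thesis
    by (auto simp: bilinear_def L.br_add_left L.br_add_right L.br_scale_left L.br_scale_right intro!: linearI)
qed

lemma br_linear: "linear (br x)" and br_linear_left: "linear (\<lambda>x. br x y)"
  using bilinear by (auto simp: bilinear_def)

lemma br_add_left: "br (x + y) z = br x z + br y z" and br_add_right: "br z (x + y) = br z x + br z y"
  and br_diff_left: "br (x - y) z = br x z - br y z" and br_diff_right: "br z (x - y) = br z x - br z y"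
  and br_minus_left: "br (- x) z = - br x z" and br_minus_right: "br z (- x) = - br z x"
  and br_scale_left: "br (c *\<^sub>R x) z = c *\<^sub>R br x z" and br_scale_right: "br z (c *\<^sub>R x) = c *\<^sub>R br z x"
  and br_zero_left [simp]: "br 0 z = 0" and br_zero_right [simp]: "br z 0 = 0"
  using bilinear
  by (simp_all add: bilinear_ladd bilinear_radd bilinear_lsub bilinear_rsub bilinear_lneg
      bilinear_rneg bilinear_lmul bilinear_rmul bilinear_lzero bilinear_rzero)

lemmas br_simps = br_add_left br_add_right br_diff_left br_diff_right br_minus_left br_minus_right
  br_scale_left br_scale_right

lemma bounded_bilinear: "bounded_bilinear br"
  using bilinear bilinear_conv_bounded_bilinear by blast

lemma br_self [simp]: "br x x = 0"
  using lie by (simp add: lie_algebra.br_self)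

lemma br_anti: "br x y = - br y x"
proof -
  have "br (x + y) (x + y) = 0" by (rule br_self)
  then have "br x y + br y x = 0" unfolding br_add_left br_add_right by (simp add: add.commute)
  then show ?thesis by (simp add: eq_neg_iff_add_eq_0)
qed

lemma jacobi: "br x (br y z) = br (br x y) z + br y (br x z)"
proof -
  have "br x (br y z) - br y (br x z) - br (br x y) z = 0"
    using lie_algebra.jacobi[OF lie, of x y z] br_anti[of z x] br_anti[of z "br x y"]
    by (simp add: br_minus_right)
  then show ?thesis by (simp add: algebra_simps)
qed

lemma jacobi_left: "br (br x y) z = br x (br y z) - br y (br x z)"
  using jacobi[of x y z] by simp

lemma exp_ad_linear: "linear (exp_map (br x))"
  by (rule exp_map_linear[OF br_linear])

lemma exp_ad_bracket: "exp_map (br x) (br y z) = br (exp_map (br x) y) (exp_map (br x) z)"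
  using exp_map_bilinear[OF bounded_bilinear br_linear[of x] br_linear[of x] br_linear[of x]] jacobi
  by blast

lemma exp_ad_inverse: "exp_map (br (- x)) (exp_map (br x) v) = v"
proof -
  have "br (- x) = (\<lambda>y. - br x y)" by (rule ext) (rule br_minus_left)
  then show ?thesis using exp_map_minus[OF br_linear] by simp
qed

lemma exp_ad_inverse': "exp_map (br x) (exp_map (br (- x)) v) = v"
  using exp_ad_inverse[of "- x"] by simp

lemma adjoint_group_exp: "x \<in> h \<Longrightarrow> exp_map (br x) \<in> adjoint_group br h"
  using adjoint_group.mult[OF _ adjoint_group.one, of x h br] by simp

lemma adjoint_group_comp:
  assumes "g \<in> adjoint_group br h" "g' \<in> adjoint_group br h"
  shows "g \<circ> g' \<in> adjoint_group br h"
  using assms(1)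
proof induction
  case one
  then show ?case using assms(2) by simp
next
  case (mult x g)
  then show ?case using adjoint_group.mult[of x h "g \<circ> g'" br] by (metis comp_assoc)
qed

lemma adjoint_group_linear: "g \<in> adjoint_group br h \<Longrightarrow> linear g"
proof (induction rule: adjoint_group.induct)
  case one
  then show ?case by (rule linear_id)
next
  case (mult x g)
  then show ?case using linear_compose exp_ad_linear by blast
qed

lemma adjoint_group_bracket: "g \<in> adjoint_group br h \<Longrightarrow> g (br y z) = br (g y) (g z)"
  by (induction rule: adjoint_group.induct) (simp_all add: exp_ad_bracket)

lemma adjoint_group_inverse:
  assumes "g \<in> adjoint_group br h" "\<And>x. x \<in> h \<Longrightarrow> - x \<in> h"
  shows "\<exists>g'\<in>adjoint_group br h. (\<forall>v. g' (g v) = v) \<and> (\<forall>v. g (g' v) = v)"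
  using assms(1)
proof induction
  case one
  then show ?case by (intro bexI[OF _ adjoint_group.one]) simp
next
  case (mult x g)
  then obtain g' where g': "g' \<in> adjoint_group br h" "\<forall>v. g' (g v) = v" "\<forall>v. g (g' v) = v" by blast
  have "g' \<circ> exp_map (br (- x)) \<in> adjoint_group br h"
    using adjoint_group_comp[OF g'(1) adjoint_group_exp] assms(2) mult by blast
  then show ?case
    using g' by (intro bexI[of _ "g' \<circ> exp_map (br (- x))"]) (simp_all add: exp_ad_inverse exp_ad_inverse')
qed

lemma adjoint_group_mem:
  assumes "g \<in> adjoint_group br h" "subspace S" "\<And>x y. x \<in> h \<Longrightarrow> y \<in> S \<Longrightarrow> br x y \<in> S" "v \<in> S"
  shows "g v \<in> S"
  using assms(1)
proof induction
  case one
  then show ?case using assms(4) by simp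
next
  case (mult x g)
  then show ?case using exp_map_mem[OF br_linear assms(2) assms(3)] by simp
qed

lemma adjoint_group_commute:
  assumes "g \<in> adjoint_group br h" "linear J" "\<And>x y. x \<in> h \<Longrightarrow> J (br x y) = br x (J y)"
  shows "J (g v) = g (J v)"
  using assms(1)
proof induction
  case (mult x g)
  have "J (exp_map (br x) (g v)) = exp_map (br x) (J (g v))"
    by (rule exp_map_intertwine[OF br_linear br_linear assms(2) assms(3)[OF mult(1)]])
  then show ?case using mult by simp
qed simp

lemma killing_symmetric: "killing_form br x y = killing_form br y x"
  unfolding killing_form_def by (rule endo_trace_commute[OF br_linear br_linear])

lemma killing_linear: "linear (killing_form br x)"
proof (rule linearI)
  show "killing_form br x (y + z) = killing_form br x y + killing_form br x z" for y z
    by (simp add: killing_form_def o_def br_simps endo_trace_add)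
  show "killing_form br x (c *\<^sub>R y) = c *\<^sub>R killing_form br x y" for c y
    by (simp add: killing_form_def o_def br_simps endo_trace_scale)
qed

lemma killing_bilinear: "bilinear (killing_form br)"
proof -
  have "(\<lambda>x. killing_form br x y) = killing_form br y" for y
    by (rule ext) (rule killing_symmetric)
  then show ?thesis by (simp add: bilinear_def killing_linear)
qed

lemma endo_trace_triple:
  fixes f g h :: "'a \<Rightarrow> 'a"
  assumes "linear f" "linear g" "linear h"
  shows "endo_trace (\<lambda>v. f (g (h v))) = endo_trace (\<lambda>v. g (h (f v)))"
  using endo_trace_commute[OF assms(1) linear_compose[OF assms(3,2)]] by (simp add: o_def)

lemma killing_invariant: "killing_form br (br x y) z = killing_form br x (br y z)"
proof -
  have "killing_form br (br x y) z = endo_trace (\<lambda>v. br x (br y (br z v))) - endo_trace (\<lambda>v. br y (br x (br z v)))"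
    by (simp add: killing_form_def o_def jacobi_left endo_trace_diff)
  also have "endo_trace (\<lambda>v. br y (br x (br z v))) = endo_trace (\<lambda>v. br x (br z (br y v)))"
    by (intro endo_trace_triple br_linear)
  also have "endo_trace (\<lambda>v. br x (br y (br z v))) - \<dots> = killing_form br x (br y z)"
    by (simp add: killing_form_def o_def jacobi_left[of y z] br_diff_right endo_trace_diff)
  finally show ?thesis .
qed

definition derivation :: "('a \<Rightarrow> 'a) \<Rightarrow> bool" where
  "derivation D \<longleftrightarrow> linear D \<and> (\<forall>x y. D (br x y) = br (D x) y + br x (D y))"

text \<open>Represent the functional \<open>y \<mapsto> tr (D \<circ> ad y)\<close> by the Killing form as \<open>killing_form br z\<close>;
  then \<open>D - ad z\<close> is a derivation whose values are orthogonal to everything.\<close>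

lemma derivation_inner:
  assumes nondeg: "\<And>x. (\<And>y. killing_form br x y = 0) \<Longrightarrow> x = 0" and D: "derivation D"
  shows "\<exists>z. \<forall>x. D x = br z x"
proof -
  have linD: "linear D" using D by (simp add: derivation_def)
  define \<phi> where "\<phi> y = endo_trace (\<lambda>v. D (br y v))" for y
  have lin\<phi>: "linear \<phi>"
    by (rule linearI) (simp_all add: \<phi>_def br_simps linear_add[OF linD] linear_scale[OF linD]
        endo_trace_add endo_trace_scale)
  \<comment> \<open>Coordinates of the functional \<open>killing_form br z\<close>. Nondegeneracy
    makes \<open>M\<close> injective, hence surjective, so every functional is represented.\<close>
  define M where "M z = (\<Sum>b\<in>Basis. killing_form br z b *\<^sub>R b)" for z
  have M_inner: "M z \<bullet> b = killing_form br z b" if "b \<in> Basis" for z b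
    using that by (simp add: M_def)
  have "linear M"
    unfolding M_def
    by (rule linearI) (simp_all add: bilinear_ladd[OF killing_bilinear] bilinear_lmul[OF killing_bilinear]
        scaleR_left_distrib sum.distrib scaleR_sum_right)
  moreover have "inj M"
  proof (rule linear_injective_0[OF \<open>linear M\<close>, THEN iffD2], intro allI impI)
    fix z assume "M z = 0"
    then have "killing_form br z b = 0" if "b \<in> Basis" for b using M_inner[OF that, of z] by simp
    then have "killing_form br z y = 0" for y using linear_expand[OF killing_linear, of z y] by simp
    then show "z = 0" using nondeg by blast
  qed
  ultimately have "surj M" by (rule linear_injective_imp_surjective) simp
  then obtain z where z: "M z = (\<Sum>b\<in>Basis. \<phi> b *\<^sub>R b)" by (metis surjD)
  have "killing_form br z b = \<phi> b" if "b \<in> Basis" for b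
    using M_inner[OF that, of z] z that by simp
  then have kz: "killing_form br z y = \<phi> y" for y
    using linear_expand[OF killing_linear, of z y] linear_expand[OF lin\<phi>, of y] by simp
  define E where "E x = D x - br z x" for x
  have linE: "linear E" unfolding E_def[abs_def] by (intro linear_compose_sub linD br_linear)
  \<comment> \<open>The derivation rule read as a commutator of \<open>E\<close> with
    \<open>ad x\<close>. Cyclicity of the trace then turns the pairing of \<open>E x\<close> with
    \<open>y\<close> into the trace of \<open>E \<circ> br (br x y)\<close>.\<close>
  have E: "br (E x) v = E (br x v) - br x (E v)" for x v
    using D jacobi[of z x v] by (simp add: derivation_def E_def br_simps)
  have trE: "endo_trace (\<lambda>v. E (br y v)) = 0" for y
    using kz[of y] by (simp add: E_def endo_trace_diff \<phi>_def killing_form_def o_def)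
  have "killing_form br (E x) y = 0" for x y
  proof -
    have "killing_form br (E x) y = endo_trace (\<lambda>v. E (br x (br y v))) - endo_trace (\<lambda>v. br x (E (br y v)))"
      by (simp add: killing_form_def o_def E endo_trace_diff)
    also have "endo_trace (\<lambda>v. br x (E (br y v))) = endo_trace (\<lambda>v. E (br y (br x v)))"
      by (intro endo_trace_triple br_linear linE)
    also have "endo_trace (\<lambda>v. E (br x (br y v))) - \<dots> = endo_trace (\<lambda>v. E (br (br x y) v))"
      by (simp add: jacobi_left linear_diff[OF linE] endo_trace_diff)
    finally show ?thesis by (simp add: trE)
  qed
  then have "E x = 0" for x using nondeg by blast
  then show ?thesis by (auto simp: E_def)
qed

end

section \<open>Compactness of the adjoint group\<close>

text \<open>Weakening \<open>fact (n + 2)\<close> to \<open>fact n\<close> in the tail leaves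
  \<open>C\<^sup>2\<close> times the exponential series. The quadratic factor yields the derivative
  of \<open>exp (ad x)\<close> at \<open>x = 0\<close>.\<close>

lemma exp_map_second_order_bound:
  fixes f :: "'a::euclidean_space \<Rightarrow> 'a"
  assumes "linear f" and C: "\<And>x. norm (f x) \<le> C * norm x" "C \<ge> 0"
  shows "norm (exp_map f v - v - f v) \<le> C\<^sup>2 * exp C * norm v"
proof -
  define a where "a n = (f ^^ n) v /\<^sub>R fact n" for n
  have eq: "exp_map f v - v - f v = (\<Sum>n. a (n + 2))"
    using exp_map_tail_sums[OF assms(1), of v] by (simp add: a_def sums_iff)
  have bound: "norm (a (n + 2)) \<le> C\<^sup>2 * (C ^ n /\<^sub>R fact n) * norm v" for n
  proof -
    have "norm (a (n + 2)) = norm ((f ^^ (n + 2)) v) / fact (n + 2)"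
      unfolding a_def by (simp add: divide_inverse mult.commute del: funpow.simps fact_Suc)
    also have "\<dots> \<le> (C ^ (n + 2) * norm v) / fact (n + 2)"
      by (intro divide_right_mono funpow_norm_bound C) simp
    also have "\<dots> \<le> (C ^ (n + 2) * norm v) / fact n"
      using C(2) by (intro divide_left_mono fact_mono) auto
    finally show ?thesis by (simp add: power_add divide_inverse mult_ac power2_eq_square)
  qed
  have "(\<lambda>n. C ^ n /\<^sub>R fact n) sums exp C" by (rule exp_converges)
  then have sums: "(\<lambda>n. C\<^sup>2 * (C ^ n /\<^sub>R fact n) * norm v) sums (C\<^sup>2 * exp C * norm v)"
    by (intro sums_mult sums_mult2)
  have "norm (\<Sum>n. a (n + 2)) \<le> (\<Sum>n. C\<^sup>2 * (C ^ n /\<^sub>R fact n) * norm v)"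
    by (rule norm_suminf_le[OF bound sums_summable[OF sums]])
  then show ?thesis using eq sums by (simp add: sums_iff)
qed

text \<open>An index type for the standard basis, so that the endomorphisms of a Euclidean space again
  form a type of class \<^class>\<open>euclidean_space\<close>, to which \<open>sussmann_open_mapping\<close> applies.\<close>

typedef (overloaded) ('a::euclidean_space) basis_index = "Basis :: 'a set"
  using nonempty_Basis by blast

instance basis_index :: (euclidean_space) finite
proof
  have "(UNIV :: 'a basis_index set) = Abs_basis_index ` Basis"
    by (metis type_definition.Abs_image type_definition_basis_index)
  then show "finite (UNIV :: 'a basis_index set)" by (metis finite_Basis finite_imageI)
qed

type_synonym 'a endo = "'a ^ 'a basis_index"

abbreviation basis_elt :: "'a::euclidean_space basis_index \<Rightarrow> 'a" where
  "basis_elt \<equiv> Rep_basis_index"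

definition of_endo :: "'a::euclidean_space endo \<Rightarrow> 'a \<Rightarrow> 'a" where
  "of_endo m v = (\<Sum>i\<in>UNIV. (v \<bullet> basis_elt i) *\<^sub>R (m $ i))"

definition to_endo :: "('a::euclidean_space \<Rightarrow> 'a) \<Rightarrow> 'a endo" where
  "to_endo f = (\<chi> i. f (basis_elt i))"

lemma sum_basis_index:
  fixes f :: "'a::euclidean_space \<Rightarrow> 'b::comm_monoid_add"
  shows "(\<Sum>i\<in>UNIV. f (basis_elt i)) = (\<Sum>b\<in>Basis. f b)"
proof -
  have "bij_betw basis_elt UNIV (Basis :: 'a set)"
    by (metis (no_types, lifting) Rep_basis_index_inject bij_betw_def injI
        type_definition.Rep_range type_definition_basis_index)
  then show ?thesis by (rule sum.reindex_bij_betw)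
qed

lemma of_endo_to_endo:
  assumes "linear f"
  shows "of_endo (to_endo f) = f"
proof
  fix v
  have "of_endo (to_endo f) v = (\<Sum>i\<in>UNIV. (\<lambda>b. (v \<bullet> b) *\<^sub>R f b) (basis_elt i))"
    by (simp add: of_endo_def to_endo_def)
  also have "\<dots> = f v"
    unfolding sum_basis_index[of "\<lambda>b. (v \<bullet> b) *\<^sub>R f b"] by (rule linear_expand[OF assms, symmetric])
  finally show "of_endo (to_endo f) v = f v" .
qed

lemma of_endo_linear: "linear (of_endo m)"
  unfolding of_endo_def
  by (rule linearI) (simp_all add: inner_add_left scaleR_add_left sum.distrib scaleR_sum_right)

lemma of_endo_basis [simp]: "of_endo m (basis_elt i) = m $ i"
proof -
  have "basis_elt i \<bullet> basis_elt j = (if j = i then 1 else 0)" for j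
    by (metis Rep_basis_index Rep_basis_index_inject inner_Basis)
  then have "of_endo m (basis_elt i) = (\<Sum>j\<in>UNIV. (if j = i then 1 else 0) *\<^sub>R m $ j)"
    by (simp add: of_endo_def)
  also have "\<dots> = (\<Sum>j\<in>UNIV. if j = i then m $ j else 0)" by (intro sum.cong) auto
  finally show ?thesis by simp
qed

lemma to_endo_of_endo: "to_endo (of_endo m) = m"
  by (simp add: to_endo_def vec_eq_iff)

lemma of_endo_bilinear: "of_endo (c *\<^sub>R m) v = c *\<^sub>R of_endo m v"
  by (simp add: of_endo_def scaleR_sum_right mult.commute)

lemma tendsto_of_endo: "(m \<longlongrightarrow> l) F \<Longrightarrow> ((\<lambda>j. of_endo (m j) v) \<longlongrightarrow> of_endo l v) F"
  unfolding of_endo_def by (intro tendsto_intros)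

lemma linear_eq_on_basis_elt:
  fixes f g :: "'a::euclidean_space \<Rightarrow> 'a"
  assumes "linear f" "linear g" "\<And>i. f (basis_elt i) = g (basis_elt i)"
  shows "f = g"
proof -
  have "to_endo f = to_endo g" using assms(3) by (simp add: to_endo_def)
  then show ?thesis using of_endo_to_endo assms by metis
qed

context real_lie_algebra
begin

section \<open>The exponential of \<open>ad x\<close> as a function of \<open>x\<close>\<close>

lemma exp_ad_zero: "exp_map (br 0) v = v"
proof -
  have "br 0 = (\<lambda>x. 0)" by (rule ext) simp
  then show ?thesis by (simp add: exp_map_zero)
qed

lemma exp_ad_bounds:
  "\<exists>K\<ge>0. \<forall>x v. norm (exp_map (br x) v - v - br x v) \<le> (norm x * K)\<^sup>2 * exp (norm x * K) * norm v"
proof -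
  obtain K where K: "K \<ge> 0" "\<And>x y. norm (br x y) \<le> norm x * norm y * K"
    using bounded_bilinear.nonneg_bounded[OF bounded_bilinear] by blast
  have "norm (exp_map (br x) v - v - br x v) \<le> (norm x * K)\<^sup>2 * exp (norm x * K) * norm v" for x v
    using K(1) K(2)[of x] by (intro exp_map_second_order_bound br_linear) (auto simp: mult_ac)
  then show ?thesis using K by blast
qed

text \<open>The open mapping argument uses continuity jointly in \<open>x\<close> and
  \<open>v\<close>, so the series is majorised on a whole ball and the Weierstrass test
  applied.\<close>

lemma exp_ad_continuous: "continuous_on (cball 0 R) (\<lambda>z. exp_map (br (fst z)) (snd z))"
proof -
  obtain K where K: "K \<ge> 0" "\<And>x y. norm (br x y) \<le> norm x * norm y * K"
    using bounded_bilinear.nonneg_bounded[OF bounded_bilinear] by blast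
  define t where "t n z = (br (fst z) ^^ n) (snd z) /\<^sub>R fact n" for n and z :: "'a \<times> 'a"
  have cont: "continuous_on A (\<lambda>z. (br (fst z) ^^ n) (snd z))" for A n
  proof (induction n)
    case (Suc n)
    then show ?case
      by (simp add: bounded_bilinear.continuous_on[OF bounded_bilinear] continuous_on_fst)
  qed (simp add: continuous_on_snd)
  have "uniform_limit (cball 0 R) (\<lambda>n z. \<Sum>i<n. t i z) (\<lambda>z. \<Sum>i. t i z) sequentially"
  proof (rule Weierstrass_m_test)
    fix n and z :: "'a \<times> 'a" assume z: "z \<in> cball 0 R"
    have le: "norm (fst z) \<le> R" "norm (snd z) \<le> R"
      using z norm_fst_le[of "fst z" "snd z"] norm_snd_le[of "snd z" "fst z"] by auto
    then have R: "R \<ge> 0" using norm_ge_zero order_trans by blast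
    have "norm (br (fst z) y) \<le> (R * K) * norm y" for y
    proof -
      have "norm (br (fst z) y) \<le> norm (fst z) * norm y * K" by (rule K)
      also have "\<dots> \<le> R * norm y * K" using le K by (intro mult_right_mono) auto
      finally show ?thesis by (simp add: mult_ac)
    qed
    then have "norm ((br (fst z) ^^ n) (snd z)) \<le> (R * K) ^ n * norm (snd z)"
      using R K by (intro funpow_norm_bound) auto
    also have "\<dots> \<le> (R * K) ^ n * R" using le R K by (intro mult_left_mono) auto
    finally have "norm (t n z) \<le> (R * K) ^ n * R / fact n"
      by (simp add: t_def divide_inverse mult.commute mult_left_mono)
    then show "norm (t n z) \<le> ((R * K) ^ n /\<^sub>R fact n) * R" by (simp add: divide_inverse mult_ac)
  next
    show "summable (\<lambda>n. ((R * K) ^ n /\<^sub>R fact n) * R)" by (intro summable_mult2 summable_exp_generic)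
  qed
  then have "continuous_on (cball 0 R) (\<lambda>z. \<Sum>i. t i z)"
  proof (rule uniform_limit_theorem[rotated])
    show "\<forall>\<^sub>F n in sequentially. continuous_on (cball 0 R) (\<lambda>z. \<Sum>i<n. t i z)"
      unfolding t_def by (intro always_eventually allI continuous_on_sum continuous_on_scaleR continuous_on_const cont)
  qed simp
  then show ?thesis by (simp add: exp_map_def t_def)
qed

text \<open>Only the point \<open>x = 0\<close> is treated: there the remainder after
  \<open>v + br x v\<close> is quadratic in \<open>x\<close>, and the open mapping argument asks for
  a derivative at one point.\<close>

lemma exp_ad_has_derivative:
  "((\<lambda>z. exp_map (br (fst z)) (snd z)) has_derivative (\<lambda>z. br (fst z) u + snd z)) (at (0, u))"
proof -
  obtain K where K: "K \<ge> 0"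
    "\<And>x v. norm (exp_map (br x) v - v - br x v) \<le> (norm x * K)\<^sup>2 * exp (norm x * K) * norm v"
    using exp_ad_bounds by blast
  define r where "r z = exp_map (br (fst z)) (snd z) - snd z - br (fst z) (snd z)" for z
  have main: "(r has_derivative (\<lambda>z. 0)) (at (0, u))"
  proof (rule has_derivativeI_sandwich[of 1])
    show "bounded_linear (\<lambda>z. 0)" by simp
    show "((\<lambda>z. norm (z - (0, u)) * (K\<^sup>2 * exp (1 * K) * norm (snd z))) \<longlongrightarrow> 0) (at (0, u))"
      by (auto intro!: tendsto_eq_intros)
    fix z :: "'a \<times> 'a" assume z: "z \<noteq> (0, u)" "dist z (0, u) < 1"
    define d where "d = norm (z - (0, u))"
    have d: "0 < d" "d < 1" using z by (auto simp: d_def dist_norm)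
    have f: "norm (fst z) \<le> d" using norm_fst_le[of "fst z" "snd z - u"] by (cases z) (simp add: d_def)
    have "norm (r z) \<le> (norm (fst z) * K)\<^sup>2 * exp (norm (fst z) * K) * norm (snd z)"
      unfolding r_def by (rule K)
    also have "\<dots> \<le> (d * K)\<^sup>2 * exp (1 * K) * norm (snd z)"
    proof -
      have "norm (fst z) * K \<le> 1 * K" using f d K(1) by (intro mult_right_mono) auto
      then show ?thesis
        using f d K(1) by (intro mult_right_mono mult_mono power_mono) auto
    qed
    finally have "norm (r z) / d \<le> d * (K\<^sup>2 * exp (1 * K) * norm (snd z))"
      using d by (simp add: field_simps power2_eq_square)
    moreover have "r (0, u) = 0" by (simp add: r_def exp_ad_zero)
    ultimately show "norm (r z - r (0, u) - 0) / norm (z - (0, u))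
        \<le> norm (z - (0, u)) * (K\<^sup>2 * exp (1 * K) * norm (snd z))"
      by (simp add: d_def)
  qed simp
  have "((\<lambda>z. br (fst z) (snd z)) has_derivative
      (\<lambda>z. br (fst (0, u)) (snd z) + br (fst z) (snd (0, u)))) (at (0, u))"
    using bounded_bilinear.FDERIV[OF bounded_bilinear
        has_derivative_fst[OF has_derivative_ident] has_derivative_snd[OF has_derivative_ident], of "(0, u)" UNIV]
    by simp
  then have "((\<lambda>z. r z + (snd z + br (fst z) (snd z))) has_derivative
      (\<lambda>z. 0 + (snd z + (br (fst (0, u)) (snd z) + br (fst z) (snd (0, u)))))) (at (0, u))"
    by (intro has_derivative_add main has_derivative_snd has_derivative_ident)
  then show ?thesis by (simp add: r_def add.commute)
qed

text \<open>If \<open>1 + n\<close> is an automorphism then \<open>n\<close> is a derivation up to a quadratic error, so a small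
  \<open>n\<close> cannot lie in a complement of the inner derivations.\<close>

lemma small_automorphism_trivial:
  assumes nondeg: "\<And>x. (\<And>y. killing_form br x y = 0) \<Longrightarrow> x = 0"
    and N: "subspace N" and inner: "\<And>x. to_endo (br x) \<in> N \<Longrightarrow> to_endo (br x) = 0"
  shows "\<exists>r>0. \<forall>n\<in>N. norm n < r \<longrightarrow>
    (\<forall>y z. br y z + of_endo n (br y z) = br (y + of_endo n y) (z + of_endo n z)) \<longrightarrow> n = 0"
proof (rule ccontr)
  assume neg: "\<not> ?thesis"
  have "\<exists>n\<in>N. n \<noteq> 0 \<and> norm n < inverse (real (Suc j)) \<and>
      (\<forall>y z. br y z + of_endo n (br y z) = br (y + of_endo n y) (z + of_endo n z))" for j
    using neg[simplified, rule_format, of "inverse (real (Suc j))"] by auto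
  then obtain n where n: "\<And>j. n j \<in> N" "\<And>j. n j \<noteq> 0" "\<And>j. norm (n j) < inverse (real (Suc j))"
    "\<And>j y z. br y z + of_endo (n j) (br y z) = br (y + of_endo (n j) y) (z + of_endo (n j) z)"
    by metis
  \<comment> \<open>Unit length keeps the limit \<open>l\<close> away from 0, while the quadratic
    error retains one factor \<open>norm (n j)\<close> and disappears in the limit.\<close>
  define m where "m j = n j /\<^sub>R norm (n j)" for j
  have m: "m j \<in> N \<inter> sphere 0 1" for j
    using n(1,2)[of j] by (auto simp: m_def subspace_scale[OF N])
  have "compact (N \<inter> sphere 0 1)" using closed_subspace[OF N] by (intro closed_Int_compact) auto
  then obtain l r where l: "l \<in> N \<inter> sphere 0 1" "strict_mono (r::nat \<Rightarrow> nat)" "(m \<circ> r) \<longlonglongrightarrow> l"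
    using m unfolding compact_def by metis
  have eq: "of_endo (m j) (br y z) - br (of_endo (m j) y) z - br y (of_endo (m j) z)
      = norm (n j) *\<^sub>R br (of_endo (m j) y) (of_endo (m j) z)" for j y z
  proof -
    define a where "a = norm (n j)"
    have a: "a > 0" "n j = a *\<^sub>R m j" using n(2)[of j] by (auto simp: m_def a_def)
    have "of_endo (n j) (br y z) - br (of_endo (n j) y) z - br y (of_endo (n j) z)
        = br (of_endo (n j) y) (of_endo (n j) z)"
      using n(4)[where j=j and y=y and z=z] by (simp add: br_simps algebra_simps)
    then have "a *\<^sub>R (of_endo (m j) (br y z) - br (of_endo (m j) y) z - br y (of_endo (m j) z))
        = a *\<^sub>R (a *\<^sub>R br (of_endo (m j) y) (of_endo (m j) z))"
      by (simp add: a(2) of_endo_bilinear br_simps scaleR_diff_right)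
    then show ?thesis using a(1) unfolding a_def[symmetric] by (simp only: scaleR_cancel_left) simp
  qed
  have lim_m: "(\<lambda>j. of_endo (m (r j)) v) \<longlonglongrightarrow> of_endo l v" for v
    using l(3) by (intro tendsto_of_endo) (simp add: o_def)
  have "(\<lambda>j. inverse (real (Suc j))) \<longlonglongrightarrow> 0" by (rule LIMSEQ_inverse_real_of_nat)
  then have "(\<lambda>j. norm (n j)) \<longlonglongrightarrow> 0"
    by (rule Lim_null_comparison[rotated]) (use n(3) in \<open>auto intro!: always_eventually simp: less_imp_le\<close>)
  from LIMSEQ_subseq_LIMSEQ[OF this l(2)] have lim_n: "(\<lambda>j. norm (n (r j))) \<longlonglongrightarrow> 0" by (simp add: o_def)
  have "of_endo l (br y z) - br (of_endo l y) z - br y (of_endo l z) = 0" for y z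
  proof -
    have "(\<lambda>j. of_endo (m (r j)) (br y z) - br (of_endo (m (r j)) y) z - br y (of_endo (m (r j)) z))
        \<longlonglongrightarrow> of_endo l (br y z) - br (of_endo l y) z - br y (of_endo l z)"
      by (intro tendsto_diff lim_m bounded_bilinear.tendsto[OF bounded_bilinear] tendsto_const)
    moreover have "(\<lambda>j. norm (n (r j)) *\<^sub>R br (of_endo (m (r j)) y) (of_endo (m (r j)) z))
        \<longlonglongrightarrow> 0 *\<^sub>R br (of_endo l y) (of_endo l z)"
      by (intro tendsto_scaleR lim_n lim_m bounded_bilinear.tendsto[OF bounded_bilinear])
    ultimately show ?thesis unfolding eq using LIMSEQ_unique by fastforce
  qed
  then have "derivation (of_endo l)"
    unfolding derivation_def using of_endo_linear by (auto simp: algebra_simps)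
  from derivation_inner[OF nondeg this] obtain x where "of_endo l = br x" by blast
  then have "l = to_endo (br x)" using to_endo_of_endo by metis
  then have "l = 0" using inner[of x] l(1) by blast
  then show False using l(1) by simp
qed

text \<open>Take a projection \<open>\<pi>\<close> whose kernel is the space of inner derivations.
  The map sending \<open>(x, m)\<close> to \<open>exp (ad x) \<circ> (1 + \<pi> m)\<close> has the
  surjective derivative \<open>ad x + \<pi> m\<close> at the origin, so it covers a neighbourhood of
  the identity. If its value is an automorphism, so is \<open>1 + \<pi> m\<close>, and then
  \<open>\<pi> m = 0\<close> by smallness.\<close>

lemma automorphism_near_identity:
  assumes nondeg: "\<And>x. (\<And>y. killing_form br x y = 0) \<Longrightarrow> x = 0"
  shows "\<exists>e>0. \<forall>A. linear A \<longrightarrow> (\<forall>y z. A (br y z) = br (A y) (A z)) \<longrightarrow>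
    norm (to_endo A - to_endo id) < e \<longrightarrow> (\<exists>x. A = exp_map (br x))"
proof -
  define ad where "ad x = to_endo (br x)" for x
  have linad: "linear ad"
    by (rule linearI) (simp_all add: ad_def to_endo_def vec_eq_iff br_simps)
  have A0: "subspace (range ad)" by (rule linear_subspace_image[OF linad subspace_UNIV])
  obtain P where P: "linear P" "range P \<subseteq> range ad" "\<And>v. v \<in> range ad \<Longrightarrow> P v = v"
    using linear_exists_left_inverse_on[OF linear_id A0 inj_on_id] by auto
  define \<pi> where "\<pi> m = m - P m" for m
  have lin\<pi>: "linear \<pi>" unfolding \<pi>_def[abs_def] by (intro linear_compose_sub linear_ident P)
  have N: "subspace (range \<pi>)" by (rule linear_subspace_image[OF lin\<pi> subspace_UNIV])
  have "ad x = 0" if range: "ad x \<in> range \<pi>" for x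
  proof -
    obtain m where "ad x = \<pi> m" using range by blast
    moreover have "P (P m) = P m" by (rule P(3)) (use P(2) in blast)
    then have "P (\<pi> m) = 0" by (simp add: \<pi>_def linear_diff[OF P(1)])
    ultimately show ?thesis using P(3)[OF rangeI[of ad x]] by simp
  qed
  then obtain r where r: "r > 0" "\<And>n. n \<in> range \<pi> \<Longrightarrow> norm n < r \<Longrightarrow>
      (\<And>y z. br y z + of_endo n (br y z) = br (y + of_endo n y) (z + of_endo n z)) \<Longrightarrow> n = 0"
    using small_automorphism_trivial[OF nondeg N, folded ad_def] by blast
  define \<Phi> where "\<Phi> z = (\<chi> i. exp_map (br (fst z)) (basis_elt i + \<pi> (snd z) $ i))" for z :: "'a \<times> 'a endo"
  define \<Phi>' where "\<Phi>' z = ad (fst z) + \<pi> (snd z)" for z :: "'a \<times> 'a endo"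
  have bl\<pi>: "bounded_linear \<pi>" using lin\<pi> linear_conv_bounded_linear by blast
  have cont: "continuous_on UNIV \<Phi>"
  proof -
    have c: "continuous_on UNIV (\<lambda>z. exp_map (br (fst z)) (snd z))"
    proof (rule continuous_at_imp_continuous_on, rule ballI)
      fix z :: "'a \<times> 'a"
      have "isCont (\<lambda>z. exp_map (br (fst z)) (snd z)) z"
        using continuous_on_interior[OF exp_ad_continuous[of "norm z + 1"]] by simp
      then show "isCont (\<lambda>z. exp_map (br (fst z)) (snd z)) z" .
    qed
    have "continuous_on UNIV (\<lambda>z::'a \<times> 'a endo. (fst z, basis_elt i + \<pi> (snd z) $ i))" for i
      by (intro continuous_intros bounded_linear.continuous_on[OF bl\<pi>])
    from continuous_on_compose2[OF c this] show ?thesis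
      unfolding \<Phi>_def by (intro continuous_on_vec_lambda) simp
  qed
  have der: "(\<Phi> has_derivative \<Phi>') (at 0)"
  proof -
    have "((\<lambda>z::'a \<times> 'a endo. (fst z, basis_elt i + \<pi> (snd z) $ i)) has_derivative
        (\<lambda>z. (fst z, 0 + \<pi> (snd z) $ i))) (at 0)" for i
      by (intro has_derivative_Pair has_derivative_fst has_derivative_ident has_derivative_add
          has_derivative_const bounded_linear.has_derivative[OF bounded_linear_vec_nth]
          bounded_linear.has_derivative[OF bl\<pi>] has_derivative_snd)
    from diff_chain_at[OF this, of "\<lambda>z. exp_map (br (fst z)) (snd z)" "\<lambda>z. br (fst z) (basis_elt i) + snd z" i for i]
    have "((\<lambda>z. exp_map (br (fst z)) (basis_elt i + \<pi> (snd z) $ i)) has_derivative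
        (\<lambda>z. br (fst z) (basis_elt i) + \<pi> (snd z) $ i)) (at 0)" for i
      using exp_ad_has_derivative[of "basis_elt i"] by (simp add: o_def linear_0[OF lin\<pi>])
    then have "((\<lambda>z. \<Phi> z $ i) has_derivative (\<lambda>z. \<Phi>' z $ i)) (at 0)" for i
      by (simp add: \<Phi>_def \<Phi>'_def ad_def to_endo_def)
    then have "((\<lambda>z. \<Phi> z $ i \<bullet> u) has_derivative (\<lambda>z. \<Phi>' z $ i \<bullet> u)) (at 0)" for i u
      by (rule has_derivative_inner_left)
    then have "((\<lambda>z. \<Phi> z \<bullet> b) has_derivative (\<lambda>z. \<Phi>' z \<bullet> b)) (at 0)" if "b \<in> Basis" for b
      using that by (auto simp: Basis_vec_def inner_axis)
    then show ?thesis by (subst has_derivative_componentwise_within) blast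
  qed
  have lin\<Phi>': "linear \<Phi>'"
    by (rule linearI) (simp_all add: \<Phi>'_def linear_add[OF linad] linear_add[OF lin\<pi>]
        linear_scale[OF linad] linear_scale[OF lin\<pi>] scaleR_add_right)
  have "surj \<Phi>'"
    unfolding surj_def
  proof
    fix m
    obtain x where "P m = ad x" using P(2) by blast
    then have "\<Phi>' (x, m) = m" by (simp add: \<Phi>'_def \<pi>_def)
    then show "\<exists>z. m = \<Phi>' z" by metis
  qed
  then obtain h where h: "linear h" "\<Phi>' \<circ> h = id"
    using linear_surjective_right_inverse[OF lin\<Phi>'] by blast
  have "continuous_on UNIV (\<lambda>z::'a \<times> 'a endo. norm (\<pi> (snd z)))"
    by (intro continuous_intros bounded_linear.continuous_on[OF bl\<pi>])
  then have "open {z::'a \<times> 'a endo. norm (\<pi> (snd z)) < r}"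
    by (intro open_Collect_less continuous_on_const)
  moreover have "0 \<in> {z::'a \<times> 'a endo. norm (\<pi> (snd z)) < r}" using r(1) by (simp add: linear_0[OF lin\<pi>])
  ultimately have "\<Phi> 0 \<in> interior (\<Phi> ` {z. norm (\<pi> (snd z)) < r})"
    using h(1) by (intro sussmann_open_mapping[OF open_UNIV cont _ der _ h(2)])
      (auto simp: interior_open linear_conv_bounded_linear)
  moreover have "\<Phi> 0 = to_endo id"
    by (simp add: \<Phi>_def to_endo_def vec_eq_iff linear_0[OF lin\<pi>] exp_ad_zero)
  ultimately obtain e where e: "e > 0" "ball (to_endo id) e \<subseteq> \<Phi> ` {z. norm (\<pi> (snd z)) < r}"
    unfolding mem_interior by auto
  have "\<exists>x. A = exp_map (br x)"
    if A: "linear A" "\<And>y z. A (br y z) = br (A y) (A z)" "norm (to_endo A - to_endo id) < e" for A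
  proof -
    have "to_endo A \<in> ball (to_endo id) e" using A(3) by (simp add: dist_norm norm_minus_commute)
    then obtain x m where xm: "to_endo A = \<Phi> (x, m)" "norm (\<pi> m) < r" using e(2) by auto
    have linE: "linear (\<lambda>v. exp_map (br x) (v + of_endo (\<pi> m) v))"
      using linear_compose[OF linear_compose_add[OF linear_ident of_endo_linear] exp_ad_linear] by (simp add: o_def)
    have "A = (\<lambda>v. exp_map (br x) (v + of_endo (\<pi> m) v))"
      using xm(1) by (intro linear_eq_on_basis_elt[OF A(1) linE]) (simp add: to_endo_def \<Phi>_def vec_eq_iff)
    then have AE: "exp_map (br (- x)) (A v) = v + of_endo (\<pi> m) v" for v by (simp add: exp_ad_inverse)
    have "br y z + of_endo (\<pi> m) (br y z) = br (y + of_endo (\<pi> m) y) (z + of_endo (\<pi> m) z)" for y z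
      by (simp add: AE[symmetric] A(2) exp_ad_bracket)
    then have "\<pi> m = 0" using r(2)[of "\<pi> m"] xm(2) by blast
    then have "A v = exp_map (br x) v" for v
      using AE[of v] exp_ad_inverse'[of x "A v"] by (simp add: of_endo_def)
    then show ?thesis by blast
  qed
  then show ?thesis using e(1) by blast
qed

theorem compact_of_killing_negative:
  assumes neg: "\<And>x. x \<noteq> 0 \<Longrightarrow> killing_form br x x < 0"
  shows "compact_lie_algebra br"
proof -
  interpret q: inner_form "\<lambda>x y. - killing_form br x y"
  proof
    show "bilinear (\<lambda>x y. - killing_form br x y)"
      using killing_bilinear by (auto simp: bilinear_def linear_compose_neg)
  qed (use neg killing_symmetric in auto)
  have nondeg: "x = 0" if "\<And>y. killing_form br x y = 0" for x
    using neg[of x] that[of x] by auto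
  let ?G = "adjoint_group br UNIV"
  have invq: "killing_form br (g v) (g v) = killing_form br v v" if "g \<in> ?G" for g v
    using that
  proof induction
    case (mult x g)
    have "- killing_form br (exp_map (br x) (g v)) (exp_map (br x) (g v)) = - killing_form br (g v) (g v)"
      by (rule exp_map_skew[OF q.bounded_bilinear br_linear])
        (simp add: br_anti[of x] bilinear_lneg[OF killing_bilinear] killing_invariant)
    then show ?case using mult by simp
  qed simp
  obtain c where c: "c > 0" "\<And>x. c * (norm x)\<^sup>2 \<le> - killing_form br x x" using q.lower_bound by blast
  obtain K where K: "\<And>x y. norm (- killing_form br x y) \<le> norm x * norm y * K" "K \<ge> 0"
    using bounded_bilinear.nonneg_bounded[OF q.bounded_bilinear] by blast
  define C where "C = sqrt (K / c)"
  have bound: "norm (g v) \<le> C * norm v" if g: "g \<in> ?G" for g v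
  proof -
    have "c * (norm (g v))\<^sup>2 \<le> - killing_form br v v" using c(2)[of "g v"] invq[OF g] by simp
    also have "\<dots> \<le> norm v * norm v * K" using K(1)[of v v] by simp
    finally have "(norm (g v))\<^sup>2 \<le> (C * norm v)\<^sup>2"
      using c(1) K(2) by (simp add: C_def power_mult_distrib field_simps power2_eq_square[of "norm v"])
    then show ?thesis by (rule power2_le_imp_le) (use K(2) c(1) in \<open>simp add: C_def\<close>)
  qed
  have bl: "bounded_linear g" if "g \<in> ?G" for g
    using adjoint_group_linear[OF that] linear_conv_bounded_linear by blast
  have C0: "C \<ge> 0" using K c by (simp add: C_def)
  have "norm (Blinfun g) \<le> C" if "g \<in> ?G" for g
    using bound[OF that] C0 by (intro norm_blinfun_bound) (simp_all add: bounded_linear_Blinfun_apply bl[OF that])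
  then have bounded: "bounded (Blinfun ` ?G)" unfolding bounded_iff by blast
  obtain e where e: "e > 0" "\<And>A. linear A \<Longrightarrow> (\<And>y z. A (br y z) = br (A y) (A z)) \<Longrightarrow>
      norm (to_endo A - to_endo id) < e \<Longrightarrow> \<exists>x. A = exp_map (br x)"
    using automorphism_near_identity[OF nondeg] by blast
  have "closed (Blinfun ` ?G)"
    unfolding closed_sequential_limits
  proof (intro allI impI, elim conjE)
    fix X L assume X: "\<forall>n. X n \<in> Blinfun ` ?G" and lim: "X \<longlonglongrightarrow> L"
    from X have "\<forall>n. \<exists>h. h \<in> ?G \<and> X n = Blinfun h" by blast
    then obtain g where g: "\<And>n. g n \<in> ?G" "\<And>n. X n = Blinfun (g n)" by (auto dest!: choice)
    define A where "A = blinfun_apply L"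
    have linA: "linear A" by (simp add: A_def blinfun.bounded_linear_right bounded_linear.linear)
    have gA: "(\<lambda>n. g n v) \<longlonglongrightarrow> A v" for v
      using blinfun.tendsto[OF lim tendsto_const, of v]
      by (simp add: A_def g(2) bounded_linear_Blinfun_apply[OF bl[OF g(1)]])
    have A_br: "A (br y z) = br (A y) (A z)" for y z
    proof (rule LIMSEQ_unique[OF gA])
      show "(\<lambda>n. g n (br y z)) \<longlonglongrightarrow> br (A y) (A z)"
        using bounded_bilinear.tendsto[OF bounded_bilinear gA gA, of y z]
        by (simp add: adjoint_group_bracket[OF g(1)])
    qed
    have "\<exists>h\<in>?G. (\<forall>v. h (g n v) = v) \<and> (\<forall>v. g n (h v) = v)" for n
      using adjoint_group_inverse[OF g(1)] by blast
    then have "\<forall>n. \<exists>h. h \<in> ?G \<and> (\<forall>v. h (g n v) = v) \<and> (\<forall>v. g n (h v) = v)" by blast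
    then obtain h where h: "\<And>n. h n \<in> ?G" "\<And>n v. h n (g n v) = v" "\<And>n v. g n (h n v) = v"
      by (auto dest!: choice)
    \<comment> \<open>The bound \<open>C\<close> also holds for the inverses \<open>h n\<close>,
      which turns convergence of \<open>g n\<close> to \<open>A\<close> into convergence of
      \<open>h n \<circ> A\<close> to the identity. For some \<open>n\<close> this is a single
      exponential, and composing it with \<open>g n\<close> recovers \<open>A\<close>.\<close>
    have "(\<lambda>n. h n (A v)) \<longlonglongrightarrow> v" for v
    proof (rule Lim_transform_bound[THEN LIM_zero_cancel])
      have "norm (h n (A v) - v) \<le> norm (C *\<^sub>R (A v - g n v))" for n
      proof -
        have "h n (A v) - v = h n (A v - g n v)"
          by (simp add: linear_diff[OF adjoint_group_linear[OF h(1)]] h(2))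
        then show ?thesis using bound[OF h(1)[of n], of "A v - g n v"] C0 by simp
      qed
      then show "\<forall>\<^sub>F n in sequentially. norm (h n (A v) - v) \<le> norm (C *\<^sub>R (A v - g n v))" by simp
      have "(\<lambda>n. C *\<^sub>R (A v - g n v)) \<longlonglongrightarrow> C *\<^sub>R (A v - A v)" by (intro tendsto_intros gA)
      then show "(\<lambda>n. C *\<^sub>R (A v - g n v)) \<longlonglongrightarrow> 0" by simp
    qed
    then have "(\<lambda>n. to_endo (h n \<circ> A)) \<longlonglongrightarrow> to_endo id"
      unfolding to_endo_def by (intro tendsto_vec_lambda) simp
    from eventually_happens'[OF sequentially_bot tendstoD[OF this e(1)]]
    obtain n where n: "norm (to_endo (h n \<circ> A) - to_endo id) < e"
      unfolding dist_norm by blast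
    have "\<exists>x. h n \<circ> A = exp_map (br x)"
      using n by (intro e linear_compose linA adjoint_group_linear[OF h(1)])
        (simp_all add: A_br adjoint_group_bracket[OF h(1)])
    then have "h n \<circ> A \<in> ?G" using adjoint_group_exp[of _ UNIV] by auto
    from adjoint_group_comp[OF g(1)[of n] this] have "A \<in> ?G" by (simp add: o_def h(3))
    then show "L \<in> Blinfun ` ?G" by (metis A_def blinfun_apply_inverse imageI)
  qed
  then show ?thesis unfolding compact_lie_algebra_def compact_eq_bounded_closed using bounded by blast
qed

end

section \<open>The complexified Cartan decomposition\<close>

lemma funpow_comp_commute:
  assumes "\<And>x. f (g x) = g (f x)"
  shows "((f \<circ> g) ^^ n) x = (f ^^ n) ((g ^^ n) x)"
proof -
  have pow: "g ((f ^^ n) x) = (f ^^ n) (g x)" for n x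
    by (induction n) (simp_all add: assms[symmetric])
  show ?thesis by (induction n) (simp_all add: pow)
qed

text \<open>Simplicity of the real algebra enters through its trivial centre, simplicity of the
  complexification through the impossibility of splitting \<open>pC\<close> into two commuting
  parts.\<close>

locale cartan_simple = real_lie_algebra br for br :: "'a::euclidean_space \<Rightarrow> 'a \<Rightarrow> 'a" +
  fixes \<theta> :: "'a \<Rightarrow> 'a"
  assumes real_simple: "simple_lie_algebra scaleR br"
    and complex_simple: "simple_lie_algebra cscale (cbracket br)"
    and involution: "cartan_involution br \<theta>"
begin

abbreviation cbr :: "'a \<times> 'a \<Rightarrow> 'a \<times> 'a \<Rightarrow> 'a \<times> 'a" where
  "cbr \<equiv> cbracket br"

definition J :: "'a \<times> 'a \<Rightarrow> 'a \<times> 'a" where "J v = (- snd v, fst v)"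
definition conjg :: "'a \<times> 'a \<Rightarrow> 'a \<times> 'a" where "conjg v = (fst v, - snd v)"
text \<open>The conjugate-linear extension of \<open>\<theta>\<close>, that is, conjugation with
  respect to the compact real form \<open>k + i p\<close>.\<close>

definition \<tau> :: "'a \<times> 'a \<Rightarrow> 'a \<times> 'a" where "\<tau> v = (\<theta> (fst v), - \<theta> (snd v))"

definition q :: "'a \<Rightarrow> 'a \<Rightarrow> real" where "q x y = - killing_form br x (\<theta> y)"
text \<open>The real part of the Hermitian form \<open>- B v (\<tau> w)\<close>, with
  \<open>B\<close> the complex Killing form.\<close>

definition Q :: "'a \<times> 'a \<Rightarrow> 'a \<times> 'a \<Rightarrow> real" where
  "Q v w = q (fst v) (fst w) + q (snd v) (snd w)"

definition k :: "'a set" where "k = {x. \<theta> x = x}"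
definition p :: "'a set" where "p = {x. \<theta> x = - x}"

abbreviation kC :: "('a \<times> 'a) set" where "kC \<equiv> complexify k"
abbreviation pC :: "('a \<times> 'a) set" where "pC \<equiv> complexify p"

lemma \<theta>_linear: "linear \<theta>" and \<theta>_bracket: "\<theta> (br x y) = br (\<theta> x) (\<theta> y)" and \<theta>_\<theta> [simp]: "\<theta> (\<theta> x) = x"
  and \<theta>_pos: "x \<noteq> 0 \<Longrightarrow> - killing_form br x (\<theta> x) > 0"
  using involution by (auto simp: cartan_involution_def)

lemma \<theta>_simps: "\<theta> (x + y) = \<theta> x + \<theta> y" "\<theta> (x - y) = \<theta> x - \<theta> y" "\<theta> (- x) = - \<theta> x"
  "\<theta> (c *\<^sub>R x) = c *\<^sub>R \<theta> x" "\<theta> 0 = 0"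
  by (simp_all add: linear_add linear_diff linear_neg linear_scale linear_0 \<theta>_linear)

sublocale C: real_lie_algebra cbr
proof (rule real_lie_algebra.intro)
  interpret L: lie_algebra cscale cbr by (rule lie_algebra_complexification[OF lie])
  have scale: "c *\<^sub>R v = cscale (complex_of_real c) v" for c and v :: "'a \<times> 'a"
    by (simp add: cscale_def prod_eq_iff)
  show "lie_algebra scaleR cbr"
    by unfold_locales
      (simp_all add: L.br_add_left L.br_add_right L.br_scale_left L.br_scale_right L.br_self L.jacobi
        scale L.scale_right_distrib L.scale_left_distrib)
qed

lemma cscale_J: "cscale c v = Re c *\<^sub>R v + Im c *\<^sub>R J v"
  by (simp add: cscale_def J_def prod_eq_iff)

lemma J_linear: "linear J" and conj_linear: "linear conjg" and \<tau>_linear: "linear \<tau>"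
  by (auto intro!: linearI simp: J_def conjg_def \<tau>_def \<theta>_simps)

lemma J_J [simp]: "J (J v) = - v" and conj_conj [simp]: "conjg (conjg v) = v" and \<tau>_\<tau> [simp]: "\<tau> (\<tau> v) = v"
  and conj_J: "conjg (J v) = - J (conjg v)"
  by (simp_all add: J_def conjg_def \<tau>_def \<theta>_simps prod_eq_iff)

lemma cbr_J_right: "cbr v (J w) = J (cbr v w)" and cbr_J_left: "cbr (J v) w = J (cbr v w)"
  and conj_cbr: "conjg (cbr v w) = cbr (conjg v) (conjg w)" and \<tau>_cbr: "\<tau> (cbr v w) = cbr (\<tau> v) (\<tau> w)"
  by (simp_all add: cbracket_def J_def conjg_def \<tau>_def prod_eq_iff br_simps \<theta>_simps \<theta>_bracket)

lemma killing_\<theta>: "killing_form br (\<theta> x) (\<theta> y) = killing_form br x y"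
proof -
  have "br (\<theta> x) (br (\<theta> y) v) = \<theta> (br x (br y (\<theta> v)))" for v
    by (simp add: \<theta>_bracket)
  then have "killing_form br (\<theta> x) (\<theta> y) = endo_trace (\<lambda>v. \<theta> (br x (br y (\<theta> v))))"
    by (simp add: killing_form_def o_def)
  also have "\<dots> = endo_trace (\<lambda>v. (\<lambda>v. br x (br y (\<theta> v))) (\<theta> v))"
    using endo_trace_commute[OF \<theta>_linear linear_compose[OF \<theta>_linear linear_compose[OF br_linear[of y] br_linear[of x]]]]
    by (simp add: o_def)
  finally show ?thesis by (simp add: killing_form_def o_def)
qed

sublocale q: inner_form q
proof
  show "bilinear q"
    unfolding q_def bilinear_def
    using killing_bilinear linear_compose[OF \<theta>_linear killing_linear]
    by (auto simp: bilinear_def o_def intro!: linear_compose_neg)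
  show "q x y = q y x" for x y
    using killing_\<theta>[of x "\<theta> y"] killing_symmetric by (simp add: q_def)
  show "q x x > 0" if "x \<noteq> 0" for x
    using \<theta>_pos[OF that] by (simp add: q_def)
qed

sublocale Q: inner_form Q
proof
  show "bilinear Q"
    unfolding Q_def bilinear_def by (auto intro!: linearI simp: q.bilinear_simps algebra_simps)
  show "Q x y = Q y x" for x y by (simp add: Q_def q.sym)
  show "Q x x > 0" if "x \<noteq> 0" for x
  proof -
    have "fst x \<noteq> 0 \<or> snd x \<noteq> 0" using that by (simp add: prod_eq_iff)
    then show ?thesis using q.pos q.nonneg by (auto simp: Q_def add_pos_nonneg add_nonneg_pos)
  qed
qed

lemma killing_nondegenerate: "(\<And>y. killing_form br x y = 0) \<Longrightarrow> x = 0"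
  using \<theta>_pos[of x] by force

lemma q_br: "q (br z x) y = - q x (br (\<theta> z) y)"
proof -
  have "killing_form br (br z x) (\<theta> y) = - killing_form br x (br z (\<theta> y))"
    by (simp add: br_anti[of z x] bilinear_lneg[OF killing_bilinear] killing_invariant)
  then show ?thesis by (simp add: q_def \<theta>_bracket)
qed

text \<open>Makes \<open>k\<close> act by skew and \<open>i k\<close> by symmetric operators; the
  spectral arguments below rest on it.\<close>

lemma Q_cbr: "Q (cbr z v) w = - Q v (cbr (\<tau> z) w)"
  by (simp add: Q_def cbracket_def \<tau>_def q.bilinear_simps q_br br_simps)

lemma Q_J: "Q (J v) w = - Q v (J w)"
  by (simp add: Q_def J_def q.bilinear_simps)

lemma subspace_k: "subspace k" and subspace_p: "subspace p"
  by (auto simp: k_def p_def subspace_def \<theta>_simps)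

lemma subspace_kC: "subspace kC" and subspace_pC: "subspace pC"
  using subspace_Times[OF subspace_k subspace_k] subspace_Times[OF subspace_p subspace_p]
  by (simp_all add: complexify_def)

lemma kC_iff: "v \<in> kC \<longleftrightarrow> fst v \<in> k \<and> snd v \<in> k" and pC_iff: "v \<in> pC \<longleftrightarrow> fst v \<in> p \<and> snd v \<in> p"
  by (cases v, simp add: complexify_def)+

lemma k_mult: "x \<in> k \<Longrightarrow> y \<in> k \<Longrightarrow> br x y \<in> k" and kp_mult: "x \<in> k \<Longrightarrow> y \<in> p \<Longrightarrow> br x y \<in> p"
  and p_mult: "x \<in> p \<Longrightarrow> y \<in> p \<Longrightarrow> br x y \<in> k"
  by (simp_all add: k_def p_def \<theta>_bracket br_simps)

lemma kC_mult: "x \<in> kC \<Longrightarrow> y \<in> kC \<Longrightarrow> cbr x y \<in> kC" and kpC_mult: "x \<in> kC \<Longrightarrow> y \<in> pC \<Longrightarrow> cbr x y \<in> pC"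
  and pC_mult: "x \<in> pC \<Longrightarrow> y \<in> pC \<Longrightarrow> cbr x y \<in> kC"
  by (simp_all add: kC_iff pC_iff cbracket_def k_mult kp_mult p_mult
      subspace_add[OF subspace_k] subspace_diff[OF subspace_k]
      subspace_add[OF subspace_p] subspace_diff[OF subspace_p])

lemma J_kC: "v \<in> kC \<Longrightarrow> J v \<in> kC" and J_pC: "v \<in> pC \<Longrightarrow> J v \<in> pC"
  and conj_pC: "v \<in> pC \<Longrightarrow> conjg v \<in> pC" and \<tau>_kC: "v \<in> kC \<Longrightarrow> \<tau> v \<in> kC"
  and \<tau>_pC: "v \<in> pC \<Longrightarrow> \<tau> v = - conjg v"
  unfolding kC_iff pC_iff by (auto simp: J_def conjg_def \<tau>_def k_def p_def \<theta>_simps)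

lemma q_k_p: "x \<in> k \<Longrightarrow> y \<in> p \<Longrightarrow> q x y = 0"
  using killing_\<theta>[of x y] linear_neg[OF killing_linear, of x y] by (simp add: q_def k_def p_def)

lemma Q_kC_pC: "x \<in> kC \<Longrightarrow> y \<in> pC \<Longrightarrow> Q x y = 0"
  by (simp add: Q_def kC_iff pC_iff q_k_p)

lemma kC_pC_disjoint: "x \<in> kC \<Longrightarrow> x \<in> pC \<Longrightarrow> x = 0"
  using Q_kC_pC Q.eq_zero by blast

lemma k_p_decomp: "\<exists>y\<in>k. \<exists>z\<in>p. x = y + z"
proof -
  have "(1 / 2) *\<^sub>R (x + \<theta> x) \<in> k" "(1 / 2) *\<^sub>R (x - \<theta> x) \<in> p"
    by (simp_all add: k_def p_def \<theta>_simps add.commute scaleR_diff_right)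
  moreover have "x = (1 / 2) *\<^sub>R (x + \<theta> x) + (1 / 2) *\<^sub>R (x - \<theta> x)"
    by (simp add: scaleR_add_right[symmetric] scaleR_2[symmetric] del: scaleR_add_right)
  ultimately show ?thesis by blast
qed

lemma kC_pC_decomp: "\<exists>y\<in>kC. \<exists>z\<in>pC. x = y + z"
proof -
  obtain a b c d where *: "a \<in> k" "b \<in> p" "fst x = a + b" "c \<in> k" "d \<in> p" "snd x = c + d"
    using k_p_decomp by metis
  have "(a, c) \<in> kC" "(b, d) \<in> pC" "x = (a, c) + (b, d)"
    using * by (auto simp: complexify_def prod_eq_iff)
  then show ?thesis by blast
qed

lemma center_trivial:
  assumes "\<And>y. br x y = 0"
  shows "x = 0"
proof -
  interpret S: simple_lie_algebra scaleR br by (rule real_simple)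
  define I where "I = {x. \<forall>y. br x y = 0}"
  have "S.lie_ideal I"
    unfolding S.lie_ideal_def subspace_raw_def[symmetric] subspace_def I_def by (auto simp: br_simps jacobi_left)
  then have "I = {0} \<or> I = UNIV" by (rule S.ideal_trivial)
  moreover have "I \<noteq> UNIV" using S.nonabelian by (auto simp: I_def)
  ultimately show ?thesis using assms by (auto simp: I_def)
qed

text \<open>For \<open>b \<in> p\<close> the bracket \<open>br x b\<close> lies in \<open>k\<close>,
  so the square of \<open>ad x\<close> kills \<open>b\<close>. Since \<open>ad x\<close> is
  symmetric for \<open>x \<in> p\<close>, already \<open>br x b = 0\<close>, and \<open>x\<close> is
  central in the whole algebra.\<close>

lemma center_trivial_p:
  assumes "x \<in> p" "\<And>y. y \<in> k \<Longrightarrow> br y x = 0"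
  shows "x = 0"
proof (rule center_trivial)
  fix y
  obtain a b where ab: "a \<in> k" "b \<in> p" "y = a + b" using k_p_decomp by blast
  have "br x b \<in> k" using p_mult assms(1) ab(2) by blast
  then have "br (br x b) x = 0" by (rule assms(2))
  then have "br x (br x b) = 0" using br_anti[of x "br x b"] by simp
  moreover have "q (br x b) (br x b) = - q b (br (\<theta> x) (br x b))" by (rule q_br)
  moreover have "\<theta> x = - x" using assms(1) by (simp add: p_def)
  ultimately have "br x b = 0" by (intro q.eq_zero) (simp add: br_simps q.bilinear_simps)
  moreover have "br x a = 0" using assms(2)[OF ab(1)] br_anti[of x a] by simp
  ultimately show "br x y = 0" by (simp add: ab(3) br_simps)
qed


subsection \<open>Nilpotent elements\<close>

lemma sum_Basis_prod:
  fixes f :: "'b::euclidean_space \<times> 'c::euclidean_space \<Rightarrow> real"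
  shows "sum f Basis = (\<Sum>i\<in>Basis. f (i, 0)) + (\<Sum>i\<in>Basis. f (0, i))"
proof -
  have inj: "inj_on (\<lambda>u. (u::'b, 0::'c)) Basis" "inj_on (\<lambda>u. (0::'b, u::'c)) Basis"
    by (auto intro!: inj_onI)
  have "sum f Basis = sum f ((\<lambda>u. (u, 0)) ` Basis) + sum f ((\<lambda>v. (0, v)) ` Basis)"
    unfolding Basis_prod_def by (intro sum.union_disjoint) (auto simp: nonzero_Basis)
  then show ?thesis by (simp add: sum.reindex[OF inj(1)] sum.reindex[OF inj(2)] o_def)
qed

text \<open>The trace is taken over the underlying real space, hence twice the real part of the
  complex Killing form.\<close>

lemma killing_form_complex:
  "killing_form cbr x y = - 2 * Q x (\<tau> y)"
proof -
  have "killing_form cbr x y = 2 * (killing_form br (fst x) (fst y) - killing_form br (snd x) (snd y))"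
    by (simp add: killing_form_def endo_trace_def cbracket_def br_simps
        sum_Basis_prod
        inner_diff_left inner_add_left sum_subtractf sum.distrib)
  then show ?thesis
    using linear_neg[OF killing_linear, of "snd x"] by (simp add: Q_def q_def \<tau>_def \<theta>_simps)
qed

text \<open>Since \<open>ad x\<close> and \<open>ad y\<close> commute, their product is nilpotent
  with \<open>ad x\<close> and has trace 0.\<close>

lemma nilpotent_orthogonal_centralizer:
  assumes "ad_nilpotent cbr x" "cbr x y = 0"
  shows "Q x (\<tau> y) = 0"
proof -
  obtain n where n: "\<And>v. (cbr x ^^ n) v = 0" using assms(1) by (auto simp: ad_nilpotent_def)
  have comm: "cbr x (cbr y v) = cbr y (cbr x v)" for v
    using C.jacobi[of x y v] assms(2) by simp
  have "((cbr x \<circ> cbr y) ^^ n) v = 0" for v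
    using funpow_comp_commute[of "cbr x" "cbr y", OF comm] n by simp
  then have "endo_trace (cbr x \<circ> cbr y) = 0"
    by (intro endo_trace_nilpotent linear_compose C.br_linear)
  then show ?thesis using killing_form_complex[of x y] by (simp add: killing_form_def)
qed

text \<open>The orthogonal complement of the range of \<open>ad x\<close> is the image under
  \<open>\<tau>\<close> of the centralizer of \<open>x\<close>, to which a nilpotent
  \<open>x\<close> is orthogonal. So \<open>x = cbr x z\<close> for some \<open>z\<close>, and the
  \<open>kC\<close>-component of \<open>- z\<close> serves as \<open>h\<close>. This is the part of
  the Jacobson-Morozov theorem that makes orbits cones.\<close>

lemma nilpotent_eigen:
  assumes "x \<in> pC" "ad_nilpotent cbr x"
  shows "\<exists>h\<in>kC. cbr h x = x"
proof -
  have R: "subspace (range (cbr x))" by (rule linear_subspace_image[OF C.br_linear subspace_UNIV])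
  obtain s where s: "s \<in> range (cbr x)" "\<And>t. t \<in> range (cbr x) \<Longrightarrow> Q (x - s) t = 0"
    using Q.projection_ex[OF R] by blast
  define y where "y = x - s"
  have "Q (cbr (\<tau> x) y) z = 0" for z
    using Q_cbr[of "\<tau> x" y z] s(2)[of "cbr x z"] by (simp add: y_def)
  then have "cbr (\<tau> x) y = 0" using Q.eq_zero by blast
  then have "cbr x (\<tau> y) = 0" using \<tau>_cbr[of "\<tau> x" y] by (simp add: linear_0[OF \<tau>_linear])
  from nilpotent_orthogonal_centralizer[OF assms(2) this] have "Q x y = 0" by simp
  moreover have "Q y s = 0" using s by (simp add: y_def)
  ultimately have "Q y y = 0" by (simp add: y_def Q.bilinear_simps Q.sym)
  then have "y = 0" by (rule Q.eq_zero)
  then obtain z where z: "x = cbr x z" using s(1) by (auto simp: y_def)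
  obtain a b where ab: "a \<in> kC" "b \<in> pC" "z = a + b" using kC_pC_decomp by blast
  have eq: "x - cbr x a = cbr x b" using z ab(3) by (metis C.br_add_right add_diff_cancel_left')
  have "cbr x a \<in> pC" using kpC_mult[OF ab(1) assms(1)] C.br_anti[of x a] subspace_neg[OF subspace_pC] by simp
  then have "x - cbr x a \<in> pC" using assms(1) subspace_diff[OF subspace_pC] by blast
  then have "cbr x b = 0" using pC_mult[OF assms(1) ab(2)] kC_pC_disjoint eq by simp
  then have "x = - cbr a x" using eq C.br_anti[of x a] by (simp add: eq_neg_iff_add_eq_0)
  then have "cbr (- a) x = x" by (simp add: C.br_minus_left)
  then show ?thesis using ab(1) subspace_neg[OF subspace_kC] by blast
qed


subsection \<open>Submodules\<close>

definition submodule :: "('a \<times> 'a) set \<Rightarrow> bool" where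
  "submodule W \<longleftrightarrow> subspace W \<and> W \<subseteq> pC \<and> (\<forall>v\<in>W. J v \<in> W) \<and> (\<forall>z\<in>kC. \<forall>v\<in>W. cbr z v \<in> W)"

definition irreducible :: "('a \<times> 'a) set \<Rightarrow> bool" where
  "irreducible W \<longleftrightarrow> submodule W \<and> W \<noteq> {0} \<and> (\<forall>X. submodule X \<longrightarrow> X \<subseteq> W \<longrightarrow> X = {0} \<or> X = W)"

lemma submodule_pC: "submodule pC"
  by (auto simp: submodule_def subspace_pC J_pC kpC_mult)

lemma submoduleD:
  assumes "submodule W"
  shows "subspace W" "v \<in> W \<Longrightarrow> v \<in> pC" "v \<in> W \<Longrightarrow> J v \<in> W" "z \<in> kC \<Longrightarrow> v \<in> W \<Longrightarrow> cbr z v \<in> W"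
  using assms by (auto simp: submodule_def)

text \<open>With \<open>w = cbr u u'\<close> in \<open>kC\<close>, invariance turns
  \<open>Q w w\<close> into a pairing of \<open>u'\<close> with \<open>cbr (\<tau> u) w\<close>,
  which is \<open>\<tau>\<close> of an element of \<open>Y\<close>.\<close>

lemma orthogonal_submodules_commute:
  assumes "submodule Y" and orth: "\<And>u u'. u \<in> Y \<Longrightarrow> u' \<in> Y' \<Longrightarrow> Q u' (\<tau> u) = 0"
    and "Y' \<subseteq> pC" "u \<in> Y" "u' \<in> Y'"
  shows "cbr u u' = 0"
proof -
  define w where "w = cbr u u'"
  have "w \<in> kC" unfolding w_def using assms submoduleD(2) by (intro pC_mult) auto
  then have "cbr (\<tau> w) u \<in> Y" by (intro submoduleD(4)[OF assms(1)] \<tau>_kC assms)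
  from orth[OF this assms(5)] have "Q u' (cbr (\<tau> u) w) = 0"
    using C.br_anti[of "\<tau> u" w] by (simp add: \<tau>_cbr Q.bilinear_simps)
  then have "Q w w = 0" using Q_cbr[of u u' w] by (simp add: w_def)
  then show ?thesis using Q.eq_zero w_def by blast
qed

text \<open>Since \<open>Y'\<close> commutes with \<open>Y\<close>, the complex space
  \<open>Y + [Y, Y]\<close> is a nonzero ideal, hence everything. As \<open>[Y, Y]\<close> lies in
  \<open>kC\<close>, its \<open>pC\<close> part is \<open>Y\<close>.\<close>

lemma orthogonal_splitting_trivial:
  assumes Y: "submodule Y" "Y \<noteq> {0}"
    and orth: "\<And>u u'. u \<in> Y \<Longrightarrow> u' \<in> Y' \<Longrightarrow> Q u' (\<tau> u) = 0" and "Y' \<subseteq> pC"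
    and sum: "\<And>x. x \<in> pC \<Longrightarrow> \<exists>u\<in>Y. \<exists>u'\<in>Y'. x = u + u'"
  shows "Y = pC"
proof -
  interpret S: simple_lie_algebra cscale cbr by (rule complex_simple)
  note Yd = submoduleD[OF Y(1)]
  have comm: "cbr u u' = 0" if "u \<in> Y" "u' \<in> Y'" for u u'
    using orthogonal_submodules_commute[OF Y(1) orth \<open>Y' \<subseteq> pC\<close> that] .
  have comm': "cbr u' u = 0" if "u \<in> Y" "u' \<in> Y'" for u u'
    using comm[OF that] C.br_anti[of u' u] by simp
  define B where "B = Y \<union> {cbr u v |u v. u \<in> Y \<and> v \<in> Y}"
  define I where "I = span B"
  have YI: "u \<in> I" if "u \<in> Y" for u unfolding I_def using that by (intro span_base) (simp add: B_def)
  have YYI: "cbr u v \<in> I" if "u \<in> Y" "v \<in> Y" for u v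
    unfolding I_def by (rule span_base) (use that in \<open>unfold B_def, blast\<close>)
  have sI: "subspace I" by (simp add: I_def)
  have JI: "J v \<in> I" if "v \<in> I" for v
    unfolding I_def
  proof (rule linear_span_mem[OF J_linear subspace_span that[unfolded I_def]])
    fix v assume "v \<in> B"
    then consider "v \<in> Y" | a b where "v = cbr a b" "a \<in> Y" "b \<in> Y" by (auto simp: B_def)
    then show "J v \<in> span B"
      by cases (use YI YYI Yd(3) in \<open>auto simp: cbr_J_left[symmetric] I_def\<close>)
  qed
  have kI: "cbr z v \<in> I" if "z \<in> kC" "v \<in> B" for z v
  proof -
    have "cbr z (cbr a b) \<in> I" if "a \<in> Y" "b \<in> Y" for a b
      unfolding C.jacobi[of z a b] using that \<open>z \<in> kC\<close> Yd(4) by (intro subspace_add[OF sI] YYI) auto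
    then show ?thesis using that(2) YI Yd(4)[OF that(1)] unfolding B_def by blast
  qed
  have yI: "cbr z v \<in> I" if "z \<in> Y" "v \<in> B" for z v
  proof -
    have "cbr z (cbr a b) \<in> I" if "a \<in> Y" "b \<in> Y" for a b
    proof -
      have "cbr a b \<in> kC" using that Yd(2) by (intro pC_mult) auto
      then have "cbr (cbr a b) z \<in> I" using Yd(4) YI \<open>z \<in> Y\<close> by blast
      then show ?thesis using C.br_anti[of z "cbr a b"] subspace_neg[OF sI] by simp
    qed
    then show ?thesis using that(2) YYI[OF that(1)] unfolding B_def by blast
  qed
  have y'I: "cbr z v \<in> I" if "z \<in> Y'" "v \<in> B" for z v
  proof -
    have "cbr z (cbr a b) = 0" if "a \<in> Y" "b \<in> Y" for a b
      unfolding C.jacobi[of z a b] using comm'[OF _ \<open>z \<in> Y'\<close>] that by simp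
    then have "cbr z v = 0" using that(2) comm'[OF _ that(1)] unfolding B_def by blast
    then show ?thesis using subspace_0[OF sI] by simp
  qed
  have "cbr x v \<in> I" if "v \<in> I" for x v
  proof (rule linear_span_mem[OF C.br_linear sI that[unfolded I_def]])
    fix v assume v: "v \<in> B"
    obtain a b where ab: "a \<in> kC" "b \<in> pC" "x = a + b" using kC_pC_decomp by blast
    obtain u u' where u: "u \<in> Y" "u' \<in> Y'" "b = u + u'" using sum[OF ab(2)] by blast
    show "cbr x v \<in> I"
      unfolding ab(3) u(3) C.br_add_left using ab u v by (intro subspace_add[OF sI] kI yI y'I)
  qed
  then have "S.lie_ideal I"
    unfolding S.lie_ideal_def S.subspace_def
    using sI JI by (auto simp: cscale_J subspace_0 subspace_add subspace_scale)
  then have "I = {0} \<or> I = UNIV" by (rule S.ideal_trivial)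
  moreover have "I \<noteq> {0}" using Y(2) YI subspace_0[OF Yd(1)] by auto
  ultimately have I: "I = UNIV" by blast
  have form: "\<exists>u\<in>Y. v - u \<in> kC" if "v \<in> I" for v
    using that unfolding I_def
  proof (rule span_induct)
    have "\<exists>u\<in>Y. x + y - u \<in> kC" if ex: "\<exists>u\<in>Y. x - u \<in> kC" "\<exists>u\<in>Y. y - u \<in> kC" for x y
    proof -
      obtain u u' where u: "u \<in> Y" "x - u \<in> kC" "u' \<in> Y" "y - u' \<in> kC" using ex by blast
      have "(x - u) + (y - u') \<in> kC" by (rule subspace_add[OF subspace_kC u(2,4)])
      then show ?thesis using subspace_add[OF Yd(1) u(1,3)] by (intro bexI[of _ "u + u'"]) (auto simp: algebra_simps)
    qed
    moreover have "\<exists>u\<in>Y. c *\<^sub>R x - u \<in> kC" if ex: "\<exists>u\<in>Y. x - u \<in> kC" for c x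
    proof -
      obtain u where u: "u \<in> Y" "x - u \<in> kC" using ex by blast
      have "c *\<^sub>R (x - u) \<in> kC" by (rule subspace_scale[OF subspace_kC u(2)])
      then show ?thesis using subspace_scale[OF Yd(1) u(1)] by (intro bexI[of _ "c *\<^sub>R u"]) (auto simp: algebra_simps)
    qed
    moreover have "\<exists>u\<in>Y. 0 - u \<in> kC" using subspace_0[OF Yd(1)] subspace_0[OF subspace_kC] by force
    ultimately show "subspace {v. \<exists>u\<in>Y. v - u \<in> kC}" unfolding subspace_def by blast
    fix v assume "v \<in> B"
    then consider "v \<in> Y" | a b where "v = cbr a b" "a \<in> Y" "b \<in> Y" by (auto simp: B_def)
    then show "\<exists>u\<in>Y. v - u \<in> kC"
    proof cases
      case 1
      then show ?thesis using subspace_0[OF subspace_kC] by force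
    next
      case 2
      then have "v \<in> kC" using pC_mult Yd(2) by blast
      then show ?thesis using subspace_0[OF Yd(1)] by (intro bexI[of _ 0]) auto
    qed
  qed
  have "v \<in> Y" if v: "v \<in> pC" for v
  proof -
    obtain u where u: "u \<in> Y" "v - u \<in> kC" using form I by blast
    have "v - u \<in> pC" using v Yd(2)[OF u(1)] subspace_diff[OF subspace_pC] by blast
    then have "v - u = 0" using u(2) kC_pC_disjoint by blast
    then show ?thesis using u(1) by simp
  qed
  then show ?thesis using Yd(2) by blast
qed



text \<open>On \<open>pC\<close> the map \<open>\<tau>\<close> is \<open>- conjg\<close>, so for a
  conjugation-stable \<open>Y\<close> the ordinary orthogonal complement satisfies the twisted
  orthogonality of the splitting.\<close>

lemma conj_invariant_submodule:
  assumes "submodule Y" "Y \<noteq> {0}" "\<And>y. y \<in> Y \<Longrightarrow> conjg y \<in> Y"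
  shows "Y = pC"
proof (rule orthogonal_splitting_trivial[OF assms(1,2)])
  let ?Y' = "{u \<in> pC. \<forall>y\<in>Y. Q u y = 0}"
  show "?Y' \<subseteq> pC" by blast
  show "Q u' (\<tau> u) = 0" if "u \<in> Y" "u' \<in> ?Y'" for u u'
    using that assms(3) submoduleD(2)[OF assms(1)] by (simp add: \<tau>_pC Q.bilinear_simps)
  fix x assume x: "x \<in> pC"
  obtain s where s: "s \<in> Y" "\<And>t. t \<in> Y \<Longrightarrow> Q (x - s) t = 0"
    using Q.projection_ex[OF submoduleD(1)[OF assms(1)]] by blast
  have "x - s \<in> ?Y'" using s x submoduleD(2)[OF assms(1)] subspace_diff[OF subspace_pC] by blast
  then show "\<exists>u\<in>Y. \<exists>u'\<in>?Y'. x = u + u'" using s(1) by (intro bexI[of _ s] bexI[of _ "x - s"]) auto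
qed

text \<open>Let \<open>P\<close> be the orthogonal projection onto a proper submodule. It commutes with
  \<open>kC\<close> and \<open>J\<close> and is self-adjoint, so its imaginary part is a skew operator on \<open>p\<close> which
  commutes with \<open>k\<close>; extended by zero to \<open>k\<close> it is a derivation, hence inner.\<close>

lemma reducible_imp_center:
  assumes W: "submodule W" "W \<noteq> {0}" "W \<noteq> pC"
  shows "\<exists>z\<in>k. z \<noteq> 0 \<and> (\<forall>x\<in>k. br z x = 0)"
proof -
  note Wd = submoduleD[OF W(1)]
  have "\<exists>P. \<forall>x. P x \<in> W \<and> (\<forall>t\<in>W. Q (x - P x) t = 0)"
    using Q.projection_ex[OF Wd(1)] by (intro choice) blast
  then obtain P where P: "\<And>x. P x \<in> W" "\<And>x t. t \<in> W \<Longrightarrow> Q (x - P x) t = 0" by blast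
  have Peq: "P x = s" if "s \<in> W" "\<And>t. t \<in> W \<Longrightarrow> Q (x - s) t = 0" for x s
    using Q.projection_unique[OF Wd(1) P(1) that(1) P(2) that(2)] .
  have PQ: "Q (P x) t = Q x t" if "t \<in> W" for x t
    using P(2)[OF that, of x] by (simp add: Q.bilinear_simps)
  have P_add: "P (x + y) = P x + P y" for x y
    by (rule Peq) (simp_all add: P(1) subspace_add[OF Wd(1)] Q.bilinear_simps PQ)
  have P_scale: "P (c *\<^sub>R x) = c *\<^sub>R P x" for c x
    by (rule Peq) (simp_all add: P(1) subspace_scale[OF Wd(1)] Q.bilinear_simps PQ)
  have P_J: "P (J x) = J (P x)" for x
    by (rule Peq) (simp_all add: P(1) Wd(3) Q.bilinear_simps Q_J PQ)
  have P_k: "P (cbr z x) = cbr z (P x)" if "z \<in> kC" for z x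
    by (rule Peq) (simp_all add: P(1) Wd(4) that Q.bilinear_simps Q_cbr PQ \<tau>_kC)
  have P_sym: "Q (P x) y = Q x (P y)" for x y
    using PQ[OF P(1)[of y], of x] PQ[OF P(1)[of x], of y] by (simp add: Q.sym)
  have P_kC: "P x = 0" if "x \<in> kC" for x
    by (rule Peq) (simp_all add: subspace_0[OF Wd(1)] Q_kC_pC that Wd(2))
  define d where "d x = snd (P (x, 0))" for x
  have lin: "linear d"
  proof (rule linearI)
    show "d (x + y) = d x + d y" for x y using P_add[of "(x, 0)" "(y, 0)"] by (simp add: d_def)
    show "d (c *\<^sub>R x) = c *\<^sub>R d x" for c x using P_scale[of c "(x, 0)"] by (simp add: d_def)
  qed
  have dk: "d x = 0" if "x \<in> k" for x
    using P_kC[of "(x, 0)"] that subspace_0[OF subspace_k] by (simp add: d_def complexify_def)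
  have dp: "d x \<in> p" for x using Wd(2)[OF P(1)] by (simp add: d_def pC_iff)
  have d_br: "d (br x y) = br x (d y)" if "x \<in> k" for x y
  proof -
    have "P (cbr (x, 0) (y, 0)) = cbr (x, 0) (P (y, 0))"
      using that subspace_0[OF subspace_k] by (intro P_k) (simp add: complexify_def)
    then show ?thesis by (simp add: cbracket_def d_def)
  qed
  have skew: "q (d x) y = - q x (d y)" for x y
    using P_sym[of "(x, 0)" "J (y, 0)"] unfolding P_J by (simp add: Q_def J_def d_def q.bilinear_simps)
  \<comment> \<open>On two elements of \<open>p\<close> the derivation rule asks for
    \<open>w = 0\<close>, because \<open>d\<close> vanishes on \<open>k\<close>. Moving brackets and
    \<open>d\<close> across \<open>q\<close> makes the two halves of \<open>q w w\<close>
    cancel.\<close>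
  have d_pp: "br (d x) y + br x (d y) = 0" if xy: "x \<in> p" "y \<in> p" for x y
  proof -
    define w where "w = br (d x) y + br x (d y)"
    have wk: "w \<in> k" unfolding w_def using p_mult dp xy by (intro subspace_add[OF subspace_k]) auto
    have "q w w = q (br (d x) y) w + q (br x (d y)) w"
      by (simp add: w_def[symmetric] q.add_left[symmetric])
    also have "q (br (d x) y) w = - q y (br (\<theta> (d x)) w)" by (rule q_br)
    also have "\<theta> (d x) = - d x" using dp by (simp add: p_def)
    also have "br (- d x) w = d (br w x)" using d_br[OF wk, of x] br_anti[of w "d x"] by (simp add: br_simps)
    also have "- q y (d (br w x)) = q (d y) (br w x)" using skew[of y "br w x"] by simp
    also have "q (br x (d y)) w = - q (d y) (br (\<theta> x) w)" by (rule q_br)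
    also have "\<theta> x = - x" using xy by (simp add: p_def)
    also have "br (- x) w = br w x" using br_anti[of w x] by (simp add: br_simps)
    finally have "q w w = 0" by simp
    then show ?thesis using q.eq_zero w_def by blast
  qed
  have "derivation d"
    unfolding derivation_def
  proof (intro conjI allI lin)
    fix x y
    obtain a b where ab: "a \<in> k" "b \<in> p" "x = a + b" using k_p_decomp by blast
    obtain a' b' where ab': "a' \<in> k" "b' \<in> p" "y = a' + b'" using k_p_decomp by blast
    have "d (br b a') = br (d b) a'"
      using d_br[OF ab'(1), of b] br_anti[of b a'] br_anti[of "d b" a'] by (simp add: linear_neg[OF lin])
    moreover have "d (br b b') = 0" using ab ab' by (intro dk p_mult)
    moreover have "br (d b) b' + br b (d b') = 0" using d_pp ab ab' by blast
    ultimately show "d (br x y) = br (d x) y + br x (d y)"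
      using d_br[OF ab(1)] dk ab(1) ab'(1)
      by (simp add: ab(3) ab'(3) br_simps linear_add[OF lin] algebra_simps)
  qed
  from derivation_inner[OF killing_nondegenerate this] obtain z where z: "\<And>x. d x = br z x" by blast
  obtain a b where ab: "a \<in> k" "b \<in> p" "z = a + b" using k_p_decomp by blast
  have disj: "u = 0" if "u \<in> k" "u \<in> p" for u using q_k_p[OF that] q.eq_zero by blast
  \<comment> \<open>\<open>d\<close> vanishes on \<open>k\<close>, so the \<open>k\<close>- and
    \<open>p\<close>-parts of \<open>br z y\<close> vanish separately; the \<open>p\<close>-part is
    \<open>br b y\<close>.\<close>
  have "br y b = 0" if y: "y \<in> k" for y
  proof -
    have "br a y + br b y = 0" using z[of y] dk[OF y] ab(3) by (simp add: br_simps)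
    then have "br b y = - br a y" by (simp add: eq_neg_iff_add_eq_0 add.commute)
    moreover have "- br a y \<in> k" using k_mult[OF ab(1) y] subspace_neg[OF subspace_k] by blast
    moreover have "br b y \<in> p" using kp_mult[OF y ab(2)] br_anti[of b y] subspace_neg[OF subspace_p] by simp
    ultimately have "br b y = 0" using disj by metis
    then show ?thesis using br_anti[of y b] by simp
  qed
  then have "b = 0" using center_trivial_p[OF ab(2)] by blast
  then have zk: "z \<in> k" using ab by simp
  \<comment> \<open>\<open>z = 0\<close> would make \<open>P\<close> commute with conjugation and
    \<open>W\<close> stable under it, which forces \<open>W = pC\<close>.\<close>
  have "z \<noteq> 0"
  proof
    assume "z = 0"
    then have snd0: "snd (P (x, 0)) = 0" for x using z[of x] by (simp add: d_def)
    have P_conj: "P (conjg v) = conjg (P v)" for v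
    proof -
      obtain x y where v: "v = (x, y)" by (cases v)
      have 1: "(x, s *\<^sub>R y) = (x, 0) + s *\<^sub>R J (y, 0)" for s :: real by (simp add: J_def)
      have "P (x, s *\<^sub>R y) = P (x, 0) + s *\<^sub>R J (P (y, 0))" for s
        unfolding 1 P_add P_scale P_J ..
      from this[of 1] this[of "-1"] show ?thesis
        using snd0[of x] snd0[of y] by (simp add: v conjg_def J_def prod_eq_iff)
    qed
    have "conjg w \<in> W" if "w \<in> W" for w
    proof -
      have "P w = w" using that by (intro Peq) (simp_all add: Q.bilinear_simps)
      then show ?thesis using P(1)[of "conjg w"] by (simp add: P_conj)
    qed
    then show False using conj_invariant_submodule[OF W(1,2)] W(3) by blast
  qed
  moreover have "br z x = 0" if "x \<in> k" for x using z dk[OF that] by metis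
  ultimately show ?thesis using zk by blast
qed

section \<open>Irreducible summands of \<open>pC\<close>\<close>

lemma pC_irreducible:
  assumes "lie_center br k = {0}" "pC \<noteq> {0}"
  shows "irreducible pC"
  unfolding irreducible_def
proof (intro conjI allI impI submodule_pC assms(2))
  fix X assume X: "submodule X" "X \<subseteq> pC"
  show "X = {0} \<or> X = pC"
  proof (rule ccontr)
    assume "\<not> (X = {0} \<or> X = pC)"
    then obtain z where "z \<in> k" "z \<noteq> 0" "\<forall>x\<in>k. br z x = 0" using reducible_imp_center X by blast
    then have "z \<in> lie_center br k" by (simp add: lie_center_def)
    then show False using assms(1) \<open>z \<noteq> 0\<close> by blast
  qed
qed

text \<open>\<open>J\<close> is multiplication by i, so these are eigenspaces of
  \<open>i ad y\<close>, which is symmetric for \<open>y \<in> k\<close> and has real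
  eigenvalues.\<close>

definition eigen :: "'a \<Rightarrow> real \<Rightarrow> ('a \<times> 'a) set" where
  "eigen y c = {v \<in> pC. J (cbr (y, 0) v) = c *\<^sub>R v}"

lemma real_kC: "y \<in> k \<Longrightarrow> (y, 0) \<in> kC"
  using subspace_0[OF subspace_k] by (simp add: complexify_def)

lemma J_ad_linear: "linear (\<lambda>v. J (cbr (y, 0) v))"
  using linear_compose[OF C.br_linear J_linear] by (simp add: o_def)

lemma J_ad_symmetric: "y \<in> k \<Longrightarrow> Q (J (cbr (y, 0) v)) w = Q v (J (cbr (y, 0) w))"
  by (simp add: Q_J Q_cbr \<tau>_def k_def \<theta>_simps cbr_J_right)

lemma J_ad_commute:
  assumes "y \<in> k" "\<And>x. x \<in> k \<Longrightarrow> br y x = 0" "z \<in> kC"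
  shows "J (cbr (y, 0) (cbr z v)) = cbr z (J (cbr (y, 0) v))"
proof -
  have "cbr (y, 0) z = 0" using assms by (simp add: cbracket_def kC_iff prod_eq_iff)
  then have "cbr (y, 0) (cbr z v) = cbr z (cbr (y, 0) v)" using C.jacobi[of "(y, 0)" z v] by simp
  then show ?thesis by (simp add: cbr_J_right)
qed

lemma eigen_submodule:
  assumes y: "y \<in> k" "\<And>x. x \<in> k \<Longrightarrow> br y x = 0"
  shows "submodule (eigen y c)"
  unfolding submodule_def
proof (intro conjI ballI)
  show "subspace (eigen y c)" unfolding eigen_def by (rule subspace_eigenspace[OF J_ad_linear subspace_pC])
  show "eigen y c \<subseteq> pC" by (auto simp: eigen_def)
  show "J v \<in> eigen y c" if "v \<in> eigen y c" for v
    using that by (simp add: eigen_def J_pC cbr_J_right linear_scale[OF J_linear])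
  show "cbr z v \<in> eigen y c" if "z \<in> kC" "v \<in> eigen y c" for z v
    using that by (simp add: eigen_def kpC_mult J_ad_commute[OF y] C.br_scale_right)
qed

lemma conj_eigen: "v \<in> eigen y c \<Longrightarrow> conjg v \<in> eigen y (- c)"
proof -
  assume v: "v \<in> eigen y c"
  have "J (cbr (y, 0) (conjg v)) = - conjg (J (cbr (y, 0) v))"
    unfolding conj_J conj_cbr by (simp add: conjg_def[of "(y, 0)"])
  then show ?thesis using v by (simp add: eigen_def conj_pC linear_scale[OF conj_linear])
qed

text \<open>Conjugation exchanges the eigenvalues \<open>c\<close> and \<open>- c\<close>. For a
  nonzero submodule \<open>X\<close>, the sum of \<open>X\<close> and its conjugate is stable under
  conjugation, hence all of \<open>pC\<close>. Applied to one eigenspace this leaves only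
  \<open>c\<close> and \<open>- c\<close>; applied to a submodule of an eigenspace it gives
  irreducibility.\<close>

lemma hermitian_decomposition:
  assumes y: "y \<in> k" "y \<noteq> 0" "\<And>x. x \<in> k \<Longrightarrow> br y x = 0"
  shows "\<exists>c>0. irreducible (eigen y c) \<and> irreducible (eigen y (- c)) \<and>
    (\<forall>x\<in>pC. \<exists>u\<in>eigen y c. \<exists>v\<in>eigen y (- c). x = u + v)"
proof -
  let ?N = "\<lambda>v. J (cbr (y, 0) v)"
  note sub = eigen_submodule[OF y(1,3)]
  \<comment> \<open>If 0 were the only eigenvalue on \<open>pC\<close>, then \<open>y\<close> would
    commute with \<open>p\<close> as well as with \<open>k\<close> and be central.\<close>
  have "\<exists>c u. c \<noteq> 0 \<and> u \<noteq> 0 \<and> u \<in> eigen y c"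
  proof (rule ccontr)
    assume no: "\<not> ?thesis"
    have inv: "?N v \<in> pC" if "v \<in> pC" for v using that by (intro J_pC kpC_mult real_kC y)
    have "span {v \<in> pC. \<exists>c. ?N v = c *\<^sub>R v} = pC"
      by (rule Q.span_eigenvectors[OF subspace_pC J_ad_linear inv J_ad_symmetric[OF y(1)]])
    moreover have "span {v \<in> pC. \<exists>c. ?N v = c *\<^sub>R v} \<subseteq> {v. ?N v = 0}"
    proof (rule span_minimal)
      show "subspace {v. ?N v = 0}" by (rule linear_subspace_kernel[OF J_ad_linear])
      show "{v \<in> pC. \<exists>c. ?N v = c *\<^sub>R v} \<subseteq> {v. ?N v = 0}"
      proof
        fix v assume "v \<in> {v \<in> pC. \<exists>c. ?N v = c *\<^sub>R v}"
        then obtain c where c: "v \<in> eigen y c" "?N v = c *\<^sub>R v" by (auto simp: eigen_def)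
        then have "c = 0 \<or> v = 0" using no by blast
        then show "v \<in> {v. ?N v = 0}" using c(2) by auto
      qed
    qed
    ultimately have N0: "?N v = 0" if "v \<in> pC" for v using that by blast
    have "br y x = 0" if "x \<in> p" for x
      using N0[of "(x, 0)"] that subspace_0[OF subspace_p] by (simp add: complexify_def cbracket_def J_def prod_eq_iff)
    then have "br y x = 0" for x using k_p_decomp[of x] y(3) by (auto simp: br_simps)
    then show False using center_trivial y(2) by blast
  qed
  then obtain c0 u0 where 0: "c0 \<noteq> 0" "u0 \<noteq> 0" "u0 \<in> eigen y c0" by blast
  define c where "c = \<bar>c0\<bar>"
  have c: "c > 0" using 0 by (simp add: c_def)
  have "conjg u0 \<noteq> 0" using 0(2) conj_conj by (metis linear_0[OF conj_linear])
  then have ne: "\<exists>u\<in>eigen y (s * c). u \<noteq> 0" if "s = 1 \<or> s = -1" for s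
    using that 0 conj_eigen[OF 0(3)] by (cases "c0 > 0") (auto simp: c_def)
  have disj: "v = 0" if "v \<in> eigen y a" "v \<in> eigen y (- a)" "a \<noteq> 0" for v a
  proof -
    have "a *\<^sub>R v = (- a) *\<^sub>R v" using that(1,2) unfolding eigen_def by simp
    then have "(a + a) *\<^sub>R v = 0" unfolding scaleR_add_left by (metis scaleR_minus_left add.right_inverse)
    then show ?thesis using that(3) by simp
  qed
  have sum: "\<exists>u\<in>X. \<exists>v\<in>X. x = u + conjg v" if X: "submodule X" "X \<noteq> {0}" and x: "x \<in> pC" for X x
  proof -
    note Xd = submoduleD[OF X(1)]
    define Y where "Y = {u + conjg v | u v. u \<in> X \<and> v \<in> X}"
    have Y: "u + conjg v \<in> Y" if "u \<in> X" "v \<in> X" for u v using that unfolding Y_def by blast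
    have "submodule Y"
      unfolding submodule_def
    proof (intro conjI ballI)
      show "subspace Y"
        unfolding subspace_def
      proof (intro conjI ballI allI)
        show "0 \<in> Y" using Y[OF subspace_0[OF Xd(1)] subspace_0[OF Xd(1)]] by (simp add: linear_0[OF conj_linear])
        fix a b s assume "a \<in> Y"
        then obtain u v where uv: "u \<in> X" "v \<in> X" "a = u + conjg v" by (auto simp: Y_def)
        show "s *\<^sub>R a \<in> Y"
          using Y[OF subspace_scale[OF Xd(1) uv(1), of s] subspace_scale[OF Xd(1) uv(2), of s]]
          by (simp add: uv(3) linear_scale[OF conj_linear] scaleR_add_right)
        assume "b \<in> Y"
        then obtain u' v' where uv': "u' \<in> X" "v' \<in> X" "b = u' + conjg v'" by (auto simp: Y_def)
        show "a + b \<in> Y"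
          using Y[OF subspace_add[OF Xd(1) uv(1) uv'(1)] subspace_add[OF Xd(1) uv(2) uv'(2)]]
          by (simp add: uv(3) uv'(3) linear_add[OF conj_linear] algebra_simps)
      qed
      show "Y \<subseteq> pC" using Xd(2) conj_pC subspace_add[OF subspace_pC] unfolding Y_def by blast
      fix a assume "a \<in> Y"
      then obtain u v where uv: "u \<in> X" "v \<in> X" "a = u + conjg v" by (auto simp: Y_def)
      show "J a \<in> Y"
        using Y[OF Xd(3)[OF uv(1)] subspace_neg[OF Xd(1) Xd(3)[OF uv(2)]]]
        by (simp add: uv(3) linear_add[OF J_linear] linear_neg[OF conj_linear] conj_J)
      fix z assume z: "z \<in> kC"
      have "conjg z \<in> kC" using z subspace_neg[OF subspace_k] by (simp add: kC_iff conjg_def)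
      then show "cbr z a \<in> Y"
        using Y[OF Xd(4)[OF z uv(1)] Xd(4)[OF _ uv(2), of "conjg z"]]
        by (simp add: uv(3) C.br_simps conj_cbr)
    qed
    moreover have "Y \<noteq> {0}"
    proof -
      obtain u where "u \<in> X" "u \<noteq> 0" using X(2) subspace_0[OF Xd(1)] by auto
      then have "u \<in> Y" using Y[OF _ subspace_0[OF Xd(1)], of u] by (simp add: linear_0[OF conj_linear])
      then show ?thesis using \<open>u \<noteq> 0\<close> by blast
    qed
    moreover have "conjg a \<in> Y" if aY: "a \<in> Y" for a
    proof -
      obtain u v where uv: "u \<in> X" "v \<in> X" "a = u + conjg v" using aY by (auto simp: Y_def)
      then show ?thesis using Y[OF uv(2,1)] by (simp add: linear_add[OF conj_linear] add.commute)
    qed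
    ultimately have "Y = pC" by (rule conj_invariant_submodule)
    then show ?thesis using x unfolding Y_def by blast
  qed
  have irr: "irreducible (eigen y a)" if ne: "\<exists>u\<in>eigen y a. u \<noteq> 0" and a: "a \<noteq> 0" for a
    unfolding irreducible_def
  proof (intro conjI allI impI sub)
    show "eigen y a \<noteq> {0}" using ne by blast
    fix X assume X: "submodule X" "X \<subseteq> eigen y a"
    show "X = {0} \<or> X = eigen y a"
    proof (cases "X = {0}")
      case X0: False
      have "x \<in> X" if x: "x \<in> eigen y a" for x
      proof -
        obtain u v where uv: "u \<in> X" "v \<in> X" "x = u + conjg v"
          using sum[OF X(1) X0, of x] submoduleD(2)[OF sub x] by blast
        have "conjg v \<in> eigen y (- a)" using conj_eigen uv X by blast
        moreover have "x - u \<in> eigen y a" using x uv(1) X(2) subspace_diff[OF submoduleD(1)[OF sub]] by blast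
        ultimately have "conjg v = 0" using disj[of "conjg v" a] uv(3) a by simp
        then show ?thesis using uv by simp
      qed
      then show ?thesis using X(2) by blast
    qed simp
  qed
  have "irreducible (eigen y c)" "irreducible (eigen y (- c))"
    using irr[of c] irr[of "- c"] ne[of 1] ne[of "-1"] c by auto
  moreover have "\<forall>x\<in>pC. \<exists>u\<in>eigen y c. \<exists>v\<in>eigen y (- c). x = u + v"
  proof
    fix x assume x: "x \<in> pC"
    have "eigen y c \<noteq> {0}" using ne[of 1] by auto
    then obtain u v where "u \<in> eigen y c" "v \<in> eigen y c" "x = u + conjg v" using sum[OF sub _ x] by blast
    then show "\<exists>u\<in>eigen y c. \<exists>v\<in>eigen y (- c). x = u + v" using conj_eigen by blast
  qed
  ultimately show ?thesis using c by blast
qed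

end

context cartan_simple
begin

subsection \<open>Extremal vectors\<close>

definition A :: "'a \<Rightarrow> 'a \<times> 'a \<Rightarrow> 'a \<times> 'a" where "A y v = J (cbr (y, 0) v)"

lemma A_linear: "linear (A y)" unfolding A_def by (rule J_ad_linear)

lemma A_symmetric: "y \<in> k \<Longrightarrow> Q (A y v) w = Q v (A y w)" unfolding A_def by (rule J_ad_symmetric)

lemma A_ad: "A y v = cbr (J (y, 0)) v" by (simp add: A_def cbr_J_left)

lemma A_cbr: "A y (cbr z v) = cbr (A y z) v + cbr z (A y v)"
  unfolding A_ad by (rule C.jacobi)

lemma A_J: "A y (J v) = J (A y v)" by (simp add: A_def cbr_J_right)

lemma A_kC: "y \<in> k \<Longrightarrow> z \<in> kC \<Longrightarrow> A y z \<in> kC" unfolding A_def by (intro J_kC kC_mult real_kC)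

lemma J_real_kC: "y \<in> k \<Longrightarrow> J (y, 0) \<in> kC" by (intro J_kC real_kC)

lemma A_submodule: "submodule W \<Longrightarrow> y \<in> k \<Longrightarrow> v \<in> W \<Longrightarrow> A y v \<in> W"
  unfolding A_ad by (intro submoduleD(4) J_real_kC)

lemma eigen_shift:
  assumes "A y z = a *\<^sub>R z" "A y v = b *\<^sub>R v"
  shows "A y (cbr z v) = (a + b) *\<^sub>R cbr z v"
  by (simp add: A_cbr assms C.br_simps scaleR_add_left)

lemma kC_span_eigenvectors: "y \<in> k \<Longrightarrow> span {z \<in> kC. \<exists>c. A y z = c *\<^sub>R z} = kC"
  by (rule Q.span_eigenvectors[OF subspace_kC A_linear A_kC A_symmetric])

definition below :: "('a \<times> 'a) set \<Rightarrow> 'a \<Rightarrow> real \<Rightarrow> ('a \<times> 'a) set" where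
  "below W y c = span {v \<in> W. \<exists>c'<c. A y v = c' *\<^sub>R v}"

text \<open>The last clause says that, inside \<open>W\<close>, the top eigenspace of
  \<open>A y\<close> is the complex line of \<open>w\<close> and all other eigenvalues are below
  \<open>m\<close>. This is the form in which a highest weight vector is used.\<close>

definition extremal :: "('a \<times> 'a) set \<Rightarrow> 'a \<Rightarrow> real \<Rightarrow> 'a \<times> 'a \<Rightarrow> bool" where
  "extremal W y m w \<longleftrightarrow> y \<in> k \<and> m > 0 \<and> w \<in> W \<and> w \<noteq> 0 \<and> A y w = m *\<^sub>R w \<and>
     (\<forall>v\<in>W. \<exists>e\<in>span {w, J w}. \<exists>r\<in>below W y m. v = e + r)"

text \<open>Spans what elements lowering the eigenvalue of \<open>A y\<close> generate from
  \<open>w\<close>. Restricting these elements to eigenvectors keeps every member an eigenvector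
  when \<open>w\<close> is one.\<close>

inductive_set lowered :: "'a \<Rightarrow> 'a \<times> 'a \<Rightarrow> ('a \<times> 'a) set" for y w where
  base: "w \<in> lowered y w"
| J: "u \<in> lowered y w \<Longrightarrow> J u \<in> lowered y w"
| lower: "u \<in> lowered y w \<Longrightarrow> z \<in> kC \<Longrightarrow> A y z = a *\<^sub>R z \<Longrightarrow> a < 0 \<Longrightarrow> cbr z u \<in> lowered y w"

lemma span_lowered_J: "v \<in> span (lowered y w) \<Longrightarrow> J v \<in> span (lowered y w)"
  by (rule linear_span_mem[OF J_linear subspace_span]) (auto intro: span_base lowered.J)

text \<open>This replaces the decomposition of the enveloping algebra of \<open>kC\<close> into lowering, neutral and
  raising parts.\<close>

lemma lowered_invariant:
  assumes raise: "\<And>z a. z \<in> kC \<Longrightarrow> A y z = a *\<^sub>R z \<Longrightarrow> a > 0 \<Longrightarrow> cbr z w = 0"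
    and neutral: "\<And>z. z \<in> kC \<Longrightarrow> A y z = 0 \<Longrightarrow> cbr z w \<in> span {w, J w}"
    and "u \<in> lowered y w" "z \<in> kC" "A y z = a *\<^sub>R z"
  shows "cbr z u \<in> span (lowered y w)"
  using assms(3-)
proof (induction arbitrary: z a)
  case base
  consider "a > 0" | "a = 0" | "a < 0" by linarith
  then show ?case
  proof cases
    case 1
    then show ?thesis using raise[OF base] by (simp add: span_0)
  next
    case 2
    have "span {w, J w} \<subseteq> span (lowered y w)"
      by (intro span_mono) (auto intro: lowered.intros)
    moreover have "cbr z w \<in> span {w, J w}" using base 2 by (intro neutral) simp_all
    ultimately show ?thesis by blast
  next
    case 3
    then show ?thesis using base by (intro span_base lowered.lower lowered.base)
  qed
next
  case (J u)
  show ?case unfolding cbr_J_right by (rule span_lowered_J[OF J.IH[OF J.prems]])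
next
  case (lower u x b)
  have "cbr x (cbr z u) \<in> span (lowered y w)"
    by (rule linear_span_mem[OF C.br_linear subspace_span lower.IH[OF lower.prems]])
      (rule span_base[OF lowered.lower[OF _ lower.hyps(2-4)]])
  moreover have "cbr (cbr z x) u \<in> span (lowered y w)"
    by (rule lower.IH[OF kC_mult[OF lower.prems(1) lower.hyps(2)] eigen_shift[OF lower.prems(2) lower.hyps(3)]])
  ultimately show ?case unfolding C.jacobi[of z x u] by (intro span_add)
qed

text \<open>Maximise \<open>Q (A y w) w\<close> over unit vectors \<open>y \<in> k\<close> and \<open>w \<in> W\<close>. At a maximum the centralizer
  of \<open>y\<close> in \<open>kC\<close> acts by scalars on the top eigenspace of \<open>A y\<close>.\<close>

lemma maximal_eigenvalue_ex:
  assumes W: "submodule W" "W \<noteq> {0}"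
  shows "\<exists>y m w. y \<in> k \<and> m > 0 \<and> w \<in> W \<and> w \<noteq> 0 \<and> A y w = m *\<^sub>R w \<and>
    (\<forall>v\<in>W. \<forall>c. v \<noteq> 0 \<longrightarrow> A y v = c *\<^sub>R v \<longrightarrow> c \<le> m) \<and>
    (\<forall>z\<in>kC. A y z = 0 \<longrightarrow> cbr z w \<in> span {w, J w})"
proof -
  note Wd = submoduleD[OF W(1)]
  have A_left: "A (c *\<^sub>R y) v = c *\<^sub>R A y v" "A (y + y') v = A y v + A y' v" for c y y' v
  proof -
    have "(c *\<^sub>R y, 0) = c *\<^sub>R (y, 0::'a)" "(y + y', 0) = (y, 0::'a) + (y', 0)" by simp_all
    then show "A (c *\<^sub>R y) v = c *\<^sub>R A y v" "A (y + y') v = A y v + A y' v"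
      unfolding A_def by (simp_all only: C.br_simps linear_scale[OF J_linear] linear_add[OF J_linear])
  qed
  have "\<exists>y\<in>k. \<exists>v\<in>W. A y v \<noteq> 0"
  proof (rule ccontr)
    assume "\<not> ?thesis"
    then have zero: "A y v = 0" if "y \<in> k" "v \<in> W" for y v using that by blast
    obtain v where v: "v \<in> W" "v \<noteq> 0" using W(2) subspace_0[OF Wd(1)] by auto
    have "br y (fst v) = 0 \<and> br y (snd v) = 0" if "y \<in> k" for y
      using zero[OF that v(1)] by (simp add: A_def J_def cbracket_def prod_eq_iff)
    then have "fst v = 0" "snd v = 0"
      using center_trivial_p[of "fst v"] center_trivial_p[of "snd v"] Wd(2)[OF v(1)] by (auto simp: pC_iff)
    then show False using v(2) by (simp add: prod_eq_iff)
  qed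
  then obtain y1 w1 where 1: "y1 \<in> k" "w1 \<in> W" "A y1 w1 \<noteq> 0" by blast
  define f where "f y w = Q (A y w) w" for y w
  define K1 where "K1 = {y \<in> k. q y y = 1}"
  define W1 where "W1 = {w \<in> W. Q w w = 1}"
  have comp: "compact (K1 \<times> W1)"
    unfolding K1_def W1_def
    by (intro compact_Times q.unit_compact Q.unit_compact closed_subspace subspace_k Wd(1))
  have "y1 \<noteq> 0" "w1 \<noteq> 0"
    using 1(3) A_left(1)[of 0 y1 w1] linear_0[OF A_linear[of y1]] by auto
  then obtain s1 t1 where "s1 *\<^sub>R y1 \<in> K1" "t1 *\<^sub>R w1 \<in> W1"
    using q.unit_nonempty[OF subspace_k 1(1)] Q.unit_nonempty[OF Wd(1) 1(2)] unfolding K1_def W1_def by blast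
  then have ne: "K1 \<times> W1 \<noteq> {}" by blast
  have bl: "bounded_linear J" "bounded_linear (\<lambda>y. (y, 0::'a))"
    using J_linear linear_conv_bounded_linear bounded_linear_Pair[OF bounded_linear_ident bounded_linear_zero] by blast+
  have "continuous_on (K1 \<times> W1) (\<lambda>z. f (fst z) (snd z))"
    unfolding f_def A_def
    by (intro Q.continuous_quadratic bounded_linear.continuous_on[OF bl(1)]
        bounded_bilinear.continuous_on[OF C.bounded_bilinear] continuous_intros)
  then obtain z where "z \<in> K1 \<times> W1" "\<And>z'. z' \<in> K1 \<times> W1 \<Longrightarrow> f (fst z') (snd z') \<le> f (fst z) (snd z)"
    using continuous_attains_sup[OF comp ne] by blast
  then obtain y w where yw: "y \<in> k" "q y y = 1" "w \<in> W" "Q w w = 1"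
    and max: "\<And>y' w'. y' \<in> k \<Longrightarrow> q y' y' = 1 \<Longrightarrow> w' \<in> W \<Longrightarrow> Q w' w' = 1 \<Longrightarrow> f y' w' \<le> f y w"
    by (force simp: K1_def W1_def)
  define m where "m = f y w"
  note inv = A_submodule[OF W(1)]
  have "Q (A y v) v \<le> Q (A y w) w" if "v \<in> W" "Q v v = 1" for v
    using max[OF yw(1,2) that] by (simp add: f_def)
  then have Aw: "A y w = m *\<^sub>R w"
    unfolding m_def f_def
    by (intro Q.rayleigh_maximizer[OF Wd(1) A_linear inv[OF yw(1)] A_symmetric[OF yw(1)] yw(3,4)])
  \<comment> \<open>Otherwise \<open>f\<close> is nonpositive everywhere. Passing from
    \<open>y1\<close> to \<open>- y1\<close> shows that \<open>f y1\<close> vanishes on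
    \<open>W\<close>, and polarisation gives \<open>A y1 w1 = 0\<close>.\<close>
  have m_pos: "m > 0"
  proof (rule ccontr)
    assume "\<not> m > 0"
    have le: "f y' w' \<le> 0" if mem: "y' \<in> k" "w' \<in> W" for y' w'
    proof (cases "y' = 0 \<or> w' = 0")
      case True
      then have "A y' w' = 0" using A_left(1)[of 0 y' w'] linear_0[OF A_linear[of y']] by auto
      then show ?thesis by (simp add: f_def Q.zero_left)
    next
      case False
      obtain s where s: "s > 0" "s *\<^sub>R y' \<in> k" "q (s *\<^sub>R y') (s *\<^sub>R y') = 1"
        using q.unit_nonempty[OF subspace_k mem(1)] False by blast
      obtain t where t: "t > 0" "t *\<^sub>R w' \<in> W" "Q (t *\<^sub>R w') (t *\<^sub>R w') = 1"
        using Q.unit_nonempty[OF Wd(1) mem(2)] False by blast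
      have "f (s *\<^sub>R y') (t *\<^sub>R w') = s * t * t * f y' w'"
        by (simp add: f_def A_left linear_scale[OF A_linear] Q.scale_left Q.scale_right)
      then have "s * t * t * f y' w' \<le> 0"
        using max[OF s(2,3) t(2,3)] \<open>\<not> m > 0\<close> by (simp add: m_def)
      moreover have "s * t * t > 0" using s(1) t(1) by simp
      ultimately show ?thesis using mult_pos_pos[of "s * t * t" "f y' w'"] by linarith
    qed
    have "f y1 v = 0" if "v \<in> W" for v
      using le[OF 1(1) that] le[OF subspace_neg[OF subspace_k 1(1)] that] A_left(1)[of "-1" y1 v]
      by (simp add: f_def Q.minus_left)
    then have "A y1 w1 = 0"
      using Q.symmetric_zero_form[OF Wd(1) A_linear[of y1] inv[OF 1(1)] A_symmetric[OF 1(1)] _ 1(2)]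
      unfolding f_def by blast
    then show False using 1(3) by blast
  qed
  have top: "c \<le> m" if v: "v \<in> W" "v \<noteq> 0" "A y v = c *\<^sub>R v" for v c
  proof -
    obtain t where t: "t > 0" "t *\<^sub>R v \<in> W" "Q (t *\<^sub>R v) (t *\<^sub>R v) = 1"
      using Q.unit_nonempty[OF Wd(1) v(1,2)] by blast
    have "f y (t *\<^sub>R v) = c * Q (t *\<^sub>R v) (t *\<^sub>R v)"
      by (simp add: f_def linear_scale[OF A_linear] v(3) Q.scale_left Q.scale_right)
    then show ?thesis using max[OF yw(1,2) t(2,3)] t(3) by (simp add: m_def)
  qed
  define E where "E = {v \<in> W. A y v = m *\<^sub>R v}"
  have E: "subspace E" unfolding E_def by (rule subspace_eigenspace[OF A_linear Wd(1)])
  \<comment> \<open>Every unit vector of the top eigenspace \<open>E\<close> attains the same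
    maximum. With it fixed, \<open>f\<close> is linear in its first argument and maximal at
    \<open>y\<close>, so it vanishes on the complement of \<open>y\<close>.\<close>
  have orth: "f x v = 0" if x: "x \<in> k" "q x y = 0" and v: "v \<in> E" for x v
  proof (cases "v = 0")
    case True
    then show ?thesis by (simp add: f_def Q.zero_right)
  next
    case False
    obtain t where t: "t > 0" "t *\<^sub>R v \<in> E" "Q (t *\<^sub>R v) (t *\<^sub>R v) = 1"
      using Q.unit_nonempty[OF E v False] by blast
    have fm: "f y (t *\<^sub>R v) = m" using t(2,3) by (simp add: E_def f_def Q.scale_left)
    have "f x (t *\<^sub>R v) = 0"
    proof (rule q.functional_maximizer[OF subspace_k _ yw(1,2) _ _ x])
      show "linear (\<lambda>x. f x (t *\<^sub>R v))"
        by (rule linearI) (simp_all add: f_def A_left Q.add_left Q.scale_left)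
      show "f y (t *\<^sub>R v) > 0" using fm m_pos by simp
      show "f x' (t *\<^sub>R v) \<le> f y (t *\<^sub>R v)" if "x' \<in> k" "q x' x' = 1" for x'
        using max[OF that, of "t *\<^sub>R v"] t fm by (simp add: E_def m_def)
    qed
    then show ?thesis using t(1) by (simp add: f_def linear_scale[OF A_linear] Q.scale_left Q.scale_right)
  qed
  \<comment> \<open>After its \<open>y\<close>-component is subtracted, an \<open>x\<close>
    commuting with \<open>y\<close> preserves \<open>E\<close> and has zero quadratic form there, so
    it kills \<open>w\<close>; only the multiple of \<open>y\<close> acts.\<close>
  have scalar: "\<exists>s. A x w = s *\<^sub>R w" if x: "x \<in> k" "br y x = 0" for x
  proof -
    define x' where "x' = x - q x y *\<^sub>R y"
    have x'k: "x' \<in> k" unfolding x'_def using x yw by (intro subspace_diff subspace_scale subspace_k) auto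
    have "q x' y = 0" using yw(2) by (simp add: x'_def q.bilinear_simps)
    have "br y x' = 0" using x(2) by (simp add: x'_def br_simps)
    then have "cbr (y, 0) (x', 0) = 0" by (simp add: cbracket_def prod_eq_iff)
    then have comm: "A y (A x' v) = A x' (A y v)" for v
      using C.jacobi[of "(y, 0)" "(x', 0)" v] by (simp add: A_def cbr_J_right)
    have inv': "A x' v \<in> E" if "v \<in> E" for v
      using that inv[OF x'k] by (simp add: E_def comm linear_scale[OF A_linear])
    have "w \<in> E" using yw(3) Aw by (simp add: E_def)
    then have "A x' w = 0"
      using orth[OF x'k \<open>q x' y = 0\<close>]
        Q.symmetric_zero_form[OF E A_linear[of x'] inv' A_symmetric[OF x'k]]
      unfolding f_def by blast
    moreover have "x = x' + q x y *\<^sub>R y" by (simp add: x'_def)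
    ultimately have "A x w = (q x y * m) *\<^sub>R w" by (metis A_left Aw add_0 scaleR_scaleR)
    then show ?thesis by blast
  qed
  have "cbr z w \<in> span {w, J w}" if z: "z \<in> kC" "A y z = 0" for z
  proof -
    have "br y (fst z) = 0" "br y (snd z) = 0" "fst z \<in> k" "snd z \<in> k"
      using z by (simp_all add: A_def J_def cbracket_def prod_eq_iff kC_iff)
    then obtain s t where st: "A (fst z) w = s *\<^sub>R w" "A (snd z) w = t *\<^sub>R w" using scalar by metis
    have "z = (fst z, 0) + J (snd z, 0)" by (simp add: J_def)
    then have "cbr z w = cbr (fst z, 0) w + A (snd z) w" by (metis A_ad C.br_add_left)
    also have "cbr (fst z, 0) w = - J (A (fst z) w)" by (simp add: A_def)
    finally have "cbr z w = t *\<^sub>R w + (- s) *\<^sub>R J w" by (simp add: st linear_scale[OF J_linear])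
    then show ?thesis unfolding span_pair by blast
  qed
  moreover have "w \<noteq> 0" using yw(4) Q.zero_left[of 0] by auto
  ultimately show ?thesis using yw(1,3) m_pos Aw top by blast
qed

text \<open>Raising elements kill \<open>w\<close> by maximality, so the span of
  \<open>lowered y w\<close> is a submodule and equals \<open>W\<close>. Each generator lies in the
  complex line of \<open>w\<close> or has a smaller eigenvalue.\<close>

lemma extremal_ex:
  assumes "irreducible W"
  shows "\<exists>y m w. extremal W y m w"
proof -
  have W: "submodule W" "W \<noteq> {0}" using assms by (auto simp: irreducible_def)
  note Wd = submoduleD[OF W(1)]
  obtain y m w where y: "y \<in> k" "m > 0" "w \<in> W" "w \<noteq> 0" "A y w = m *\<^sub>R w"
    and top: "\<And>v c. v \<in> W \<Longrightarrow> v \<noteq> 0 \<Longrightarrow> A y v = c *\<^sub>R v \<Longrightarrow> c \<le> m"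
    and neutral: "\<And>z. z \<in> kC \<Longrightarrow> A y z = 0 \<Longrightarrow> cbr z w \<in> span {w, J w}"
    using maximal_eigenvalue_ex[OF W] by blast
  have raise: "cbr z w = 0" if z: "z \<in> kC" "A y z = a *\<^sub>R z" "a > 0" for z a
  proof (rule ccontr)
    assume "cbr z w \<noteq> 0"
    with top[OF Wd(4)[OF z(1) y(3)] this eigen_shift[OF z(2) y(5)]] z(3) show False by simp
  qed
  define X where "X = span (lowered y w)"
  have lowW: "u \<in> W" if "u \<in> lowered y w" for u
    using that by induction (use y Wd in auto)
  have XW: "X \<subseteq> W" unfolding X_def using lowW by (intro span_minimal Wd(1)) auto
  have "submodule X"
    unfolding submodule_def
  proof (intro conjI ballI)
    show "subspace X" by (simp add: X_def)
    show "X \<subseteq> pC" using XW Wd(2) by blast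
    show "J v \<in> X" if "v \<in> X" for v using that unfolding X_def by (rule span_lowered_J)
    have eig: "cbr z v \<in> X" if z: "z \<in> kC" "A y z = a *\<^sub>R z" and v: "v \<in> X" for z v a
      unfolding X_def
      by (rule linear_span_mem[OF C.br_linear subspace_span v[unfolded X_def]])
        (rule lowered_invariant[OF raise neutral _ z])
    show "cbr z v \<in> X" if "z \<in> kC" "v \<in> X" for z v
    proof -
      have "z \<in> span {z \<in> kC. \<exists>c. A y z = c *\<^sub>R z}" using that(1) kC_span_eigenvectors[OF y(1)] by simp
      then show ?thesis
        by (rule linear_span_mem[OF C.br_linear_left \<open>subspace X\<close>]) (use eig that(2) in blast)
    qed
  qed
  moreover have "w \<in> X" unfolding X_def by (intro span_base lowered.base)
  then have "X \<noteq> {0}" using y(4) by auto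
  ultimately have XeqW: "X = W" using assms XW by (auto simp: irreducible_def)
  define B where "B = {v \<in> W. \<exists>c'<m. A y v = c' *\<^sub>R v}"
  have low: "(A y u = m *\<^sub>R u \<and> u \<in> span {w, J w}) \<or> u \<in> B" if "u \<in> lowered y w" for u
    using that
  proof induction
    case base
    then show ?case using y(5) by (simp add: span_base)
  next
    case (J u)
    have "J u \<in> span {w, J w}" if u: "u \<in> span {w, J w}"
    proof -
      obtain s t where st: "u = s *\<^sub>R w + t *\<^sub>R J w" using u span_pair by blast
      then have "J u = (- t) *\<^sub>R w + s *\<^sub>R J w"
        by (simp add: linear_add[OF J_linear] linear_scale[OF J_linear])
      then show ?thesis unfolding span_pair by blast
    qed
    then show ?case using J.IH Wd(3)[of u] by (auto simp: A_J linear_scale[OF J_linear] B_def)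
  next
    case (lower u z a)
    have "\<exists>c\<le>m. A y u = c *\<^sub>R u" using lower.IH by (auto simp: B_def intro: less_imp_le)
    then obtain c where c: "c \<le> m" "A y u = c *\<^sub>R u" by blast
    have "A y (cbr z u) = (a + c) *\<^sub>R cbr z u" by (rule eigen_shift[OF lower(3) c(2)])
    moreover have "a + c < m" using c(1) lower(4) by simp
    moreover have "cbr z u \<in> W" using lowW[OF lower(1)] Wd(4) lower(2) by blast
    ultimately show ?case by (auto simp: B_def)
  qed
  have "lowered y w \<subseteq> span ({w, J w} \<union> B)"
  proof
    fix u assume "u \<in> lowered y w"
    then have "u \<in> span {w, J w} \<or> u \<in> B" using low by blast
    then show "u \<in> span ({w, J w} \<union> B)"
      using span_mono[of "{w, J w}" "{w, J w} \<union> B"] span_superset[of "{w, J w} \<union> B"] by blast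
  qed
  then have "W \<subseteq> span ({w, J w} \<union> B)"
    unfolding XeqW[symmetric] X_def by (intro span_minimal) auto
  then have "\<forall>v\<in>W. \<exists>e\<in>span {w, J w}. \<exists>r\<in>below W y m. v = e + r"
    unfolding span_Un below_def B_def by blast
  then show ?thesis using y unfolding extremal_def by blast
qed

end

section \<open>Complex eigenvectors and curves in subspaces\<close>

lemma cscale_linear: "linear (\<lambda>c. cscale c v)"
  by (rule linearI) (simp_all add: cscale_def algebra_simps)

lemma cscale_cscale: "cscale c (cscale d v) = cscale (c * d) v"
  by (simp add: cscale_def algebra_simps)

lemma exp_map_complex_eigenvector:
  fixes f :: "'a::euclidean_space \<times> 'a \<Rightarrow> 'a \<times> 'a"
  assumes "linear f" and f: "\<And>c v. f (cscale c v) = cscale c (f v)" "f v = cscale z v"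
  shows "exp_map f v = cscale (exp z) v"
proof -
  have "((\<lambda>t. cscale (exp (of_real t * z)) v) has_vector_derivative f (cscale (exp (of_real t * z)) v)) (at t)" for t
  proof -
    have "((\<lambda>u. exp (u * z)) has_field_derivative exp (of_real t * z) * z) (at (of_real t))"
      by (auto intro!: derivative_eq_intros)
    then have "((\<lambda>t. exp (of_real t * z)) has_vector_derivative exp (of_real t * z) * z) (at t)"
      by (rule has_vector_derivative_real_field)
    then have "((\<lambda>t. cscale (exp (of_real t * z)) v) has_vector_derivative cscale (exp (of_real t * z) * z) v) (at t)"
      using bounded_linear.has_vector_derivative[OF linear_conv_bounded_linear[THEN iffD1, OF cscale_linear]] by blast
    then show ?thesis by (simp add: f cscale_cscale)
  qed
  from linear_ode_unique[OF assms(1) this, of 1] show ?thesis by (simp add: cscale_def)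
qed

text \<open>A linear projection onto \<open>S\<close> fixes the curve and therefore its derivative.
  This passes from invariance under the group to invariance under \<open>kC\<close>.\<close>

lemma vector_derivative_in_subspace:
  fixes f :: "real \<Rightarrow> 'a::euclidean_space"
  assumes "subspace S" "\<And>t. f t \<in> S" "(f has_vector_derivative D) (at t)"
  shows "D \<in> S"
proof -
  obtain P where P: "linear P" "range P \<subseteq> S" "\<And>v. v \<in> S \<Longrightarrow> P v = v"
    using linear_exists_left_inverse_on[OF linear_id assms(1) inj_on_id] by auto
  have "((\<lambda>t. P (f t)) has_vector_derivative P D) (at t)"
    by (rule bounded_linear.has_vector_derivative[OF linear_conv_bounded_linear[THEN iffD1, OF P(1)] assms(3)])
  then have "(f has_vector_derivative P D) (at t)" by (simp add: P(3) assms(2))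
  then have "D = P D" using vector_derivative_unique_at[OF assms(3)] by blast
  then show ?thesis using P(2) by (metis rangeI subsetD)
qed

context cartan_simple
begin

subsection \<open>The action of the complex group\<close>

abbreviation KG :: "('a \<times> 'a \<Rightarrow> 'a \<times> 'a) set" where "KG \<equiv> adjoint_group cbr kC"
abbreviation orb :: "'a \<times> 'a \<Rightarrow> ('a \<times> 'a) set" where "orb \<equiv> K_orbit br k"

lemma KG_linear: "g \<in> KG \<Longrightarrow> linear g" by (rule C.adjoint_group_linear)

lemma KG_inverse: "g \<in> KG \<Longrightarrow> \<exists>g'\<in>KG. (\<forall>v. g' (g v) = v) \<and> (\<forall>v. g (g' v) = v)"
  by (rule C.adjoint_group_inverse[OF _ subspace_neg[OF subspace_kC]])

lemma KG_kC: "g \<in> KG \<Longrightarrow> z \<in> kC \<Longrightarrow> g z \<in> kC"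
  by (rule C.adjoint_group_mem[OF _ subspace_kC kC_mult])

lemma KG_submodule: "g \<in> KG \<Longrightarrow> submodule W \<Longrightarrow> v \<in> W \<Longrightarrow> g v \<in> W"
  by (rule C.adjoint_group_mem[OF _ submoduleD(1) submoduleD(4)])


lemma KG_J: "g \<in> KG \<Longrightarrow> J (g v) = g (J v)"
  by (rule C.adjoint_group_commute[OF _ J_linear]) (simp_all add: cbr_J_right)

lemma orb_iff: "u \<in> orb v \<longleftrightarrow> (\<exists>g\<in>KG. u = g v)" by (auto simp: K_orbit_def)

lemma orb_self: "v \<in> orb v"
  unfolding orb_iff by (rule bexI[OF _ adjoint_group.one]) simp

lemma orb_KG: "g \<in> KG \<Longrightarrow> u \<in> orb v \<Longrightarrow> g u \<in> orb v"
  unfolding orb_iff using C.adjoint_group_comp[of g kC] by (metis comp_apply)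

lemma orb_subset:
  assumes "u \<in> orb v"
  shows "orb u \<subseteq> orb v"
proof
  fix a assume "a \<in> orb u"
  then obtain g where "g \<in> KG" "a = g u" by (auto simp: orb_iff)
  then show "a \<in> orb v" using orb_KG assms by simp
qed

lemma orb_eq:
  assumes "u \<in> orb v"
  shows "orb u = orb v"
proof -
  obtain g where g: "g \<in> KG" "u = g v" using assms orb_iff by blast
  obtain g' where "g' \<in> KG" "v = g' u" using KG_inverse[OF g(1)] g(2) by metis
  then have "v \<in> orb u" using orb_iff by blast
  then show ?thesis using orb_subset assms by blast
qed

lemma KG_nilpotent:
  assumes "g \<in> KG" "ad_nilpotent cbr v"
  shows "ad_nilpotent cbr (g v)"
proof -
  obtain g' where g': "\<And>v. g (g' v) = v" using KG_inverse[OF assms(1)] by blast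
  obtain n where n: "\<And>y. (cbr v ^^ n) y = 0" using assms(2) by (auto simp: ad_nilpotent_def)
  have "(cbr (g v) ^^ n) (g y) = g ((cbr v ^^ n) y)" for y n
    by (induction n) (simp_all add: C.adjoint_group_bracket[OF assms(1)])
  then have "(cbr (g v) ^^ n) y = 0" for y
    using n g' linear_0[OF KG_linear[OF assms(1)]] by metis
  then show ?thesis by (auto simp: ad_nilpotent_def)
qed

lemma orb_scale:
  assumes "x \<in> pC" "ad_nilpotent cbr x" "c > 0"
  shows "c *\<^sub>R x \<in> orb x"
proof -
  obtain h where h: "h \<in> kC" "cbr h x = x" using nilpotent_eigen[OF assms(1,2)] by blast
  have "exp_map (cbr (ln c *\<^sub>R h)) x = exp (ln c) *\<^sub>R x"
    by (rule exp_map_eigenvector[OF C.br_linear]) (simp add: C.br_scale_left h(2))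
  moreover have "exp_map (cbr (ln c *\<^sub>R h)) \<in> KG"
    using h(1) by (intro C.adjoint_group_exp subspace_scale[OF subspace_kC])
  ultimately show ?thesis using assms(3) unfolding orb_iff by (metis exp_ln)
qed

section \<open>Closed invariant cones and contraction along a flow\<close>

definition invariant_cone :: "('a \<times> 'a) set \<Rightarrow> bool" where
  "invariant_cone S \<longleftrightarrow> closed S \<and> (\<forall>g\<in>KG. \<forall>u\<in>S. g u \<in> S) \<and> (\<forall>c>0. \<forall>u\<in>S. c *\<^sub>R u \<in> S)"

lemma closure_linear_mem:
  fixes f :: "'a \<times> 'a \<Rightarrow> 'a \<times> 'a"
  assumes "linear f" "\<And>u. u \<in> S \<Longrightarrow> f u \<in> S" "u \<in> closure S"
  shows "f u \<in> closure S"
proof -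
  have "f u \<in> closure (f ` S)" using closure_linear_image_subset[OF assms(1)] assms(3) by blast
  moreover have "closure (f ` S) \<subseteq> closure S" using assms(2) by (intro closure_mono) auto
  ultimately show ?thesis by blast
qed

lemma closure_orb_cone:
  assumes "x \<in> pC" "ad_nilpotent cbr x"
  shows "invariant_cone (closure (orb x))"
  unfolding invariant_cone_def
proof (intro conjI ballI allI impI closed_closure)
  show "g u \<in> closure (orb x)" if "g \<in> KG" "u \<in> closure (orb x)" for g u
    by (rule closure_linear_mem[OF KG_linear[OF that(1)] orb_KG[OF that(1)] that(2)])
  fix c :: real and u assume c: "c > 0" and u: "u \<in> closure (orb x)"
  have "c *\<^sub>R v \<in> orb x" if v: "v \<in> orb x" for v
  proof -
    obtain g where g: "g \<in> KG" "v = g x" using v orb_iff by blast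
    have "c *\<^sub>R v = g (c *\<^sub>R x)" by (simp add: g(2) linear_scale[OF KG_linear[OF g(1)]])
    then show ?thesis using orb_KG[OF g(1) orb_scale[OF assms c]] by simp
  qed
  then show "c *\<^sub>R u \<in> closure (orb x)"
    by (rule closure_linear_mem[OF linear_scale_self _ u])
qed

lemma cone_orb_subset: "invariant_cone S \<Longrightarrow> u \<in> S \<Longrightarrow> orb u \<subseteq> S"
  by (auto simp: invariant_cone_def orb_iff)

definition flow :: "'a \<Rightarrow> real \<Rightarrow> 'a \<times> 'a \<Rightarrow> 'a \<times> 'a" where
  "flow y s = exp_map (cbr (s *\<^sub>R J (y, 0)))"

lemma flow_KG: "y \<in> k \<Longrightarrow> flow y s \<in> KG"
  unfolding flow_def by (intro C.adjoint_group_exp subspace_scale[OF subspace_kC] J_real_kC)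

lemma flow_linear: "linear (flow y s)"
  unfolding flow_def by (rule C.exp_ad_linear)

lemma flow_eigen: "A y v = c *\<^sub>R v \<Longrightarrow> flow y s v = exp (c * s) *\<^sub>R v"
  unfolding flow_def
  by (subst exp_map_eigenvector[OF C.br_linear, where c="c * s"]) (simp_all add: C.br_scale_left A_ad mult.commute)


text \<open>The flow of \<open>i y\<close>, rescaled to fix eigenvectors for \<open>c\<close>; those
  with smaller eigenvalues shrink to 0. Integer times suffice for limits.\<close>

definition contract :: "'a \<Rightarrow> real \<Rightarrow> nat \<Rightarrow> 'a \<times> 'a \<Rightarrow> 'a \<times> 'a" where
  "contract y c j v = exp (- (c * real j)) *\<^sub>R flow y (real j) v"

lemma contract_linear: "linear (contract y c j)"
  unfolding contract_def[abs_def] by (rule linear_compose_scale_right[OF flow_linear])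

lemma contract_eigen: "A y v = c *\<^sub>R v \<Longrightarrow> contract y c j v = v"
  using flow_eigen[of y v c "real j"] by (simp add: contract_def exp_minus)

lemma cone_contract: "invariant_cone S \<Longrightarrow> y \<in> k \<Longrightarrow> u \<in> S \<Longrightarrow> contract y c j u \<in> S"
  using flow_KG[of y] by (auto simp: invariant_cone_def contract_def)

lemma contract_limit:
  assumes "r \<in> below W y c"
  shows "(\<lambda>j. contract y c j r) \<longlonglongrightarrow> 0"
  using assms unfolding below_def
proof (rule span_induct)
  have "(\<lambda>j. contract y c j (u + v)) \<longlonglongrightarrow> 0"
    if "(\<lambda>j. contract y c j u) \<longlonglongrightarrow> 0" "(\<lambda>j. contract y c j v) \<longlonglongrightarrow> 0" for u v
    using tendsto_add[OF that] by (simp add: linear_add[OF contract_linear])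
  moreover have "(\<lambda>j. contract y c j (s *\<^sub>R u)) \<longlonglongrightarrow> 0"
    if "(\<lambda>j. contract y c j u) \<longlonglongrightarrow> 0" for u s
    using tendsto_scaleR[OF tendsto_const that, of s] by (simp add: linear_scale[OF contract_linear])
  ultimately show "subspace {r. (\<lambda>j. contract y c j r) \<longlonglongrightarrow> 0}"
    by (auto simp: subspace_def linear_0[OF contract_linear])
  fix r assume "r \<in> {v \<in> W. \<exists>c'<c. A y v = c' *\<^sub>R v}"
  then obtain d where d: "d < c" "A y r = d *\<^sub>R r" by blast
  have eq: "contract y c j r = (exp (- (c - d)) ^ j) *\<^sub>R r" for j
    by (simp add: contract_def flow_eigen[OF d(2)] exp_add[symmetric] exp_of_nat_mult[symmetric] algebra_simps)
  have "(\<lambda>j. exp (- (c - d)) ^ j) \<longlonglongrightarrow> 0"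
    using d(1) by (intro LIMSEQ_realpow_zero) auto
  from tendsto_scaleR[OF this tendsto_const, of r] show "(\<lambda>j. contract y c j r) \<longlonglongrightarrow> 0"
    by (simp add: eq)
qed

section \<open>Spans of eigenspaces below a threshold\<close>

lemma below_subspace: "subspace (below W y c)" by (simp add: below_def)

lemma below_subset: "submodule W \<Longrightarrow> below W y c \<subseteq> W"
  unfolding below_def by (rule span_minimal) (auto dest: submoduleD(1))

lemma below_map:
  assumes "linear f" "subspace S" "r \<in> below W y c"
    and "\<And>v c'. v \<in> W \<Longrightarrow> c' < c \<Longrightarrow> A y v = c' *\<^sub>R v \<Longrightarrow> f v \<in> S"
  shows "f r \<in> S"
  using linear_span_mem[OF assms(1,2) assms(3)[unfolded below_def]] assms(4) by blast

lemma below_base: "v \<in> W \<Longrightarrow> c' < c \<Longrightarrow> A y v = c' *\<^sub>R v \<Longrightarrow> v \<in> below W y c"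
  unfolding below_def by (rule span_base) blast

lemma below_A:
  assumes "submodule W" "y \<in> k" "r \<in> below W y c"
  shows "A y r \<in> below W y c"
  by (rule below_map[OF A_linear below_subspace assms(3)])
    (metis A_linear A_submodule assms(1,2) below_base linear_scale)

lemma below_J:
  assumes "submodule W" "r \<in> below W y c"
  shows "J r \<in> below W y c"
  by (rule below_map[OF J_linear below_subspace assms(2)])
    (metis A_J J_linear assms(1) below_base linear_scale submoduleD(3))

lemma below_orthogonal:
  assumes "y \<in> k" "r \<in> below W y c" "A y u = a *\<^sub>R u" "c \<le> a"
  shows "Q u r = 0"
proof -
  have "Q u r \<in> {0}"
  proof (rule below_map[OF Q.lin_right _ assms(2)])
    fix v c' assume v: "c' < c" "A y v = c' *\<^sub>R v"
    show "Q u v \<in> {0}"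
      using Q.eigenvectors_orthogonal[OF A_symmetric[OF assms(1)] assms(3) v(2)] v(1) assms(4) by simp
  qed simp
  then show ?thesis by simp
qed

lemma extremalD:
  assumes "extremal W y m w"
  shows "y \<in> k" "m > 0" "w \<in> W" "w \<noteq> 0" "A y w = m *\<^sub>R w"
    "v \<in> W \<Longrightarrow> \<exists>e\<in>span {w, J w}. \<exists>r\<in>below W y m. v = e + r"
  using assms by (auto simp: extremal_def)

lemma span_cscale: "e \<in> span {w, J w} \<longleftrightarrow> (\<exists>c. e = cscale c w)"
proof
  assume "e \<in> span {w, J w}"
  then obtain s t where "e = s *\<^sub>R w + t *\<^sub>R J w" using span_pair by blast
  then have "e = cscale (Complex s t) w" by (simp add: cscale_J)
  then show "\<exists>c. e = cscale c w" by blast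
qed (auto simp: cscale_J span_pair)

lemma cbr_cscale_left: "cbr (cscale c u) v = cscale c (cbr u v)"
  and cbr_cscale_right: "cbr u (cscale c v) = cscale c (cbr u v)"
  by (simp_all add: cscale_J C.br_simps cbr_J_left cbr_J_right)

lemma A_top:
  assumes "A y w = m *\<^sub>R w" "e \<in> span {w, J w}"
  shows "A y e = m *\<^sub>R e"
  using assms by (auto simp: span_pair linear_add[OF A_linear] linear_scale[OF A_linear] A_J
      linear_scale[OF J_linear] scaleR_add_right mult.commute)

text \<open>Bracketing with a complex multiple of \<open>i y\<close> is a complex multiple of
  \<open>A y\<close>: its exponential reaches every nonzero scalar on the line of \<open>w\<close>
  and preserves every \<open>below W y c\<close>.\<close>

lemma normalize_top:
  assumes W: "submodule W" and ex: "extremal W y m w" and e: "e \<in> span {w, J w}" "e \<noteq> 0"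
  shows "\<exists>g\<in>KG. g e = w \<and> (\<forall>r\<in>below W y c. g r \<in> below W y c)"
proof -
  note x = extremalD[OF ex]
  obtain a where a: "e = cscale a w" using e(1) span_cscale by blast
  have "a \<noteq> 0" using a e(2) by (auto simp: cscale_J)
  \<comment> \<open>Chosen so that the exponential of \<open>z * m\<close> is the inverse of the
    coefficient \<open>a\<close>.\<close>
  define z where "z = Ln (inverse a) / of_real m"
  define h where "h = cscale z (J (y, 0))"
  have hk: "h \<in> kC"
    unfolding h_def cscale_J
    by (intro subspace_add subspace_scale subspace_kC J_kC J_real_kC x(1))
  have h: "cbr h v = cscale z (A y v)" for v by (simp add: h_def cbr_cscale_left A_ad)
  have "cbr h e = cscale z (m *\<^sub>R e)" using A_top[OF x(5) e(1)] by (simp add: h)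
  also have "\<dots> = cscale (z * of_real m) e" by (simp add: cscale_def)
  finally have "exp_map (cbr h) e = cscale (exp (z * of_real m)) e"
    by (intro exp_map_complex_eigenvector C.br_linear cbr_cscale_right)
  also have "z * of_real m = Ln (inverse a)" using x(2) by (simp add: z_def)
  also have "exp (Ln (inverse a)) = inverse a" using \<open>a \<noteq> 0\<close> by simp
  also have "cscale (inverse a) e = w" using \<open>a \<noteq> 0\<close> by (simp add: a cscale_cscale) (simp add: cscale_J)
  finally have 1: "exp_map (cbr h) e = w" .
  have "exp_map (cbr h) r \<in> below W y c" if "r \<in> below W y c" for r
  proof (rule exp_map_mem[OF C.br_linear below_subspace _ that])
    fix v assume "v \<in> below W y c"
    then show "cbr h v \<in> below W y c"
      unfolding h cscale_J
      by (intro subspace_add subspace_scale below_subspace below_J[OF W] below_A[OF W x(1)])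
  qed
  then show ?thesis using 1 C.adjoint_group_exp[OF hk] by blast
qed

lemma extremal_not_below:
  assumes "extremal W y m w" "e \<in> span {w, J w}" "e \<in> below W y m"
  shows "e = 0"
  using below_orthogonal[OF extremalD(1)[OF assms(1)] assms(3) A_top[OF extremalD(5)[OF assms(1)] assms(2)]] Q.eq_zero
  by simp

text \<open>The vectors of \<open>W\<close> whose whole orbit stays below the top form a submodule,
  by differentiation along one-parameter groups. It misses \<open>w\<close>, so irreducibility makes
  it zero.\<close>

lemma escapes_below:
  assumes irr: "irreducible W" and ex: "extremal W y m w" and x: "x \<in> W" "x \<noteq> 0"
  shows "\<exists>g\<in>KG. g x \<notin> below W y m"
proof (rule ccontr)
  assume no: "\<not> ?thesis"
  have W: "submodule W" using irr by (simp add: irreducible_def)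
  define Y where "Y = {u \<in> W. \<forall>g\<in>KG. g u \<in> below W y m}"
  have "submodule Y"
    unfolding submodule_def
  proof (intro conjI ballI)
    show "subspace Y"
      using submoduleD(1)[OF W] below_subspace[of W y m] unfolding subspace_def Y_def
      by (auto simp: linear_0[OF KG_linear] linear_add[OF KG_linear] linear_scale[OF KG_linear])
    show "Y \<subseteq> pC" using submoduleD(2)[OF W] by (auto simp: Y_def)
    show "J v \<in> Y" if "v \<in> Y" for v
      using that submoduleD(3)[OF W] below_J[OF W] by (auto simp: Y_def KG_J[symmetric])
    fix z v assume z: "z \<in> kC" and v: "v \<in> Y"
    have "g (cbr z v) \<in> below W y m" if g: "g \<in> KG" for g
    proof (rule vector_derivative_in_subspace[OF below_subspace])
      have "(\<lambda>x. t *\<^sub>R cbr z x) = cbr (t *\<^sub>R z)" for t by (rule ext) (simp add: C.br_scale_left)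
      then have "((\<lambda>t. exp_map (cbr (t *\<^sub>R z)) v) has_vector_derivative cbr z v) (at 0)"
        using exp_map_has_vector_derivative[OF C.br_linear[of z], of v 0] by (simp add: exp_map_zero)
      from bounded_linear.has_vector_derivative[OF linear_conv_bounded_linear[THEN iffD1, OF KG_linear[OF g]] this]
      show "((\<lambda>t. g (exp_map (cbr (t *\<^sub>R z)) v)) has_vector_derivative g (cbr z v)) (at 0)"
        by (simp add: C.exp_ad_zero)
      fix t :: real
      have "g \<circ> exp_map (cbr (t *\<^sub>R z)) \<in> KG"
        using z by (intro C.adjoint_group_comp g C.adjoint_group_exp subspace_scale[OF subspace_kC])
      then show "g (exp_map (cbr (t *\<^sub>R z)) v) \<in> below W y m" using v by (force simp: Y_def)
    qed
    then show "cbr z v \<in> Y" using z v submoduleD(4)[OF W] by (auto simp: Y_def)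
  qed
  moreover have "Y \<subseteq> W" by (auto simp: Y_def)
  moreover have "x \<in> Y" using no x(1) by (auto simp: Y_def)
  then have "Y \<noteq> {0}" using x(2) by blast
  ultimately have "Y = W" using irr by (auto simp: irreducible_def)
  then have "w \<in> Y" using extremalD(3)[OF ex] by simp
  then have "w \<in> below W y m" using adjoint_group.one[of cbr kC] unfolding Y_def by force
  then have "w = 0" by (intro extremal_not_below[OF ex]) (auto intro: span_base)
  then show False using extremalD(4)[OF ex] by blast
qed

text \<open>A translate of \<open>x\<close> with nonzero top component \<open>e\<close> contracts to
  \<open>e\<close>, and \<open>e\<close> is moved to \<open>w\<close> within its complex
  line.\<close>

lemma cone_contains_extremal:
  assumes irr: "irreducible W" and ex: "extremal W y m w" and S: "invariant_cone S"
    and x: "x \<in> S" "x \<in> W" "x \<noteq> 0"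
  shows "w \<in> S"
proof -
  have W: "submodule W" using irr by (simp add: irreducible_def)
  note xd = extremalD[OF ex]
  obtain g where g: "g \<in> KG" "g x \<notin> below W y m" using escapes_below[OF irr ex x(2,3)] by blast
  obtain e r where er: "e \<in> span {w, J w}" "r \<in> below W y m" "g x = e + r"
    using xd(6)[OF KG_submodule[OF g(1) W x(2)]] by blast
  have "e \<noteq> 0" using er g(2) by auto
  have gS: "g x \<in> S" using S g(1) x(1) by (auto simp: invariant_cone_def)
  have "(\<lambda>j. contract y m j e + contract y m j r) \<longlonglongrightarrow> e + 0"
    unfolding contract_eigen[OF A_top[OF xd(5) er(1)]]
    by (intro tendsto_add tendsto_const contract_limit[OF er(2)])
  then have "(\<lambda>j. contract y m j (g x)) \<longlonglongrightarrow> e" by (simp add: er(3) linear_add[OF contract_linear])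
  then have "e \<in> S"
  proof (rule Lim_in_closed_set[rotated 3])
    show "closed S" using S by (simp add: invariant_cone_def)
    show "\<forall>\<^sub>F j in sequentially. contract y m j (g x) \<in> S"
      by (intro always_eventually allI cone_contract[OF S xd(1) gS])
  qed simp
  moreover obtain h where "h \<in> KG" "h e = w" using normalize_top[OF W ex er(1) \<open>e \<noteq> 0\<close>] by blast
  ultimately show ?thesis using S unfolding invariant_cone_def by metis
qed

text \<open>\<open>ad w\<close> raises eigenvalues of \<open>A y\<close> by \<open>m\<close>, and
  all of them lie between \<open>- K\<close> and \<open>K\<close>. A power \<open>n\<close> with
  \<open>n * m > 2 * K\<close> thus kills every eigenvector, and these span.\<close>

lemma eigenvector_nilpotent:
  assumes y: "y \<in> k" and w: "A y w = m *\<^sub>R w" "m > 0"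
  shows "ad_nilpotent cbr w"
proof -
  obtain K where K: "\<And>v. norm (A y v) \<le> K * norm v"
    using linear_bounded_pos[OF A_linear[of y]] by metis
  have bound: "\<bar>c\<bar> \<le> K" if "A y v = c *\<^sub>R v" "v \<noteq> 0" for v c
    using K[of v] that by simp
  obtain n :: nat where n: "2 * K < real n * m" using reals_Archimedean3[OF w(2)] by blast
  have shift: "A y ((cbr w ^^ j) v) = (real j * m + c) *\<^sub>R (cbr w ^^ j) v" if "A y v = c *\<^sub>R v" for j v c
  proof (induction j)
    case 0
    then show ?case using that by simp
  next
    case (Suc j)
    from eigen_shift[OF w(1) Suc] show ?case by (simp add: algebra_simps)
  qed
  have eig: "(cbr w ^^ n) v = 0" if v: "A y v = c *\<^sub>R v" for v c
  proof (rule ccontr)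
    assume nz: "(cbr w ^^ n) v \<noteq> 0"
    then have "v \<noteq> 0" using linear_0[OF linear_funpow[OF C.br_linear]] by metis
    with bound[OF v] bound[OF shift[OF v] nz] n show False by linarith
  qed
  have "span {v \<in> UNIV. \<exists>c. A y v = c *\<^sub>R v} = UNIV"
    by (rule Q.span_eigenvectors[OF subspace_UNIV A_linear _ A_symmetric[OF y]]) simp
  moreover have "span {v \<in> UNIV. \<exists>c. A y v = c *\<^sub>R v} \<subseteq> {v. (cbr w ^^ n) v = 0}"
  proof (rule span_minimal)
    show "subspace {v. (cbr w ^^ n) v = 0}"
      by (rule linear_subspace_kernel[OF linear_funpow[OF C.br_linear]])
  qed (use eig in blast)
  ultimately show ?thesis unfolding ad_nilpotent_def by blast
qed

end

context cartan_simple
begin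

subsection \<open>The orbit of an extremal vector is closed up to zero\<close>

text \<open>The orthogonal projection onto \<open>kC\<close>. Precomposing with it makes
  \<open>tangent x\<close> the range of a linear map on the whole space, as semicontinuity of the
  rank requires.\<close>

definition kproj :: "'a \<times> 'a \<Rightarrow> 'a \<times> 'a" where
  "kproj z = ((1 / 2) *\<^sub>R (fst z + \<theta> (fst z)), (1 / 2) *\<^sub>R (snd z + \<theta> (snd z)))"

lemma kproj_linear: "linear kproj"
  by (rule linearI) (simp_all add: kproj_def \<theta>_simps algebra_simps)

lemma kproj_kC: "kproj z \<in> kC"
  by (simp add: kproj_def complexify_def k_def \<theta>_simps add.commute)

lemma kproj_id: "z \<in> kC \<Longrightarrow> kproj z = z"
proof -
  assume "z \<in> kC"
  then have "\<theta> (fst z) = fst z" "\<theta> (snd z) = snd z" unfolding kC_iff by (simp_all add: k_def)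
  then show ?thesis by (simp add: kproj_def prod_eq_iff scaleR_2[symmetric])
qed

lemma below_mono: "c \<le> d \<Longrightarrow> below W y c \<subseteq> below W y d"
  unfolding below_def by (intro span_mono) (auto intro: less_le_trans)

section \<open>Tangent spaces of orbits\<close>

definition tangent :: "'a \<times> 'a \<Rightarrow> ('a \<times> 'a) set" where
  "tangent x = (\<lambda>z. cbr z x) ` kC"

lemma tangent_subspace: "subspace (tangent x)"
  unfolding tangent_def by (rule linear_subspace_image[OF C.br_linear_left subspace_kC])

lemma tangent_range: "tangent x = range (\<lambda>z. cbr (kproj z) x)"
proof
  show "tangent x \<subseteq> range (\<lambda>z. cbr (kproj z) x)"
    unfolding tangent_def
  proof
    fix t assume "t \<in> (\<lambda>z. cbr z x) ` kC"
    then obtain z where "z \<in> kC" "t = cbr z x" by blast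
    then have "t = cbr (kproj z) x" by (simp add: kproj_id)
    then show "t \<in> range (\<lambda>z. cbr (kproj z) x)" by blast
  qed
  show "range (\<lambda>z. cbr (kproj z) x) \<subseteq> tangent x"
    unfolding tangent_def using kproj_kC by blast
qed

lemma tangent_KG:
  assumes "g \<in> KG"
  shows "g ` tangent x = tangent (g x)"
proof -
  obtain g' where g': "g' \<in> KG" "\<And>v. g (g' v) = v" using KG_inverse[OF assms] by blast
  have "g (cbr z x) \<in> tangent (g x)" if "z \<in> kC" for z
    using KG_kC[OF assms that] by (simp add: tangent_def C.adjoint_group_bracket[OF assms])
  moreover have "cbr z (g x) \<in> g ` tangent x" if "z \<in> kC" for z
  proof -
    have "cbr z (g x) = g (cbr (g' z) x)" by (simp add: C.adjoint_group_bracket[OF assms] g'(2))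
    then show ?thesis using KG_kC[OF g'(1) that] by (auto simp: tangent_def)
  qed
  ultimately show ?thesis by (auto simp: tangent_def)
qed

lemma tangent_scale:
  assumes "c \<noteq> 0"
  shows "tangent (c *\<^sub>R x) = tangent x"
proof -
  have "cbr z (c *\<^sub>R x) \<in> tangent x" if "z \<in> kC" for z
    using subspace_scale[OF tangent_subspace, of "cbr z x"] that
    by (simp add: C.br_scale_right tangent_def)
  moreover have "cbr z x \<in> tangent (c *\<^sub>R x)" if "z \<in> kC" for z
  proof -
    have "cbr z x = inverse c *\<^sub>R cbr z (c *\<^sub>R x)" using assms by (simp add: C.br_scale_right)
    then show ?thesis
      using subspace_scale[OF tangent_subspace, of "cbr z (c *\<^sub>R x)" "c *\<^sub>R x"] that by (simp add: tangent_def)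
  qed
  ultimately show ?thesis unfolding tangent_def[of "c *\<^sub>R x"] tangent_def[of x] by (auto simp: tangent_def)
qed

text \<open>The two rescalings may differ because scaling the base point leaves its tangent space
  unchanged. Later the point is contracted with the top eigenvalue and a tangent vector with a lower
  one.\<close>

lemma contract_tangent: "y \<in> k \<Longrightarrow> contract y c j ` tangent x \<subseteq> tangent (contract y d j x)"
proof
  fix u assume y: "y \<in> k" and "u \<in> contract y c j ` tangent x"
  then obtain v where v: "v \<in> tangent x" "u = exp (- (c * real j)) *\<^sub>R flow y (real j) v"
    by (auto simp: contract_def)
  have "flow y (real j) v \<in> tangent (flow y (real j) x)"
    using tangent_KG[OF flow_KG[OF y]] v(1) by blast
  then have "u \<in> tangent (flow y (real j) x)"
    unfolding v(2) by (rule subspace_scale[OF tangent_subspace])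
  then show "u \<in> tangent (contract y d j x)" by (simp add: contract_def tangent_scale)
qed

lemma tangent_dim_closure:
  assumes "y \<in> closure (orb w)"
  shows "dim (tangent y) \<le> dim (tangent w)"
proof -
  obtain f where f: "\<And>n. f n \<in> orb w" "f \<longlonglongrightarrow> y" using assms closure_sequential by blast
  have lin: "linear (\<lambda>z. cbr (kproj z) x)" for x
    using linear_compose[OF kproj_linear C.br_linear_left[of x]] by (simp add: o_def)
  have lim: "(\<lambda>n. cbr (kproj z) (f n)) \<longlonglongrightarrow> cbr (kproj z) y" for z
    by (intro bounded_bilinear.tendsto[OF C.bounded_bilinear] tendsto_const f(2))
  have "dim (range (\<lambda>z. cbr (kproj z) (f n))) \<le> dim (tangent w)" for n
  proof -
    obtain g where g: "g \<in> KG" "f n = g w" using f(1)[of n] by (auto simp: orb_iff)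
    show ?thesis
      unfolding tangent_range[symmetric] g(2) tangent_KG[OF g(1), symmetric]
      by (rule dim_image_le[OF KG_linear[OF g(1)]])
  qed
  from rank_lower_semicontinuous[OF lin lin lim this] show ?thesis by (simp add: tangent_range)
qed

text \<open>The flow of \<open>A y\<close>, suitably rescaled, moves \<open>x\<close> to \<open>w\<close> and a vector of \<open>tangent x\<close> to
  \<open>n\<close>. Were \<open>n \<noteq> 0\<close>, the limit of the tangent spaces would be larger than \<open>tangent w\<close>.\<close>

lemma transversal_part_zero:
  assumes W: "submodule W" and ex: "extremal W y m w"
    and x: "x = w + n + l" "x \<in> pC" "ad_nilpotent cbr x" "x \<in> closure (orb w)"
    and n: "A y n = c *\<^sub>R n" "c < m" "n \<in> W" and l: "l \<in> below W y c"
    and orth: "\<And>t. t \<in> tangent w \<Longrightarrow> Q n t = 0"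
  shows "n = 0"
proof -
  note xd = extremalD[OF ex]
  have wpC: "w \<in> pC" using submoduleD(2)[OF W xd(3)] .
  have wnil: "ad_nilpotent cbr w" by (rule eigenvector_nilpotent[OF xd(1) xd(5) xd(2)])
  note cone = closure_orb_cone[OF wpC wnil]
  \<comment> \<open>\<open>A y - m\<close> removes \<open>w\<close> from \<open>x\<close> and
    multiplies \<open>n\<close> by \<open>c - m\<close>. The result is tangent at \<open>x\<close>:
    \<open>A y x\<close> is the bracket with \<open>i y\<close>, and the nilpotent \<open>x\<close>
    is itself of the form \<open>cbr h x\<close>.\<close>
  define u where "u = inverse (c - m) *\<^sub>R (A y x - m *\<^sub>R x)"
  define l' where "l' = inverse (c - m) *\<^sub>R (A y l - m *\<^sub>R l)"
  have l': "l' \<in> below W y c"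
    unfolding l'_def by (intro subspace_scale subspace_diff below_subspace below_A[OF W xd(1)] l)
  have "A y x - m *\<^sub>R x = (c - m) *\<^sub>R n + (A y l - m *\<^sub>R l)"
    by (simp add: x(1) linear_add[OF A_linear] xd(5) n(1) algebra_simps)
  then have u: "u = n + l'" using n(2) by (simp add: u_def l'_def scaleR_add_right)
  have "x \<in> tangent x" using nilpotent_eigen[OF x(2,3)] by (force simp: tangent_def)
  moreover have "A y x \<in> tangent x" unfolding A_ad tangent_def using J_real_kC[OF xd(1)] by blast
  ultimately have ut: "u \<in> tangent x"
    unfolding u_def by (intro subspace_scale subspace_diff tangent_subspace)
  \<comment> \<open>The point is rescaled with \<open>m\<close>, so that it tends to
    \<open>w\<close>, the tangent vector with \<open>c\<close>, so that it tends to
    \<open>n\<close>.\<close>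
  define f where "f j = contract y m j x" for j
  define \<eta> where "\<eta> j = contract y c j u" for j
  have below_m: "n + l \<in> below W y m"
    by (rule subspace_add[OF below_subspace below_base[OF n(3,2,1)]])
      (use below_mono[of c m] n(2) l in auto)
  have "(\<lambda>j. contract y m j w + contract y m j (n + l)) \<longlonglongrightarrow> w + 0"
    unfolding contract_eigen[OF xd(5)] by (intro tendsto_add tendsto_const contract_limit[OF below_m])
  then have f_lim: "f \<longlonglongrightarrow> w"
    by (simp add: f_def[abs_def] x(1) linear_add[OF contract_linear] add.assoc)
  have "(\<lambda>j. contract y c j n + contract y c j l') \<longlonglongrightarrow> n + 0"
    unfolding contract_eigen[OF n(1)] by (intro tendsto_add tendsto_const contract_limit[OF l'])
  then have \<eta>_lim: "\<eta> \<longlonglongrightarrow> n"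
    by (simp add: \<eta>_def[abs_def] u linear_add[OF contract_linear])
  have f_closure: "f j \<in> closure (orb w)" for j
    unfolding f_def by (rule cone_contract[OF cone xd(1) x(4)])
  have \<eta>_tangent: "\<eta> j \<in> tangent (f j)" for j
    using contract_tangent[OF xd(1), of c j x m] ut unfolding \<eta>_def f_def by blast
  \<comment> \<open>The tangent map at \<open>a\<close> with one extra column \<open>b\<close>. For
    \<open>b\<close> tangent at \<open>a\<close> the rank does not grow, so in the limit adjoining
    \<open>n\<close> to \<open>tangent w\<close> does not enlarge it, although \<open>n\<close> is
    orthogonal to it.\<close>
  define F where "F a b z = cbr (kproj (fst z)) a + snd z *\<^sub>R b" for a b and z :: "('a \<times> 'a) \<times> real"
  have F_linear: "linear (F a b)" for a b
    by (rule linearI) (simp_all add: F_def linear_add[OF kproj_linear] linear_scale[OF kproj_linear]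
        C.br_simps scaleR_add_left scaleR_add_right)
  have "(\<lambda>j. F (f j) (\<eta> j) z) \<longlonglongrightarrow> F w n z" for z
    unfolding F_def
    by (intro tendsto_add tendsto_scaleR tendsto_const \<eta>_lim f_lim
        bounded_bilinear.tendsto[OF C.bounded_bilinear])
  moreover have "dim (range (F (f j) (\<eta> j))) \<le> dim (tangent w)" for j
  proof -
    have "F (f j) (\<eta> j) z \<in> tangent (f j)" for z
      unfolding F_def
      by (intro subspace_add subspace_scale tangent_subspace \<eta>_tangent) (simp add: tangent_def kproj_kC)
    then have "range (F (f j) (\<eta> j)) \<subseteq> tangent (f j)" by blast
    then have "dim (range (F (f j) (\<eta> j))) \<le> dim (tangent (f j))" by (rule dim_subset)
    then show ?thesis using tangent_dim_closure[OF f_closure[of j]] by linarith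
  qed
  ultimately have "dim (range (F w n)) \<le> dim (tangent w)"
    by (rule rank_lower_semicontinuous[OF F_linear F_linear])
  moreover have "tangent w \<subseteq> range (F w n)"
  proof
    fix t assume "t \<in> tangent w"
    then obtain z where "z \<in> kC" "t = cbr z w" by (auto simp: tangent_def)
    then have "t = F w n (z, 0)" by (simp add: F_def kproj_id)
    then show "t \<in> range (F w n)" by blast
  qed
  moreover have "subspace (range (F w n))" by (rule linear_subspace_image[OF F_linear subspace_UNIV])
  ultimately have "tangent w = range (F w n)"
    by (intro subspace_dim_equal tangent_subspace)
  moreover have "n = F w n (0, 1)" by (simp add: F_def linear_0[OF kproj_linear])
  ultimately have "n \<in> tangent w" by (metis rangeI)
  then show ?thesis using orth Q.eq_zero by blast
qed

section \<open>Unipotent normal form near an extremal vector\<close>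

lemma below_empty:
  assumes "\<And>c'. c' < c \<Longrightarrow> c' \<notin> {c. \<exists>v. v \<noteq> 0 \<and> A y v = c *\<^sub>R v}" "r \<in> below W y c"
  shows "r = 0"
proof -
  have "{v \<in> W. \<exists>c'<c. A y v = c' *\<^sub>R v} \<subseteq> {0}" using assms(1) by blast
  moreover have "subspace {0::'a \<times> 'a}" by (simp add: subspace_def)
  ultimately have "below W y c \<subseteq> {0}" unfolding below_def by (rule span_minimal)
  then show ?thesis using assms(2) by blast
qed

text \<open>No eigenvalue lies strictly between \<open>c'\<close> and \<open>c\<close>, so peeling
  off the eigenspace of \<open>c'\<close> lowers the bound from \<open>c\<close> to
  \<open>c'\<close>.\<close>

lemma below_split:
  assumes W: "submodule W" and c': "c' < c"
    and gap: "\<And>d v. d < c \<Longrightarrow> A y v = d *\<^sub>R v \<Longrightarrow> v \<noteq> 0 \<Longrightarrow> d \<le> c'" and r: "r \<in> below W y c"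
  shows "\<exists>e\<in>W. \<exists>l\<in>below W y c'. A y e = c' *\<^sub>R e \<and> r = e + l"
proof -
  define E where "E = {e \<in> W. A y e = c' *\<^sub>R e}"
  have E: "subspace E" unfolding E_def by (rule subspace_eigenspace[OF A_linear submoduleD(1)[OF W]])
  have "id r \<in> {e + l |e l. e \<in> E \<and> l \<in> below W y c'}"
  proof (rule below_map[OF linear_id subspace_sums[OF E below_subspace] r])
    fix v d assume v: "v \<in> W" "d < c" "A y v = d *\<^sub>R v"
    show "id v \<in> {e + l |e l. e \<in> E \<and> l \<in> below W y c'}"
    proof (cases "v = 0 \<or> d = c'")
      case True
      then have "v \<in> E" using v by (auto simp: E_def linear_0[OF A_linear])
      moreover have "v = v + 0" by simp
      ultimately show ?thesis using subspace_0[OF below_subspace, of W y c'] unfolding id_apply by blast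
    next
      case False
      then have "d < c'" using gap[OF v(2,3)] by auto
      then have "v \<in> below W y c'" using below_base v by blast
      moreover have "v = 0 + v" by simp
      ultimately show ?thesis using subspace_0[OF E] unfolding id_apply by blast
    qed
  qed
  then show ?thesis unfolding E_def id_apply by blast
qed

text \<open>Unipotent elements of \<open>KG\<close> push the part of \<open>x - w\<close> below \<open>w\<close> to lower and lower
  eigenvalues of \<open>A y\<close>.\<close>

lemma extremal_orbit_normal_form:
  assumes W: "submodule W" and ex: "extremal W y m w"
    and "x = w + r" "r \<in> below W y c" "c \<le> m" "ad_nilpotent cbr x" "x \<in> closure (orb w)"
  shows "x \<in> orb w"
proof -
  note xd = extremalD[OF ex]
  have wpC: "w \<in> pC" using submoduleD(2)[OF W xd(3)] .
  have wnil: "ad_nilpotent cbr w" by (rule eigenvector_nilpotent[OF xd(1) xd(5) xd(2)])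
  define \<Lambda> where "\<Lambda> = {c. \<exists>v. v \<noteq> 0 \<and> A y v = c *\<^sub>R v}"
  have fin: "finite \<Lambda>" unfolding \<Lambda>_def by (rule Q.finite_eigenvalues[OF A_symmetric[OF xd(1)]])
  show ?thesis
    using assms(3-)
  proof (induction "card {d \<in> \<Lambda>. d < c}" arbitrary: x r c rule: less_induct)
    case less
    have finc: "finite {d \<in> \<Lambda>. d < c}" using fin by simp
    show ?case
    proof (cases "{d \<in> \<Lambda>. d < c} = {}")
      case True
      then have "r = 0" using below_empty[OF _ less.prems(2)] unfolding \<Lambda>_def by blast
      then show ?thesis using less.prems(1) orb_self by simp
    next
      case False
      define c' where "c' = Max {d \<in> \<Lambda>. d < c}"
      have c': "c' \<in> \<Lambda>" "c' < c" using Max_in[OF finc False] by (simp_all add: c'_def)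
      have gap: "d \<le> c'" if "d < c" "A y v = d *\<^sub>R v" "v \<noteq> 0" for d v
      proof -
        have "d \<in> {d \<in> \<Lambda>. d < c}" unfolding \<Lambda>_def using that by blast
        then show ?thesis unfolding c'_def by (rule Max_ge[OF finc])
      qed
      have c'm: "c' < m" using c'(2) less.prems(3) by simp
      have "\<exists>e\<in>W. \<exists>l\<in>below W y c'. A y e = c' *\<^sub>R e \<and> r = e + l"
        by (rule below_split[OF W c'(2) _ less.prems(2)]) (rule gap)
      then obtain e l where el: "e \<in> W" "l \<in> below W y c'" "A y e = c' *\<^sub>R e" "r = e + l" by blast
      \<comment> \<open>Elements of \<open>\<Xi>\<close> send \<open>w\<close> into the eigenspace
        of \<open>c'\<close>. The part \<open>s\<close> of \<open>e\<close> obtained in this way is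
        removed by the exponential of \<open>- z\<close>; the rest \<open>n\<close> is orthogonal to
        all such vectors.\<close>
      define \<Xi> where "\<Xi> = {z \<in> kC. A y z = (c' - m) *\<^sub>R z}"
      have "subspace \<Xi>" unfolding \<Xi>_def by (rule subspace_eigenspace[OF A_linear subspace_kC])
      then have R: "subspace ((\<lambda>z. cbr z w) ` \<Xi>)" by (rule linear_subspace_image[OF C.br_linear_left])
      obtain s where s: "s \<in> (\<lambda>z. cbr z w) ` \<Xi>" "\<And>t. t \<in> (\<lambda>z. cbr z w) ` \<Xi> \<Longrightarrow> Q (e - s) t = 0"
        using Q.projection_ex[OF R] by blast
      obtain z where z: "z \<in> kC" "A y z = (c' - m) *\<^sub>R z" "s = cbr z w" using s(1) by (auto simp: \<Xi>_def)
      define n where "n = e - s"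
      have sW: "s \<in> W" unfolding z(3) using submoduleD(4)[OF W z(1) xd(3)] .
      have As: "A y s = c' *\<^sub>R s" using eigen_shift[OF z(2) xd(5)] by (simp add: z(3))
      have nW: "n \<in> W" unfolding n_def using el(1) sW subspace_diff[OF submoduleD(1)[OF W]] by blast
      have An: "A y n = c' *\<^sub>R n" by (simp add: n_def linear_diff[OF A_linear] el(3) As scaleR_diff_right)
      have lower: "cbr z v \<in> below W y c'" if "v \<in> below W y c" for v
      proof (rule below_map[OF C.br_linear below_subspace that])
        fix v d assume v: "v \<in> W" "d < c" "A y v = d *\<^sub>R v"
        have "c' - m + d < c'" using v(2) less.prems(3) by simp
        then show "cbr z v \<in> below W y c'"
          by (rule below_base[OF submoduleD(4)[OF W z(1) v(1)] _ eigen_shift[OF z(2) v(3)]])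
      qed
      have mono: "v \<in> below W y c" if "v \<in> below W y c'" for v
        using below_mono[of c' c W y] c'(2) that by auto
      have s_c: "s \<in> below W y c" by (rule below_base[OF sW c'(2) As])
      define f where "f = cbr (- z)"
      have f: "f v = - cbr z v" for v by (simp add: f_def C.br_minus_left)
      define x' where "x' = exp_map f x"
      have fx: "f x = - s - cbr z r" by (simp add: f less.prems(1) C.br_add_right z(3))
      \<comment> \<open>\<open>f\<close> shifts eigenvalues by \<open>c' - m\<close>, and
        \<open>c \<le> m\<close>, so it takes \<open>below W y c\<close> into
        \<open>below W y c'\<close>. Since \<open>f x\<close> is already below \<open>c\<close>, all
        terms from the second order on are below \<open>c'\<close>.\<close>
      have "exp_map f x - x - f x \<in> below W y c'"
      proof (rule exp_map_second_order_mem[OF _ below_subspace])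
        show "linear f" unfolding f_def by (rule C.br_linear)
        show "f v \<in> below W y c'" if "v \<in> below W y c'" for v
          unfolding f by (intro subspace_neg below_subspace lower mono that)
        have "f x \<in> below W y c"
          unfolding fx by (intro subspace_diff subspace_neg below_subspace s_c mono lower less.prems(2))
        then show "f (f x) \<in> below W y c'"
          unfolding f[of "f x"] by (intro subspace_neg below_subspace lower)
      qed
      then have "(exp_map f x - x - f x) + (l - cbr z r) \<in> below W y c'"
        by (rule subspace_add[OF below_subspace])
          (intro subspace_diff below_subspace el(2) lower less.prems(2))
      moreover have "(exp_map f x - x - f x) + (l - cbr z r) = x' - (w + n)"
        unfolding x'_def fx n_def by (simp add: less.prems(1) el(4))
      ultimately have "x' - (w + n) \<in> below W y c'" by simp
      then obtain l' where l': "l' \<in> below W y c'" "x' = w + n + l'" by (metis add.commute diff_add_cancel)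
      have g: "exp_map f \<in> KG"
        unfolding f_def by (intro C.adjoint_group_exp subspace_neg[OF subspace_kC] z(1))
      have x'nil: "ad_nilpotent cbr x'" unfolding x'_def by (rule KG_nilpotent[OF g less.prems(4)])
      have x'cl: "x' \<in> closure (orb w)"
        unfolding x'_def by (rule closure_linear_mem[OF KG_linear[OF g] orb_KG[OF g] less.prems(5)])
      have below_W: "l' \<in> W" using l'(1) below_subset[OF W] by blast
      have "x' \<in> W" unfolding l'(2) by (intro subspace_add submoduleD(1)[OF W] xd(3) nW below_W)
      then have x'pC: "x' \<in> pC" by (rule submoduleD(2)[OF W])
      \<comment> \<open>Only eigenvectors \<open>z'\<close> for \<open>c' - m\<close> send
        \<open>w\<close> into the eigenspace of \<open>n\<close>, and there \<open>n\<close> is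
        orthogonal by projection; for the others distinct eigenspaces are orthogonal.\<close>
      have "Q n t = 0" if t: "t \<in> tangent w" for t
      proof -
        obtain z' where z': "z' \<in> kC" "t = cbr z' w" using t by (auto simp: tangent_def)
        have "z' \<in> span {z \<in> kC. \<exists>a. A y z = a *\<^sub>R z}" using z'(1) kC_span_eigenvectors[OF xd(1)] by simp
        then have "Q n (cbr z' w) = 0"
        proof (rule span_induct)
          show "subspace {z'. Q n (cbr z' w) = 0}"
            by (auto simp: subspace_def C.br_simps Q.bilinear_simps)
          fix z' assume "z' \<in> {z \<in> kC. \<exists>a. A y z = a *\<^sub>R z}"
          then obtain a where a: "z' \<in> kC" "A y z' = a *\<^sub>R z'" by blast
          show "Q n (cbr z' w) = 0"
          proof (cases "a = c' - m")
            case True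
            then have "cbr z' w \<in> (\<lambda>z. cbr z w) ` \<Xi>" using a by (simp add: \<Xi>_def)
            then show ?thesis using s(2) by (simp add: n_def)
          next
            case False
            show ?thesis
              by (rule Q.eigenvectors_orthogonal[OF A_symmetric[OF xd(1)] An eigen_shift[OF a(2) xd(5)]])
                (use False in simp)
          qed
        qed
        then show ?thesis by (simp add: z'(2))
      qed
      then have "n = 0"
        by (rule transversal_part_zero[OF W ex l'(2) x'pC x'nil x'cl An c'm nW l'(1)])
      then have x'w: "x' = w + l'" using l'(2) by simp
      have "{d \<in> \<Lambda>. d < c'} \<subset> {d \<in> \<Lambda>. d < c}" using c' by auto
      then have "card {d \<in> \<Lambda>. d < c'} < card {d \<in> \<Lambda>. d < c}" by (rule psubset_card_mono[OF finc])
      from less.hyps[OF this x'w l'(1) _ x'nil x'cl] have "x' \<in> orb w" using c'm by simp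
      moreover have "x' \<in> orb x" unfolding x'_def by (rule orb_KG[OF g orb_self])
      ultimately have "orb x = orb w" using orb_eq by metis
      then show ?thesis using orb_self by blast
    qed
  qed
qed

text \<open>A translate of \<open>x\<close> with nonzero top component, normalised to
  \<open>w\<close>, has the shape \<open>w + r\<close> from which the normal form starts.\<close>

lemma extremal_orbit_closure:
  assumes irr: "irreducible W" and ex: "extremal W y m w"
    and x: "x \<in> W" "x \<noteq> 0" "ad_nilpotent cbr x" "x \<in> closure (orb w)"
  shows "x \<in> orb w"
proof -
  have W: "submodule W" using irr by (simp add: irreducible_def)
  note xd = extremalD[OF ex]
  obtain g where g: "g \<in> KG" "g x \<notin> below W y m" using escapes_below[OF irr ex x(1,2)] by blast
  obtain e r where er: "e \<in> span {w, J w}" "r \<in> below W y m" "g x = e + r"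
    using xd(6)[OF KG_submodule[OF g(1) W x(1)]] by blast
  have "e \<noteq> 0" using er g(2) by auto
  then obtain h where h: "h \<in> KG" "h e = w" "\<And>r. r \<in> below W y m \<Longrightarrow> h r \<in> below W y m"
    using normalize_top[OF W ex er(1)] by blast
  have hg: "h \<circ> g \<in> KG" by (rule C.adjoint_group_comp[OF h(1) g(1)])
  have "(h \<circ> g) x = w + h r" by (simp add: er(3) linear_add[OF KG_linear[OF h(1)]] h(2))
  then have "(h \<circ> g) x \<in> orb w"
    using KG_nilpotent[OF hg x(3)] closure_linear_mem[OF KG_linear[OF hg] orb_KG[OF hg] x(4)]
    by (intro extremal_orbit_normal_form[OF W ex _ h(3)[OF er(2)] order_refl])
  moreover have "(h \<circ> g) x \<in> orb x" by (rule orb_KG[OF hg orb_self])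
  ultimately have "orb x = orb w" using orb_eq by metis
  then show ?thesis using orb_self by blast
qed


subsection \<open>Minimal orbits\<close>

lemma orb_zero: "orb 0 = {0}"
  using orb_self[of 0] by (auto simp: orb_iff linear_0[OF KG_linear])

lemma nilpotent_orbits_nonzero:
  "U \<in> nilpotent_K_orbits br k p - {{0}} \<longleftrightarrow> (\<exists>v\<in>pC. v \<noteq> 0 \<and> ad_nilpotent cbr v \<and> U = orb v)"
proof -
  have "orb v = {0} \<longleftrightarrow> v = 0" for v using orb_self[of v] orb_zero by auto
  then show ?thesis unfolding nilpotent_K_orbits_def by blast
qed

lemma minimal_orbit_representative:
  assumes "U \<in> minimal_nilpotent_K_orbits br k p"
  shows "\<exists>v. v \<in> pC \<and> v \<noteq> 0 \<and> ad_nilpotent cbr v \<and> U = orb v"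
proof -
  have "U \<in> nilpotent_K_orbits br k p - {{0}}"
    using assms unfolding minimal_nilpotent_K_orbits_def mem_Collect_eq by (rule conjunct1)
  then show ?thesis unfolding nilpotent_orbits_nonzero by blast
qed

lemma orb_subset_submodule:
  assumes "submodule W" "v \<in> W"
  shows "orb v \<subseteq> W"
proof
  fix u assume "u \<in> orb v"
  then obtain g where "g \<in> KG" "u = g v" unfolding orb_iff by blast
  then show "u \<in> W" using KG_submodule assms by simp
qed

lemma extremal_orbit_minimal:
  assumes irr: "irreducible W" and ex: "extremal W y m w"
  shows "orb w \<in> minimal_nilpotent_K_orbits br k p"
  unfolding minimal_nilpotent_K_orbits_def
proof (intro CollectI conjI ballI impI)
  have W: "submodule W" using irr by (simp add: irreducible_def)
  note xd = extremalD[OF ex]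
  show "orb w \<in> nilpotent_K_orbits br k p - {{0}}"
    unfolding nilpotent_orbits_nonzero
    using submoduleD(2)[OF W xd(3)] xd(4) eigenvector_nilpotent[OF xd(1) xd(5) xd(2)] by blast
  fix V assume V: "V \<in> nilpotent_K_orbits br k p - {{0}}" "V \<subseteq> closure (orb w)"
  then obtain v where v: "v \<in> pC" "v \<noteq> 0" "ad_nilpotent cbr v" "V = orb v"
    using nilpotent_orbits_nonzero by blast
  have vc: "v \<in> closure (orb w)" using V(2) v(4) orb_self by blast
  \<comment> \<open>A submodule is invariant and, as a finite-dimensional subspace, closed; so
    \<open>v\<close> stays in the irreducible \<open>W\<close>.\<close>
  have "closure (orb w) \<subseteq> W"
    by (intro closure_minimal orb_subset_submodule[OF W xd(3)] closed_subspace submoduleD(1)[OF W])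
  then have "v \<in> orb w" using extremal_orbit_closure[OF irr ex _ v(2,3) vc] vc by blast
  then show "V = orb w" using orb_eq v(4) by simp
qed

lemma minimal_orbit_eq:
  assumes U: "U \<in> minimal_nilpotent_K_orbits br k p" and "U = orb v" "v \<in> pC" "ad_nilpotent cbr v"
    and ex: "extremal W y m w" and irr: "irreducible W" and w: "w \<in> closure (orb v)"
  shows "U = orb w"
proof -
  have "orb w \<in> nilpotent_K_orbits br k p - {{0}}"
    using extremal_orbit_minimal[OF irr ex] by (simp add: minimal_nilpotent_K_orbits_def)
  moreover have "orb w \<subseteq> closure U"
    unfolding assms(2) by (rule cone_orb_subset[OF closure_orb_cone[OF assms(3,4)] w])
  ultimately show ?thesis using U unfolding minimal_nilpotent_K_orbits_def by blast
qed

theorem card_minimal_non_hermitian: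
  assumes "lie_center br k = {0}" "p \<noteq> {0}"
  shows "card (minimal_nilpotent_K_orbits br k p) = 1"
proof -
  have "pC \<noteq> {0}"
  proof -
    obtain x where "x \<in> p" "x \<noteq> 0" using assms(2) subspace_0[OF subspace_p] by auto
    then have "(x, 0) \<in> pC" "(x, 0) \<noteq> 0" using subspace_0[OF subspace_p] by (auto simp: complexify_def prod_eq_iff)
    then show ?thesis by blast
  qed
  then have irr: "irreducible pC" by (rule pC_irreducible[OF assms(1)])
  obtain y m w where ex: "extremal pC y m w" using extremal_ex[OF irr] by blast
  have "U = orb w" if U: "U \<in> minimal_nilpotent_K_orbits br k p" for U
  proof -
    obtain v where v: "v \<in> pC" "v \<noteq> 0" "ad_nilpotent cbr v" "U = orb v"
      using minimal_orbit_representative[OF U] by blast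
    have "w \<in> closure (orb v)"
      using orb_self[of v] closure_subset
      by (intro cone_contains_extremal[OF irr ex closure_orb_cone[OF v(1,3)] _ v(1,2)]) blast
    then show ?thesis by (rule minimal_orbit_eq[OF U v(4,1,3) ex irr])
  qed
  then have "minimal_nilpotent_K_orbits br k p = {orb w}"
    using extremal_orbit_minimal[OF irr ex] by blast
  then show ?thesis by simp
qed

theorem card_minimal_hermitian:
  assumes "lie_center br k \<noteq> {0}"
  shows "card (minimal_nilpotent_K_orbits br k p) = 2"
proof -
  have "0 \<in> lie_center br k" using subspace_0[OF subspace_k] by (simp add: lie_center_def)
  then obtain z where z: "z \<in> k" "z \<noteq> 0" "\<And>x. x \<in> k \<Longrightarrow> br z x = 0"
    using assms by (auto simp: lie_center_def)
  obtain c where c: "c > 0" "irreducible (eigen z c)" "irreducible (eigen z (- c))"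
    and sum: "\<And>x. x \<in> pC \<Longrightarrow> \<exists>u\<in>eigen z c. \<exists>v\<in>eigen z (- c). x = u + v"
    using hermitian_decomposition[OF z] by blast
  have zn: "- z \<in> k" using z(1) subspace_neg[OF subspace_k] by blast
  have eigen_A: "A z v = d *\<^sub>R v" "A (- z) v = (- d) *\<^sub>R v" if "v \<in> eigen z d" for v d
  proof -
    have "(- z, 0) = - (z, 0::'a)" by simp
    then show "A z v = d *\<^sub>R v" "A (- z) v = (- d) *\<^sub>R v"
      using that by (simp_all only: A_def eigen_def mem_Collect_eq C.br_minus_left linear_neg[OF J_linear] scaleR_minus_left)
  qed
  obtain y m w where ex: "extremal (eigen z c) y m w" using extremal_ex[OF c(2)] by blast
  obtain y' m' w' where ex': "extremal (eigen z (- c)) y' m' w'" using extremal_ex[OF c(3)] by blast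
  text \<open>Contracting along \<open>z\<close> or \<open>- z\<close> isolates the components of \<open>v\<close>.\<close>
  have component: "u \<in> S"
    if S: "invariant_cone S" and v: "u + u' \<in> S" and b: "b \<in> k" "A b u = d *\<^sub>R u" "A b u' = d' *\<^sub>R u'" "d' < d" for S u u' b d d'
  proof -
    have "u' \<in> below UNIV b d" by (rule below_base[OF _ b(4,3)]) simp
    then have "(\<lambda>j. contract b d j u + contract b d j u') \<longlonglongrightarrow> u + 0"
      unfolding contract_eigen[OF b(2)] by (intro tendsto_add tendsto_const contract_limit)
    then have lim: "(\<lambda>j. contract b d j (u + u')) \<longlonglongrightarrow> u" by (simp add: linear_add[OF contract_linear])
    show ?thesis
    proof (rule Lim_in_closed_set[OF _ _ _ lim])
      show "closed S" using S by (simp add: invariant_cone_def)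
      show "\<forall>\<^sub>F j in sequentially. contract b d j (u + u') \<in> S"
        by (intro always_eventually allI cone_contract[OF S b(1) v])
    qed simp
  qed
  have "U = orb w \<or> U = orb w'" if U: "U \<in> minimal_nilpotent_K_orbits br k p" for U
  proof -
    obtain v where v: "v \<in> pC" "v \<noteq> 0" "ad_nilpotent cbr v" "U = orb v"
      using minimal_orbit_representative[OF U] by blast
    note cone = closure_orb_cone[OF v(1,3)]
    have vS: "v \<in> closure (orb v)" using orb_self[of v] closure_subset by blast
    obtain u u' where u: "u \<in> eigen z c" "u' \<in> eigen z (- c)" "v = u + u'" using sum[OF v(1)] by blast
    have "u \<in> closure (orb v)"
    proof (rule component[OF cone _ z(1) eigen_A(1)[OF u(1)] eigen_A(1)[OF u(2)]])
      show "u + u' \<in> closure (orb v)" using vS u(3)[symmetric] by simp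
    qed (use c(1) in simp)
    moreover have "u' \<in> closure (orb v)"
    proof (rule component[OF cone _ zn eigen_A(2)[OF u(2)] eigen_A(2)[OF u(1)]])
      show "u' + u \<in> closure (orb v)" using vS u(3)[symmetric] by (simp add: add.commute)
    qed (use c(1) in simp)
    moreover have "u \<noteq> 0 \<or> u' \<noteq> 0" using v(2) u(3) by auto
    ultimately have "w \<in> closure (orb v) \<or> w' \<in> closure (orb v)"
      using cone_contains_extremal[OF c(2) ex cone _ u(1)] cone_contains_extremal[OF c(3) ex' cone _ u(2)] by blast
    then show ?thesis
      using minimal_orbit_eq[OF U v(4,1,3) ex c(2)] minimal_orbit_eq[OF U v(4,1,3) ex' c(3)] by blast
  qed
  moreover have "orb w \<in> minimal_nilpotent_K_orbits br k p" "orb w' \<in> minimal_nilpotent_K_orbits br k p"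
    using extremal_orbit_minimal c(2,3) ex ex' by blast+
  ultimately have eq: "minimal_nilpotent_K_orbits br k p = {orb w, orb w'}" by blast
  \<comment> \<open>The two orbits lie in eigenspaces of the central element \<open>z\<close> for
    different eigenvalues.\<close>
  have "orb w \<noteq> orb w'"
  proof
    assume "orb w = orb w'"
    then have "w \<in> orb w'" using orb_self by metis
    moreover have "orb w' \<subseteq> eigen z (- c)"
      using c(3) extremalD(3)[OF ex'] by (intro orb_subset_submodule) (auto simp: irreducible_def)
    ultimately have "A z w = (- c) *\<^sub>R w" using eigen_A(1) by blast
    moreover have "A z w = c *\<^sub>R w" using eigen_A(1) extremalD(3)[OF ex] by blast
    ultimately have "c *\<^sub>R w = (- c) *\<^sub>R w" by simp
    then have "c = - c" using extremalD(4)[OF ex] unfolding scaleR_cancel_right by blast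
    then show False using c(1) extremalD(4)[OF ex] by simp
  qed
  then show ?thesis by (simp add: eq)
qed

end

theorem corollary1p6:
  fixes br :: "'a::euclidean_space \<Rightarrow> 'a \<Rightarrow> 'a"
    and k p :: "'a set"
  assumes "simple_lie_algebra scaleR br"
    and "\<not> compact_lie_algebra br"
    and "simple_lie_algebra cscale (cbracket br)"
    and "cartan_decomposition br k p"
  shows "(\<not> hermitian_type br k \<longrightarrow> card (minimal_nilpotent_K_orbits br k p) = 1) \<and>
         (hermitian_type br k \<longrightarrow> card (minimal_nilpotent_K_orbits br k p) = 2)"
proof -
  obtain \<theta> where \<theta>: "cartan_involution br \<theta>" "k = {x. \<theta> x = x}" "p = {x. \<theta> x = - x}"
    using assms(4) by (auto simp: cartan_decomposition_def)
  interpret S: simple_lie_algebra scaleR br by (rule assms(1))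
  interpret cartan_simple br \<theta>
    by (intro cartan_simple.intro real_lie_algebra.intro cartan_simple_axioms.intro
        S.lie_algebra_axioms assms(1,3) \<theta>(1))
  have kp: "cartan_simple.k \<theta> = k" "cartan_simple.p \<theta> = p"
    by (simp_all add: k_def p_def \<theta>)
  \<comment> \<open>With \<open>p = {0}\<close> the involution is the identity and the Killing form
    negative definite, so the adjoint group would be compact.\<close>
  have "p \<noteq> {0}"
  proof
    assume "p = {0}"
    then have "\<theta> x = x" for x
      using k_p_decomp[of x] kp by (auto simp: k_def)
    then have "compact_lie_algebra br"
      using \<theta>_pos by (intro compact_of_killing_negative) force
    then show False using assms(2) by blast
  qed
  then show ?thesis
    using card_minimal_non_hermitian card_minimal_hermitian unfolding kp hermitian_type_def by blast
qed

end
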